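(* Let $A$ be a unital commutative associative algebra over $\mathbb{C}$, let $B$ be a vertex $A$-algebroid, and let $g$ be an endomorphism of the vertex $A$-algebroid $B$. Then $g$ extends uniquely to an endomorphism of $V_B$ as an $\mathbb{N}$-graded vertex algebra. Furthermore, if $g$ is an automorphism, then the extension is an automorphism.
   Context: $\mathbb{N}=\{0,1,2,\dots\}$. Let $A$ be a unital commutative associative $\mathbb{C}$-algebra with identity $e$. A vertex $A$-algebroid is a $\mathbb{C}$-vector space $B$ with: a bilinear map $A\times B\to B$, $(a,v)\mapsto a*v$ (also written $av$), with $e*v=v$; a Leibniz algebra structure $[\cdot,\cdot]:B\otimes B\to B$; a homomorphism of Leibniz algebras $\pi:B\to \mathrm{Der}(A)$; a symmetric bilinear pairing $\langle\cdot,\cdot\rangle:B\otimes B\to A$; a linear map $\partial:A\to B$ with $\pi\circ\partial=0$; such that for $a,a'\in A$, $u,v,v_1,v_2\in B$: $a*(a'*v)-(aa')*v=\pi(v)(a)*\partial(a')+\pi(v)(a')*\partial(a)$; $[u,a*v]=\pi(u)(a)*v+a*[u,v]$; $[u,v]+[v,u]=\partial(\langle u,v\rangle)$; $\pi(a*v)=a\pi(v)$; $\langle a*u,v\rangle=a\langle u,v\rangle-\pi(u)(\pi(v)(a))$; $\pi(v)(\langle v_1,v_2\rangle)=\langle[v,v_1],v_2\rangle+\langle v_1,[v,v_2]\rangle$; $\partial(aa')=a*\partial(a')+a'*\partial(a)$; $[v,\partial(a)]=\partial(\pi(v)(a))$; $\langle v,\partial(a)\rangle=\pi(v)(a)$.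 On $C=A\oplus B$ write, for $a,a'\in A$, $u,v\in B$, $i=0,1$: $a_ia'=0$, $u_0v=[u,v]$, $u_1v=\langle u,v\rangle$, $u_0a=\pi(u)(a)$, $a_0u=-\pi(u)(a)$, and $a_1u=u_1a=0$. An endomorphism of the vertex $A$-algebroid $B$ is a linear map $f:A\oplus B\to A\oplus B$ with $f(A)\subset A$, $f(B)\subset B$ such that $f|_A$ is a (unital) associative algebra homomorphism, $f|_B$ is a Leibniz algebra homomorphism, $f(ab)=f(a)f(b)$ for $a\in A$, $b\in B$, $\langle f(u),f(v)\rangle=f(\langle u,v\rangle)$ for $u,v\in B$, $f\circ\partial=\partial\circ f$, and $f(b_0a)=f(b)_0f(a)$ for $a\in A$, $b\in B$. An automorphism is a bijective endomorphism. Construction of $V_B$. Let $L(A\oplus B)=(A\oplus B)\otimes\mathbb{C}[t,t^{-1}]$, $L(A)=A\otimes\mathbb{C}[t,t^{-1}]$, $\hat\partial=\partial\otimes1+1\otimes d/dt:L(A)\to L(A\oplus B)$. The quotient $\mathcal{L}=L(A\oplus B)/\hat\partial L(A)$ is a $\mathbb{Z}$-graded Lie algebra with bracket induced by $[a\otimes t^m,a'\otimes t^n]=0$, $[a\otimes t^m,b\otimes t^n]=a_0b\otimes t^{m+n}$, $[b\otimes t^n,a\otimes t^m]=b_0a\otimes t^{m+n}$, $[b\otimes t^m,b'\otimes t^n]=b_0b'\otimes t^{m+n}+m(b_1b')\otimes t^{m+n-1}$, and grading $\deg(a\otimes t^n)=-n-1$, $\deg(b\otimes t^n)=-n$. Write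 $u(n)$ for the image of $u\otimes t^n$. Let $\mathcal{L}^{\ge0}$ be the image of $(A\oplus B)\otimes\mathbb{C}[t]$ and $V_{\mathcal{L}}=U(\mathcal{L})\otimes_{U(\mathcal{L}^{\ge0})}\mathbb{C}$ with $\mathbb{C}$ trivial, of degree $0$; ${\bf 1}=1\otimes1$. $A\oplus B$ embeds in $V_{\mathcal{L}}$ by $u\mapsto u(-1){\bf 1}$, and $V_{\mathcal{L}}$ has a unique vertex algebra structure with vacuum ${\bf 1}$ and $Y(u,x)=\sum_{n\in\mathbb{Z}}u(n)x^{-n-1}$ for $u\in A\oplus B$; it is $\mathbb{N}$-graded with $A$ in degree $0$, $B$ in degree $1$. Put $E=\mathrm{span}\{e-{\bf 1},\,a(-1)a'-aa',\,a(-1)b-ab\mid a,a'\in A,\ b\in B\}\subset V_{\mathcal{L}}$ and $I_B=U(\mathcal{L})\mathbb{C}[\mathcal{D}]E$ where $\mathcal{D}v=v_{-2}{\bf 1}$; $I_B$ is a graded two-sided ideal and $V_B=V_{\mathcal{L}}/I_B$ is an $\mathbb{N}$-graded vertex algebra, with $(V_B)_{(0)}=A$, $(V_B)_{(1)}=B$, generated by $A\oplus B$. An endomorphism of a vertex algebra $V$ is a linear map $g$ with $g({\bf 1})={\bf 1}$ and $g(Y(u,x)v)=Y(g(u),x)g(v)$ for $u,v\in V$; an automorphism is a bijective endomorphism. An endomorphism of an $\mathbb{N}$-graded vertex algebra is a grading-preserving endomorphism of the vertex algebra. *)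

theory Defs
  imports
    Complex_Main
    "HOL-Algebra.Module"
    "HOL-Algebra.QuotRing"
    "HOL-Algebra.Algebraic_Closure_Type"
    "HOL-Library.FuncSet"
    "HOL-Library.Product_Plus"
    "HOL-Library.Poly_Mapping"
begin

section \<open>Vertex algebroids\<close>

text \<open>The class \<open>comm_ring\<close> has no built-in unit; using it with an explicit identity \<open>e\<close>
  keeps the zero algebra among the unital algebras.\<close>

locale unital_comm_algebra = vector_space scale
  for scale :: "complex \<Rightarrow> 'a::comm_ring \<Rightarrow> 'a" +
  fixes e :: 'a
  assumes e_mult: "e * a = a"
    and scale_mult: "scale c (a * a') = scale c a * a'"

definition bilinear_map ::
  "(complex \<Rightarrow> 'x::ab_group_add \<Rightarrow> 'x) \<Rightarrow> (complex \<Rightarrow> 'y::ab_group_add \<Rightarrow> 'y) \<Rightarrow>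
   (complex \<Rightarrow> 'z::ab_group_add \<Rightarrow> 'z) \<Rightarrow> ('x \<Rightarrow> 'y \<Rightarrow> 'z) \<Rightarrow> bool" where
  "bilinear_map s1 s2 s3 f \<longleftrightarrow>
     (\<forall>x. Vector_Spaces.linear s2 s3 (f x)) \<and> (\<forall>y. Vector_Spaces.linear s1 s3 (\<lambda>x. f x y))"

text \<open>The data of the algebra \<open>A\<close> (type \<open>'a\<close>) and of the vertex \<open>A\<close>-algebroid \<open>B\<close> (type \<open>'b\<close>):
  \<open>smulA\<close>, \<open>smulB\<close> are the scalar multiplications, \<open>idA\<close> is the identity \<open>e\<close> of \<open>A\<close>, and
  \<open>act\<close>, \<open>lbr\<close>, \<open>anchor\<close>, \<open>pairing\<close>, \<open>del\<close> are \<open>*\<close>, \<open>[\<cdot>,\<cdot>]\<close>, \<open>\<pi>\<close>, \<open>\<langle>\<cdot>,\<cdot>\<rangle>\<close>, \<open>\<partial>\<close>.\<close>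

record ('a, 'b) algebroid =
  smulA :: "complex \<Rightarrow> 'a \<Rightarrow> 'a"
  smulB :: "complex \<Rightarrow> 'b \<Rightarrow> 'b"
  idA :: 'a
  act :: "'a \<Rightarrow> 'b \<Rightarrow> 'b"
  lbr :: "'b \<Rightarrow> 'b \<Rightarrow> 'b"
  anchor :: "'b \<Rightarrow> 'a \<Rightarrow> 'a"
  pairing :: "'b \<Rightarrow> 'b \<Rightarrow> 'a"
  del :: "'a \<Rightarrow> 'b"

locale vertex_algebroid =
  fixes S :: "('a::comm_ring, 'b::ab_group_add) algebroid"
  assumes algebra_A: "unital_comm_algebra (smulA S) (idA S)"
    and vector_space_B: "vector_space (smulB S)"
    and act_bilinear: "bilinear_map (smulA S) (smulB S) (smulB S) (act S)"
    and act_id: "act S (idA S) v = v"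
    and lbr_bilinear: "bilinear_map (smulB S) (smulB S) (smulB S) (lbr S)"
    and lbr_leibniz: "lbr S u (lbr S v w) = lbr S (lbr S u v) w + lbr S v (lbr S u w)"
    and anchor_bilinear: "bilinear_map (smulB S) (smulA S) (smulA S) (anchor S)"
    and anchor_derivation: "anchor S v (a * a') = anchor S v a * a' + a * anchor S v a'"
    and anchor_lbr: "anchor S (lbr S u v) a = anchor S u (anchor S v a) - anchor S v (anchor S u a)"
    and pairing_bilinear: "bilinear_map (smulB S) (smulB S) (smulA S) (pairing S)"
    and pairing_sym: "pairing S u v = pairing S v u"
    and del_linear: "Vector_Spaces.linear (smulA S) (smulB S) (del S)"
    and anchor_del: "anchor S (del S a) a' = 0"
    and act_act: "act S a (act S a' v) - act S (a * a') v
           = act S (anchor S v a) (del S a') + act S (anchor S v a') (del S a)"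
    and lbr_act: "lbr S u (act S a v) = act S (anchor S u a) v + act S a (lbr S u v)"
    and lbr_skew: "lbr S u v + lbr S v u = del S (pairing S u v)"
    and anchor_act: "anchor S (act S a v) a' = a * anchor S v a'"
    and pairing_act: "pairing S (act S a u) v = a * pairing S u v - anchor S u (anchor S v a)"
    and anchor_pairing: "anchor S v (pairing S v1 v2)
           = pairing S (lbr S v v1) v2 + pairing S v1 (lbr S v v2)"
    and del_mult: "del S (a * a') = act S a (del S a') + act S a' (del S a)"
    and lbr_del: "lbr S v (del S a) = del S (anchor S v a)"
    and pairing_del: "pairing S v (del S a) = anchor S v a"

text \<open>\<open>C = A \<oplus> B\<close> is the product type, with \<open>a\<close> and \<open>b\<close> identified with \<open>(a, 0)\<close> and \<open>(0, b)\<close>.\<close>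

definition smulC :: "('a, 'b) algebroid \<Rightarrow> complex \<Rightarrow> 'a \<times> 'b \<Rightarrow> 'a \<times> 'b" where
  "smulC S c = map_prod (smulA S c) (smulB S c)"

text \<open>The products \<open>x\<^sub>0 y\<close> and \<open>x\<^sub>1 y\<close> on \<open>A \<oplus> B\<close>, extended bilinearly.\<close>

fun prod0 :: "('a::comm_ring, 'b) algebroid \<Rightarrow> 'a \<times> 'b \<Rightarrow> 'a \<times> 'b \<Rightarrow> 'a \<times> 'b" where
  "prod0 S (a, u) (a', v) = (anchor S u a' - anchor S v a, lbr S u v)"

fun prod1 :: "('a, 'b::zero) algebroid \<Rightarrow> 'a \<times> 'b \<Rightarrow> 'a \<times> 'b \<Rightarrow> 'a \<times> 'b" where
  "prod1 S (a, u) (a', v) = (pairing S u v, 0)"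

definition algebroid_endo ::
  "('a::comm_ring, 'b::ab_group_add) algebroid \<Rightarrow> ('a \<times> 'b \<Rightarrow> 'a \<times> 'b) \<Rightarrow> bool" where
  "algebroid_endo S f \<longleftrightarrow> Vector_Spaces.linear (smulC S) (smulC S) f \<and>
     (\<exists>fA fB.
        (\<forall>a. f (a, 0) = (fA a, 0)) \<and> (\<forall>b. f (0, b) = (0, fB b)) \<and>
        fA (idA S) = idA S \<and> (\<forall>a a'. fA (a * a') = fA a * fA a') \<and>
        (\<forall>u v. fB (lbr S u v) = lbr S (fB u) (fB v)) \<and>
        (\<forall>a b. fB (act S a b) = act S (fA a) (fB b)) \<and>
        (\<forall>u v. pairing S (fB u) (fB v) = fA (pairing S u v)) \<and>
        (\<forall>a. fB (del S a) = del S (fA a)) \<and>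
        (\<forall>a b. fA (anchor S b a) = anchor S (fB b) (fA a)))"

definition algebroid_aut ::
  "('a::comm_ring, 'b::ab_group_add) algebroid \<Rightarrow> ('a \<times> 'b \<Rightarrow> 'a \<times> 'b) \<Rightarrow> bool" where
  "algebroid_aut S f \<longleftrightarrow> algebroid_endo S f \<and> bij f"


section \<open>Quotients, spans and enveloping algebras over the complex numbers\<close>

abbreviation CC :: "complex ring" where
  "CC \<equiv> ring_of_type_algebra"

text \<open>Complex vector spaces are modules over \<open>CC\<close> in the sense of HOL-Algebra.  The record fields
  \<open>mult\<close> and \<open>one\<close> carry a possibly nonassociative, nonunital product: the bracket of a Lie algebra,
  or the product of an associative algebra.  They have no meaning for a mere vector space, and
  \<open>one\<close> has none for a Lie algebra.  The quotient by a subspace \<open>I\<close> consists of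
  cosets; its \<open>mult\<close> is the induced product when \<open>I\<close> is a two-sided ideal.\<close>

definition quotient_alg :: "(complex, 'v) module \<Rightarrow> 'v set \<Rightarrow> (complex, 'v set) module" where
  "quotient_alg M I = \<lparr>carrier = a_rcosets\<^bsub>M\<^esub> I, monoid.mult = rcoset_mult M I,
     one = I +>\<^bsub>M\<^esub> \<one>\<^bsub>M\<^esub>, zero = I, add = (<+>\<^bsub>M\<^esub>),
     module.smult = (\<lambda>c P. \<Union>x\<in>P. I +>\<^bsub>M\<^esub> (c \<odot>\<^bsub>M\<^esub> x))\<rparr>"

definition lin_span :: "(complex, 'v) module \<Rightarrow> 'v set \<Rightarrow> 'v set" where
  "lin_span M P = \<Inter>{W. submodule W CC M \<and> P \<subseteq> W}"

text \<open>Lists form the free monoid, so that \<^typ>\<open>'x list \<Rightarrow>\<^sub>0 complex\<close> is the free unital associative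
  algebra on the type \<open>'x\<close>.\<close>

instantiation list :: (type) monoid_add
begin
definition zero_list :: "'a list" where "zero_list = []"
definition plus_list :: "'a list \<Rightarrow> 'a list \<Rightarrow> 'a list" where "plus_list = append"
instance by standard (simp_all add: zero_list_def plus_list_def)
end

definition free_alg :: "'x set \<Rightarrow> (complex, 'x list \<Rightarrow>\<^sub>0 complex) module" where
  "free_alg P = \<lparr>carrier = {f. Poly_Mapping.keys f \<subseteq> lists P}, monoid.mult = (*), one = 1,
     zero = 0, add = (+), module.smult = (\<lambda>c. Poly_Mapping.map ((*) c))\<rparr>"

abbreviation gen :: "'x \<Rightarrow> 'x list \<Rightarrow>\<^sub>0 complex" where
  "gen x \<equiv> Poly_Mapping.single [x] 1"

text \<open>The universal enveloping algebra \<open>U(G)\<close> of a Lie algebra \<open>G\<close> with bracket \<open>\<otimes>\<^bsub>G\<^esub>\<close>: the first two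
  families of relations turn the free algebra on the set \<open>carrier G\<close> into the tensor algebra of the
  vector space \<open>G\<close>.\<close>

definition env_relations :: "(complex, 'x) module \<Rightarrow> ('x list \<Rightarrow>\<^sub>0 complex) set" where
  "env_relations G =
     {gen (x \<oplus>\<^bsub>G\<^esub> y) - gen x - gen y | x y. x \<in> carrier G \<and> y \<in> carrier G} \<union>
     {gen (c \<odot>\<^bsub>G\<^esub> x) - Poly_Mapping.single [x] c | c x. x \<in> carrier G} \<union>
     {gen x * gen y - gen y * gen x - gen (x \<otimes>\<^bsub>G\<^esub> y) | x y. x \<in> carrier G \<and> y \<in> carrier G}"

definition env_ideal :: "(complex, 'x) module \<Rightarrow> ('x list \<Rightarrow>\<^sub>0 complex) set" where
  "env_ideal G = Idl\<^bsub>free_alg (carrier G)\<^esub> (env_relations G)"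

definition env_alg :: "(complex, 'x) module \<Rightarrow> (complex, ('x list \<Rightarrow>\<^sub>0 complex) set) module" where
  "env_alg G = quotient_alg (free_alg (carrier G)) (env_ideal G)"

definition env_gen :: "(complex, 'x) module \<Rightarrow> 'x \<Rightarrow> ('x list \<Rightarrow>\<^sub>0 complex) set" where
  "env_gen G x = env_ideal G +>\<^bsub>free_alg (carrier G)\<^esub> gen x"

text \<open>For a Lie subalgebra \<open>H\<close> of \<open>G\<close>, the induced module \<open>U(G) \<otimes>\<^bsub>U(H)\<^esub> \<complex>\<close> of the trivial
  \<open>H\<close>-module \<open>\<complex>\<close> is \<open>U(G)/U(G)H\<close>, with \<open>u \<otimes> 1\<close> being the coset of \<open>u\<close>.\<close>

definition ind_ideal ::
  "(complex, 'x) module \<Rightarrow> 'x set \<Rightarrow> ('x list \<Rightarrow>\<^sub>0 complex) set set" where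
  "ind_ideal G H = lin_span (env_alg G)
     {u \<otimes>\<^bsub>env_alg G\<^esub> env_gen G x | u x. u \<in> carrier (env_alg G) \<and> x \<in> H}"

definition ind_module ::
  "(complex, 'x) module \<Rightarrow> 'x set \<Rightarrow> (complex, ('x list \<Rightarrow>\<^sub>0 complex) set set) module" where
  "ind_module G H = quotient_alg (env_alg G) (ind_ideal G H)"

definition ind_act ::
  "(complex, 'x) module \<Rightarrow> 'x set \<Rightarrow> ('x list \<Rightarrow>\<^sub>0 complex) set \<Rightarrow>
   ('x list \<Rightarrow>\<^sub>0 complex) set set \<Rightarrow> ('x list \<Rightarrow>\<^sub>0 complex) set set" where
  "ind_act G H u P = (\<Union>y\<in>P. ind_ideal G H +>\<^bsub>env_alg G\<^esub> (u \<otimes>\<^bsub>env_alg G\<^esub> y))"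

definition ind_one ::
  "(complex, 'x) module \<Rightarrow> 'x set \<Rightarrow> ('x list \<Rightarrow>\<^sub>0 complex) set set" where
  "ind_one G H = ind_ideal G H +>\<^bsub>env_alg G\<^esub> \<one>\<^bsub>env_alg G\<^esub>"


section \<open>Vertex algebras\<close>

text \<open>The sum of a finitely supported sequence (\<open>0\<close> if the support is infinite); by the truncation
  condition all sums below have finite support.\<close>

definition fsum :: "(complex, 'v) module \<Rightarrow> (nat \<Rightarrow> 'v) \<Rightarrow> 'v" where
  "fsum M f = (if finite {i. f i \<noteq> \<zero>\<^bsub>M\<^esub>} then finsum M f {i. f i \<noteq> \<zero>\<^bsub>M\<^esub>} else \<zero>\<^bsub>M\<^esub>)"

text \<open>\<open>Y u n v\<close> is \<open>u\<^sub>n v\<close>, the coefficient of \<open>x\<^bsup>-n-1\<^esup>\<close> in \<open>Y(u,x)v\<close>.  The axiom \<open>jacobi\<close> is the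
  Jacobi identity in components (Borcherds identity).\<close>

locale vertex_algebra = module CC V
  for V :: "(complex, 'v) module" +
  fixes vac :: 'v and Y :: "'v \<Rightarrow> int \<Rightarrow> 'v \<Rightarrow> 'v"
  assumes vac_closed: "vac \<in> carrier V"
    and Y_closed: "\<lbrakk>u \<in> carrier V; v \<in> carrier V\<rbrakk> \<Longrightarrow> Y u n v \<in> carrier V"
    and Y_add_left: "\<lbrakk>u \<in> carrier V; u' \<in> carrier V; v \<in> carrier V\<rbrakk> \<Longrightarrow>
           Y (u \<oplus>\<^bsub>V\<^esub> u') n v = Y u n v \<oplus>\<^bsub>V\<^esub> Y u' n v"
    and Y_smult_left: "\<lbrakk>u \<in> carrier V; v \<in> carrier V\<rbrakk> \<Longrightarrow> Y (c \<odot>\<^bsub>V\<^esub> u) n v = c \<odot>\<^bsub>V\<^esub> Y u n v"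
    and Y_add_right: "\<lbrakk>u \<in> carrier V; v \<in> carrier V; v' \<in> carrier V\<rbrakk> \<Longrightarrow>
           Y u n (v \<oplus>\<^bsub>V\<^esub> v') = Y u n v \<oplus>\<^bsub>V\<^esub> Y u n v'"
    and Y_smult_right: "\<lbrakk>u \<in> carrier V; v \<in> carrier V\<rbrakk> \<Longrightarrow> Y u n (c \<odot>\<^bsub>V\<^esub> v) = c \<odot>\<^bsub>V\<^esub> Y u n v"
    and truncation: "\<lbrakk>u \<in> carrier V; v \<in> carrier V\<rbrakk> \<Longrightarrow> \<exists>N. \<forall>n\<ge>N. Y u n v = \<zero>\<^bsub>V\<^esub>"
    and vacuum: "v \<in> carrier V \<Longrightarrow> Y vac n v = (if n = -1 then v else \<zero>\<^bsub>V\<^esub>)"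
    and creation: "v \<in> carrier V \<Longrightarrow> Y v (-1) vac = v"
    and creation_nonneg: "\<lbrakk>v \<in> carrier V; n \<ge> 0\<rbrakk> \<Longrightarrow> Y v n vac = \<zero>\<^bsub>V\<^esub>"
    and jacobi: "\<lbrakk>u \<in> carrier V; v \<in> carrier V; w \<in> carrier V\<rbrakk> \<Longrightarrow>
           fsum V (\<lambda>i. (of_int m gchoose i) \<odot>\<^bsub>V\<^esub> Y (Y u (l + int i) v) (m + n - int i) w)
         = fsum V (\<lambda>i. ((-1) ^ i * (of_int l gchoose i)) \<odot>\<^bsub>V\<^esub>
             (Y u (m + l - int i) (Y v (n + int i) w) \<ominus>\<^bsub>V\<^esub>
              ((-1) powi l) \<odot>\<^bsub>V\<^esub> Y v (n + l - int i) (Y u (m + int i) w)))"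

definition va_endo ::
  "(complex, 'v) module \<Rightarrow> 'v \<Rightarrow> ('v \<Rightarrow> int \<Rightarrow> 'v \<Rightarrow> 'v) \<Rightarrow> ('v \<Rightarrow> 'v) \<Rightarrow> bool" where
  "va_endo V vac Y g \<longleftrightarrow>
     g \<in> carrier V \<rightarrow> carrier V \<and>
     (\<forall>u\<in>carrier V. \<forall>v\<in>carrier V. g (u \<oplus>\<^bsub>V\<^esub> v) = g u \<oplus>\<^bsub>V\<^esub> g v) \<and>
     (\<forall>c. \<forall>v\<in>carrier V. g (c \<odot>\<^bsub>V\<^esub> v) = c \<odot>\<^bsub>V\<^esub> g v) \<and>
     g vac = vac \<and>
     (\<forall>u\<in>carrier V. \<forall>v\<in>carrier V. \<forall>n. g (Y u n v) = Y (g u) n (g v))"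

definition graded_va_endo ::
  "(complex, 'v) module \<Rightarrow> 'v \<Rightarrow> ('v \<Rightarrow> int \<Rightarrow> 'v \<Rightarrow> 'v) \<Rightarrow> (nat \<Rightarrow> 'v set) \<Rightarrow> ('v \<Rightarrow> 'v) \<Rightarrow> bool" where
  "graded_va_endo V vac Y gr g \<longleftrightarrow> va_endo V vac Y g \<and> (\<forall>d. g ` gr d \<subseteq> gr d)"

definition graded_va_aut ::
  "(complex, 'v) module \<Rightarrow> 'v \<Rightarrow> ('v \<Rightarrow> int \<Rightarrow> 'v \<Rightarrow> 'v) \<Rightarrow> (nat \<Rightarrow> 'v set) \<Rightarrow> ('v \<Rightarrow> 'v) \<Rightarrow> bool" where
  "graded_va_aut V vac Y gr g \<longleftrightarrow>
     graded_va_endo V vac Y gr g \<and> bij_betw g (carrier V) (carrier V)"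


section \<open>The Lie algebra of a vertex algebroid\<close>

text \<open>\<open>W \<otimes> \<complex>[t,t\<^sup>-\<^sup>1]\<close> is \<^typ>\<open>int \<Rightarrow>\<^sub>0 'w\<close>, with \<open>w \<otimes> t\<^sup>n\<close> being \<open>Poly_Mapping.single n w\<close>.\<close>

type_synonym ('a, 'b) loop = "int \<Rightarrow>\<^sub>0 'a \<times> 'b"

definition hat_del ::
  "('a::comm_ring, 'b::ab_group_add) algebroid \<Rightarrow> (int \<Rightarrow>\<^sub>0 'a) \<Rightarrow> ('a, 'b) loop" where
  "hat_del S p = (\<Sum>n\<in>Poly_Mapping.keys p.
     Poly_Mapping.single n (0, del S (Poly_Mapping.lookup p n)) +
     Poly_Mapping.single (n - 1) (smulA S (of_int n) (Poly_Mapping.lookup p n), 0))"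

text \<open>The four bracket formulas amount to
  \<open>[x \<otimes> t\<^sup>m, y \<otimes> t\<^sup>n] = x\<^sub>0 y \<otimes> t\<^bsup>m+n\<^esup> + m (x\<^sub>1 y) \<otimes> t\<^bsup>m+n-1\<^esup>\<close> for \<open>x, y\<close> in \<open>A \<oplus> B\<close>.\<close>

definition loop_bracket ::
  "('a::comm_ring, 'b::ab_group_add) algebroid \<Rightarrow> ('a, 'b) loop \<Rightarrow> ('a, 'b) loop \<Rightarrow> ('a, 'b) loop" where
  "loop_bracket S p q = (\<Sum>m\<in>Poly_Mapping.keys p. \<Sum>n\<in>Poly_Mapping.keys q.
     Poly_Mapping.single (m + n) (prod0 S (Poly_Mapping.lookup p m) (Poly_Mapping.lookup q n)) +
     Poly_Mapping.single (m + n - 1)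
       (smulC S (of_int m) (prod1 S (Poly_Mapping.lookup p m) (Poly_Mapping.lookup q n))))"

definition loop_alg ::
  "('a::comm_ring, 'b::ab_group_add) algebroid \<Rightarrow> (complex, ('a, 'b) loop) module" where
  "loop_alg S = \<lparr>carrier = UNIV, monoid.mult = loop_bracket S, one = undefined,
     zero = 0, add = (+), module.smult = (\<lambda>c. Poly_Mapping.map (smulC S c))\<rparr>"

definition lie_alg ::
  "('a::comm_ring, 'b::ab_group_add) algebroid \<Rightarrow> (complex, ('a, 'b) loop set) module" where
  "lie_alg S = quotient_alg (loop_alg S) (range (hat_del S))"

text \<open>\<open>lie_mode S u n\<close> is \<open>u(n)\<close>.\<close>

definition lie_mode ::
  "('a::comm_ring, 'b::ab_group_add) algebroid \<Rightarrow> 'a \<times> 'b \<Rightarrow> int \<Rightarrow> ('a, 'b) loop set" where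
  "lie_mode S u n = range (hat_del S) +>\<^bsub>loop_alg S\<^esub> Poly_Mapping.single n u"

definition lie_nonneg ::
  "('a::comm_ring, 'b::ab_group_add) algebroid \<Rightarrow> ('a, 'b) loop set set" where
  "lie_nonneg S =
     {range (hat_del S) +>\<^bsub>loop_alg S\<^esub> p | p. Poly_Mapping.keys p \<subseteq> {0..}}"


section \<open>The vertex algebras \<open>V\<^sub>L\<close> and \<open>V\<^sub>B\<close>\<close>

type_synonym ('a, 'b) vl = "(('a, 'b) loop set list \<Rightarrow>\<^sub>0 complex) set set"

definition VL ::
  "('a::comm_ring, 'b::ab_group_add) algebroid \<Rightarrow> (complex, ('a, 'b) vl) module" where
  "VL S = ind_module (lie_alg S) (lie_nonneg S)"

definition VL_vac :: "('a::comm_ring, 'b::ab_group_add) algebroid \<Rightarrow> ('a, 'b) vl" where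
  "VL_vac S = ind_one (lie_alg S) (lie_nonneg S)"

text \<open>The action of \<open>u(n)\<close> on \<open>V\<^sub>L\<close>.\<close>

definition VL_mode ::
  "('a::comm_ring, 'b::ab_group_add) algebroid \<Rightarrow> 'a \<times> 'b \<Rightarrow> int \<Rightarrow> ('a, 'b) vl \<Rightarrow> ('a, 'b) vl" where
  "VL_mode S u n = ind_act (lie_alg S) (lie_nonneg S) (env_gen (lie_alg S) (lie_mode S u n))"

definition VL_emb ::
  "('a::comm_ring, 'b::ab_group_add) algebroid \<Rightarrow> 'a \<times> 'b \<Rightarrow> ('a, 'b) vl" where
  "VL_emb S u = VL_mode S u (-1) (VL_vac S)"

text \<open>The vertex algebra structure on \<open>V\<^sub>L\<close> with \<open>Y(u,x) = \<Sum> u(n) x\<^bsup>-n-1\<^esup>\<close> for \<open>u\<close> in \<open>A \<oplus> B\<close> is unique.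
  It is picked by \<open>SOME\<close>, not \<open>THE\<close>: functions are unconstrained outside the carrier.\<close>

definition VL_Y ::
  "('a::comm_ring, 'b::ab_group_add) algebroid \<Rightarrow> ('a, 'b) vl \<Rightarrow> int \<Rightarrow> ('a, 'b) vl \<Rightarrow> ('a, 'b) vl" where
  "VL_Y S = (SOME Y. vertex_algebra (VL S) (VL_vac S) Y \<and>
     (\<forall>u n. \<forall>v\<in>carrier (VL S). Y (VL_emb S u) n v = VL_mode S u n v))"

text \<open>Vectors \<open>u\<^sub>1(n\<^sub>1) \<dots> u\<^sub>r(n\<^sub>r)\<^bold>1\<close> with each \<open>u\<^sub>i\<close> in \<open>A\<close> or in \<open>B\<close>, paired with their degrees.\<close>

inductive_set VL_homogeneous ::
  "('a::comm_ring, 'b::ab_group_add) algebroid \<Rightarrow> (int \<times> ('a, 'b) vl) set"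
  for S :: "('a, 'b) algebroid" where
  vac: "(0, VL_vac S) \<in> VL_homogeneous S"
| modeA: "(d, v) \<in> VL_homogeneous S \<Longrightarrow> (d - n - 1, VL_mode S (a, 0) n v) \<in> VL_homogeneous S"
| modeB: "(d, v) \<in> VL_homogeneous S \<Longrightarrow> (d - n, VL_mode S (0, b) n v) \<in> VL_homogeneous S"

definition VL_grade ::
  "('a::comm_ring, 'b::ab_group_add) algebroid \<Rightarrow> nat \<Rightarrow> ('a, 'b) vl set" where
  "VL_grade S d = lin_span (VL S) {v. (int d, v) \<in> VL_homogeneous S}"

definition VL_D ::
  "('a::comm_ring, 'b::ab_group_add) algebroid \<Rightarrow> ('a, 'b) vl \<Rightarrow> ('a, 'b) vl" where
  "VL_D S v = VL_Y S v (-2) (VL_vac S)"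

definition VB_relations ::
  "('a::comm_ring, 'b::ab_group_add) algebroid \<Rightarrow> ('a, 'b) vl set" where
  "VB_relations S = lin_span (VL S)
     ({VL_emb S (idA S, 0) \<ominus>\<^bsub>VL S\<^esub> VL_vac S} \<union>
      {VL_mode S (a, 0) (-1) (VL_emb S (a', 0)) \<ominus>\<^bsub>VL S\<^esub> VL_emb S (a * a', 0) | a a'. True} \<union>
      {VL_mode S (a, 0) (-1) (VL_emb S (0, b)) \<ominus>\<^bsub>VL S\<^esub> VL_emb S (0, act S a b) | a b. True})"

definition VB_ideal ::
  "('a::comm_ring, 'b::ab_group_add) algebroid \<Rightarrow> ('a, 'b) vl set" where
  "VB_ideal S = lin_span (VL S)
     {ind_act (lie_alg S) (lie_nonneg S) u ((VL_D S ^^ k) v) | u k v.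
        u \<in> carrier (env_alg (lie_alg S)) \<and> v \<in> VB_relations S}"

definition VB ::
  "('a::comm_ring, 'b::ab_group_add) algebroid \<Rightarrow> (complex, ('a, 'b) vl set) module" where
  "VB S = quotient_alg (VL S) (VB_ideal S)"

definition VB_vac :: "('a::comm_ring, 'b::ab_group_add) algebroid \<Rightarrow> ('a, 'b) vl set" where
  "VB_vac S = VB_ideal S +>\<^bsub>VL S\<^esub> VL_vac S"

definition VB_Y ::
  "('a::comm_ring, 'b::ab_group_add) algebroid \<Rightarrow>
   ('a, 'b) vl set \<Rightarrow> int \<Rightarrow> ('a, 'b) vl set \<Rightarrow> ('a, 'b) vl set" where
  "VB_Y S P n Z = (\<Union>x\<in>P. \<Union>z\<in>Z. VB_ideal S +>\<^bsub>VL S\<^esub> VL_Y S x n z)"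

definition VB_grade ::
  "('a::comm_ring, 'b::ab_group_add) algebroid \<Rightarrow> nat \<Rightarrow> ('a, 'b) vl set set" where
  "VB_grade S d = (\<lambda>v. VB_ideal S +>\<^bsub>VL S\<^esub> v) ` VL_grade S d"

text \<open>The embedding of \<open>A \<oplus> B\<close>, as degrees \<open>0\<close> and \<open>1\<close>, into \<open>V\<^sub>B\<close>.\<close>

definition VB_emb ::
  "('a::comm_ring, 'b::ab_group_add) algebroid \<Rightarrow> 'a \<times> 'b \<Rightarrow> ('a, 'b) vl set" where
  "VB_emb S u = VB_ideal S +>\<^bsub>VL S\<^esub> VL_emb S u"

definition extends_to_VB ::
  "('a::comm_ring, 'b::ab_group_add) algebroid \<Rightarrow> ('a \<times> 'b \<Rightarrow> 'a \<times> 'b) \<Rightarrow>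
   (('a, 'b) vl set \<Rightarrow> ('a, 'b) vl set) \<Rightarrow> bool" where
  "extends_to_VB S g G \<longleftrightarrow> (\<forall>u. G (VB_emb S u) = VB_emb S (g u))"

end

theory Submission
  imports Defs
begin

text \<open>The vertex algebra structure on \<open>V\<^sub>L\<close> is specified only by a choice operator, so its existence
  is part of the proof.  The modes of \<open>A \<oplus> B\<close> are mutually local fields on \<open>V\<^sub>L\<close>, covariant under a
  translation operator; by Dong's lemma so are all their iterated products, by Goddard's argument each
  such field is determined by its value at the vacuum, and this gives the state-field map.  An
  endomorphism \<open>g\<close> of the algebroid twists the action of the modes, and the universal property of
  the induced module \<open>V\<^sub>L\<close> turns the twist into a linear endomorphism of \<open>V\<^sub>L\<close>.  It preserves products
  because \<open>V\<^sub>L\<close> is generated by \<open>A \<oplus> B\<close>, and it maps \<open>I\<^sub>B\<close> to itself, so it descends to \<open>V\<^sub>B\<close>.\<close>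

section \<open>Fields and Dong's lemma\<close>

text \<open>Fields are handled through their integer modes, without formal delta functions:
  multiplying a two-variable series by x - y is the recursion \<open>bor_Suc\<close> on
  coefficients, and locality says that finitely many such steps give zero. Dong's lemma and the
  Borcherds identity both rest on this recursion. The obstacle is the type of V_L: its elements are
  cosets of cosets, with operations meaningful only on a carrier, whereas sums of fields want a
  total addition. All field theory therefore runs in the free algebra, on representatives singled
  out by a projection \<open>p\<close>, and is carried over by \<open>q\<close> at the end. The
  choice in \<open>VL_Y\<close> also calls for uniqueness of the structure: only then do the chosen
  products agree with the constructed ones. Likewise \<open>VB_Y\<close> is a union of cosets,
  meaningful once \<open>VB_ideal\<close> absorbs products on both sides. The universal property
  serves twice: for the twist by the endomorphism and, with the square of the module as target, for
  the translation operator on which Goddard's argument depends. Bijectivity comes from lifting the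
  inverse of \<open>g\<close> too.\<close>

definition lin_map ::
  "(complex \<Rightarrow> 'x::ab_group_add \<Rightarrow> 'x) \<Rightarrow> (complex \<Rightarrow> 'y::ab_group_add \<Rightarrow> 'y) \<Rightarrow> ('x \<Rightarrow> 'y) \<Rightarrow> bool" where
  "lin_map s t f \<longleftrightarrow> (\<forall>x y. f (x + y) = f x + f y) \<and> (\<forall>c x. f (s c x) = t c (f x))"

lemma lin_map_add: "lin_map s t f \<Longrightarrow> f (x + y) = f x + f y"
  and lin_map_scale: "lin_map s t f \<Longrightarrow> f (s c x) = t c (f x)"
  by (auto simp: lin_map_def)

lemma lin_map_zero: "lin_map s t f \<Longrightarrow> f 0 = 0"
  by (metis add_cancel_right_right lin_map_add)

lemma lin_map_minus: "lin_map s t f \<Longrightarrow> f (- x) = - f x"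
  by (metis add.left_inverse eq_neg_iff_add_eq_0 lin_map_add lin_map_zero)

lemma lin_map_diff: "lin_map s t f \<Longrightarrow> f (x - y) = f x - f y"
  by (metis diff_conv_add_uminus lin_map_add lin_map_minus)

lemma lin_map_sum: "lin_map s t f \<Longrightarrow> f (sum h I) = (\<Sum>i\<in>I. f (h i))"
  by (induction I rule: infinite_finite_induct) (auto simp: lin_map_add lin_map_zero)

lemmas lin_map_simps = lin_map_add lin_map_scale lin_map_zero lin_map_minus lin_map_diff lin_map_sum

lemma lin_map_comp: "lin_map s t f \<Longrightarrow> lin_map t r h \<Longrightarrow> lin_map s r (\<lambda>x. h (f x))"
  by (auto simp: lin_map_def)

lemma Sum_any_eq_sum:
  fixes f :: "nat \<Rightarrow> 'x::comm_monoid_add"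
  assumes "\<And>i. i \<ge> N \<Longrightarrow> f i = 0"
  shows "Sum_any f = (\<Sum>i<N. f i)"
proof -
  have "{i. f i \<noteq> 0} \<subseteq> {..<N}"
    using assms by (auto simp: not_less[symmetric])
  then show ?thesis
    by (rule Sum_any.expand_superset[rotated]) simp
qed

text \<open>The coefficients of (1 - z)^l. \<open>altbin_Suc\<close> is multiplication by 1 - z, and
  \<open>altbin_absorb\<close> is the differential equation (1 - z) f' = - l f.\<close>

definition altbin :: "int \<Rightarrow> nat \<Rightarrow> complex" where
  "altbin l i = (-1) ^ i * (of_int l gchoose i)"

lemma altbin_0 [simp]: "altbin l 0 = 1"
  by (simp add: altbin_def)

lemma altbin_zero_Suc [simp]: "altbin 0 (Suc i) = 0"
  by (simp add: altbin_def gbinomial_0)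

lemma altbin_Suc: "altbin (l + 1) (Suc i) = altbin l (Suc i) - altbin l i"
  using gbinomial_Suc_Suc[of "of_int l :: complex" i]
  by (simp add: altbin_def algebra_simps)

lemma altbin_absorb: "altbin l (Suc i) * of_nat (Suc i) = - (altbin l i * (of_int l - of_nat i))"
proof -
  have "of_nat (Suc i) * (of_int l gchoose Suc i) = (of_int l - of_nat i) * ((of_int l :: complex) gchoose i)"
    using gbinomial_absorb_comp[of "of_int l :: complex" i] gbinomial_absorption[of i "of_int l :: complex"]
    by (simp add: mult.commute)
  then show ?thesis
    unfolding altbin_def by (simp add: mult.assoc mult.commute[of _ "of_nat (Suc i)"] del: of_nat_Suc)
qed

locale complex_space = vector_space scale
  for scale :: "complex \<Rightarrow> 'v::ab_group_add \<Rightarrow> 'v" (infixr "*s" 75)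
begin

abbreviation "lin \<equiv> lin_map scale scale"

definition fld :: "(int \<Rightarrow> 'v \<Rightarrow> 'v) \<Rightarrow> bool" where
  "fld a \<longleftrightarrow> (\<forall>n. lin (a n)) \<and> (\<forall>w. \<exists>N. \<forall>n\<ge>N. a n w = 0)"

lemma fld_lin: "fld a \<Longrightarrow> lin (a n)"
  by (simp add: fld_def)

lemmas fld_simps = lin_map_simps[OF fld_lin]

text \<open>Summation by parts, cut at \<open>M\<close> with an explicit boundary term because
  \<open>h\<close> is arbitrary here.\<close>

lemma altbin_sum_Suc:
  "(\<Sum>i\<le>M. altbin (l + 1) i *s h i) = (\<Sum>i\<le>M. altbin l i *s (h i - h (Suc i))) + altbin l M *s h (Suc M)"
proof (induction M)
  case (Suc M)
  then show ?case
    by (simp add: altbin_Suc scale_left_diff_distrib scale_right_diff_distrib)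
qed (simp add: scale_right_diff_distrib)

text \<open>Summed with weights \<open>altbin l i\<close>, these terms give the coefficient of
  x^(-m-1) y^(-n-1) in (x - y)^l a(x) b(y) - (-y + x)^l b(y) a(x), where the first power is expanded
  in nonnegative powers of y and the second in nonnegative powers of x.\<close>

definition bor_term :: "(int \<Rightarrow> 'v \<Rightarrow> 'v) \<Rightarrow> (int \<Rightarrow> 'v \<Rightarrow> 'v) \<Rightarrow> int \<Rightarrow> int \<Rightarrow> int \<Rightarrow> 'v \<Rightarrow> nat \<Rightarrow> 'v" where
  "bor_term a b l m n w i =
     a (m + l - int i) (b (n + int i) w) - ((-1) powi l) *s b (n + l - int i) (a (m + int i) w)"

text \<open>The right-hand side of the Borcherds identity; for \<open>m = 0\<close> it is the \<open>l\<close>-th product of the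
  fields \<open>a\<close> and \<open>b\<close>.\<close>

definition bor :: "(int \<Rightarrow> 'v \<Rightarrow> 'v) \<Rightarrow> (int \<Rightarrow> 'v \<Rightarrow> 'v) \<Rightarrow> int \<Rightarrow> int \<Rightarrow> int \<Rightarrow> 'v \<Rightarrow> 'v" where
  "bor a b l m n w = Sum_any (\<lambda>i. altbin l i *s bor_term a b l m n w i)"

lemma bor_term_zero:
  assumes "fld a" "fld b"
  shows "\<exists>N. \<forall>i\<ge>N. b (n + int i) w = 0 \<and> a (m + int i) w = 0 \<and> bor_term a b l m n w i = 0"
proof -
  obtain N1 N2 where N: "\<forall>n\<ge>N1. a n w = 0" "\<forall>n\<ge>N2. b n w = 0"
    using assms by (metis fld_def)
  have "b (n + int i) w = 0 \<and> a (m + int i) w = 0" if "i \<ge> nat (max (N1 - m) (N2 - n))" for i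
    using that N by auto
  then show ?thesis
    using assms by (intro exI[of _ "nat (max (N1 - m) (N2 - n))"]) (auto simp: bor_term_def fld_simps)
qed

text \<open>The number of nonzero terms depends on the indices and on \<open>w\<close>. Stated for
  all large cutoffs, the truncation lets several such sums be compared at one common cutoff.\<close>

lemma bor_sum_ev:
  assumes "fld a" "fld b"
  shows "\<forall>\<^sub>F M in sequentially. bor a b l m n w = (\<Sum>i<M. altbin l i *s bor_term a b l m n w i)"
proof -
  obtain N where N: "\<forall>i\<ge>N. bor_term a b l m n w i = 0"
    using bor_term_zero[OF assms] by blast
  have "bor a b l m n w = (\<Sum>i<M. altbin l i *s bor_term a b l m n w i)" if "M \<ge> N" for M
    unfolding bor_def using N that by (intro Sum_any_eq_sum) auto
  then show ?thesis
    by (auto simp: eventually_sequentially)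
qed

text \<open>Multiplying the generating series by x - y raises l by one, and multiplication by x or
  by y shifts the index \<open>m\<close> or \<open>n\<close>.\<close>

lemma bor_Suc:
  assumes "fld a" "fld b"
  shows "bor a b (l + 1) m n w = bor a b l (m + 1) n w - bor a b l m (n + 1) w"
proof -
  \<comment> \<open>The extra sign in (-1)^(l+1) turns the minus of \<open>bor_term\<close> into a
    plus, and the two terms with exponent l then differ by \<open>h i - h (Suc i)\<close>, the shape
    needed for summation by parts.\<close>
  define h where "h i = a (m + l + 1 - int i) (b (n + int i) w) +
     ((-1) powi l) *s b (n + l + 1 - int i) (a (m + int i) w)" for i
  have h1: "bor_term a b (l + 1) m n w i = h i" for i
    by (simp add: bor_term_def h_def power_int_add add.assoc)
  have h2: "bor_term a b l (m + 1) n w i - bor_term a b l m (n + 1) w i = h i - h (Suc i)" for i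
    by (simp add: bor_term_def h_def algebra_simps)
  obtain N where N: "\<forall>i\<ge>N. bor_term a b (l + 1) m n w i = 0"
    using bor_term_zero[OF assms] by blast
  obtain M where M: "M \<ge> N" "M \<ge> 1"
    "bor a b (l + 1) m n w = (\<Sum>i<M. altbin (l + 1) i *s bor_term a b (l + 1) m n w i)"
    "bor a b l (m + 1) n w = (\<Sum>i<M. altbin l i *s bor_term a b l (m + 1) n w i)"
    "bor a b l m (n + 1) w = (\<Sum>i<M. altbin l i *s bor_term a b l m (n + 1) w i)"
  proof -
    have "\<forall>\<^sub>F M in sequentially. M \<ge> N \<and> M \<ge> 1 \<and>
    bor a b (l + 1) m n w = (\<Sum>i<M. altbin (l + 1) i *s bor_term a b (l + 1) m n w i) \<and>
    bor a b l (m + 1) n w = (\<Sum>i<M. altbin l i *s bor_term a b l (m + 1) n w i) \<and>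
    bor a b l m (n + 1) w = (\<Sum>i<M. altbin l i *s bor_term a b l m (n + 1) w i)"
      by (intro eventually_conj bor_sum_ev assms eventually_ge_at_top)
    then show ?thesis
      using that eventually_happens'[OF sequentially_bot] by fast
  qed
  obtain M' where M': "M = Suc M'"
    using M(2) by (cases M) auto
  \<comment> \<open>This removes the boundary term of \<open>altbin_sum_Suc\<close> and is the
    reason for requiring \<open>M \<ge> N\<close>.\<close>
  have "h M = 0"
    using N M(1) h1 by metis
  then show ?thesis
    using altbin_sum_Suc[of l h M']
    by (simp add: M(3-5) M' lessThan_Suc_atMost h1 sum_subtractf[symmetric]
        scale_right_diff_distrib[symmetric] h2)
qed

lemma bor_0:
  assumes "fld a" "fld b"
  shows "bor a b 0 m n w = a m (b n w) - b n (a m w)"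
proof -
  have "bor a b 0 m n w = (\<Sum>i<Suc 0. altbin 0 i *s bor_term a b 0 m n w i)"
    unfolding bor_def by (rule Sum_any_eq_sum) (auto dest!: Suc_le_D)
  then show ?thesis
    by (simp add: bor_term_def)
qed

text \<open>For a natural exponent the two expansions of (x - y)^N coincide, so the condition is (x
  - y)^N [a(x), b(y)] = 0.\<close>

definition mloc :: "(int \<Rightarrow> 'v \<Rightarrow> 'v) \<Rightarrow> (int \<Rightarrow> 'v \<Rightarrow> 'v) \<Rightarrow> bool" where
  "mloc a b \<longleftrightarrow> (\<exists>N::nat. \<forall>m n w. bor a b (int N) m n w = 0)"

lemma bor_vanish:
  assumes "fld a" "fld b" "\<forall>m n w. bor a b l m n w = 0" "l' \<ge> l"
  shows "bor a b l' m n w = 0"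
  using assms(4)
proof (induction l' arbitrary: m n rule: int_ge_induct)
  case base
  show ?case by (rule assms(3)[rule_format])
next
  case (step i)
  show ?case unfolding bor_Suc[OF assms(1,2)] step.IH by simp
qed

lemma mloc_common:
  assumes "fld a" "fld b" "mloc a b"
  obtains N :: nat where "\<And>l m n w. l \<ge> int N \<Longrightarrow> bor a b l m n w = 0"
proof -
  obtain N where "\<forall>m n w. bor a b (int N) m n w = 0"
    using assms unfolding mloc_def by blast
  then show ?thesis
    by (intro that[of N] bor_vanish[OF assms(1,2)])
qed

lemma bor_Suc_nat:
  "fld a \<Longrightarrow> fld b \<Longrightarrow>
    bor a b (int (Suc k)) m n w = bor a b (int k) (m + 1) n w - bor a b (int k) m (n + 1) w"
  using bor_Suc[of a b "int k"] by (simp add: add.commute)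

text \<open>Exchanging the fields replaces (x - y)^k by (y - x)^k and reverses the commutator,
  whence k + 1 signs.\<close>

lemma bor_swap:
  assumes "fld a" "fld b"
  shows "bor b a (int k) n m w = (-1) ^ Suc k *s bor a b (int k) m n w"
proof (induction k arbitrary: m n)
  case 0
  then show ?case using assms by (simp add: bor_0)
next
  case (Suc k)
  show ?case
    unfolding bor_Suc_nat[OF assms] bor_Suc_nat[OF assms(2,1)] Suc
    by (simp add: scale_right_diff_distrib)
qed

lemma mloc_sym: "fld a \<Longrightarrow> fld b \<Longrightarrow> mloc a b \<Longrightarrow> mloc b a"
  unfolding mloc_def by (auto simp: bor_swap[of a b])

text \<open>Multiplication of a series by a difference of two variables, seen on its coefficients:
  in the convention x^(-n-1), adding a unit vector to the index multiplies by the corresponding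
  variable. The index group is left open so that two or three variables can be treated
  alike.\<close>

definition dif :: "'i::ab_group_add \<Rightarrow> 'i \<Rightarrow> ('i \<Rightarrow> 'v) \<Rightarrow> 'i \<Rightarrow> 'v" where
  "dif s t f x = f (x + s) - f (x + t)"

lemma dif_pow_Suc: "(dif s t ^^ Suc k) f = dif s t ((dif s t ^^ k) f)"
  by simp

lemma dif_pow_zero: "(dif s t ^^ k) (\<lambda>x. 0) = (\<lambda>x. 0)"
  by (induction k) (auto simp: dif_def)

lemma dif_pow_add: "(dif s t ^^ k) (\<lambda>x. f x + h x) = (\<lambda>x. (dif s t ^^ k) f x + (dif s t ^^ k) h x)"
  by (induction k) (auto simp: dif_def)

lemma dif_pow_diff: "(dif s t ^^ k) (\<lambda>x. f x - h x) = (\<lambda>x. (dif s t ^^ k) f x - (dif s t ^^ k) h x)"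
  by (induction k) (auto simp: dif_def)

lemma dif_pow_scale: "(dif s t ^^ k) (\<lambda>x. c *s f x) = (\<lambda>x. c *s (dif s t ^^ k) f x)"
  by (induction k) (auto simp: dif_def scale_right_diff_distrib)

lemma dif_pow_sum: "(dif s t ^^ k) (\<lambda>x. \<Sum>i\<in>I. f i x) = (\<lambda>x. \<Sum>i\<in>I. (dif s t ^^ k) (f i) x)"
  by (induction k) (auto simp: dif_def sum_subtractf)

lemma dif_pow_shift: "(dif s t ^^ k) (\<lambda>x. f (x + y)) = (\<lambda>x. (dif s t ^^ k) f (x + y))"
  by (induction k) (auto simp: dif_def algebra_simps)

lemma dif_commute: "dif s t (dif s' t' f) = dif s' t' (dif s t f)"
  by (auto simp: dif_def algebra_simps)

lemma dif_dif_pow: "dif s t ((dif s' t' ^^ k) f) = (dif s' t' ^^ k) (dif s t f)"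
proof (induction k)
  case (Suc k)
  show ?case
    unfolding funpow.simps comp_apply dif_commute[of s t s' t'] Suc ..
qed simp

lemma dif_pow_commute: "(dif s t ^^ j) ((dif s' t' ^^ k) f) = (dif s' t' ^^ k) ((dif s t ^^ j) f)"
  by (induction j) (simp_all add: dif_dif_pow)

text \<open>A power of \<open>dif\<close> evaluated at one point reads its argument at finitely many
  points only, so a cutoff that depends on the point does no harm.\<close>

lemma dif_pow_eventually:
  assumes "\<And>x. \<forall>\<^sub>F M in sequentially. f x = F M x"
  shows "\<forall>\<^sub>F M in sequentially. (dif s t ^^ k) f x = (dif s t ^^ k) (F M) x"
proof (induction k arbitrary: x)
  case 0
  then show ?case using assms by simp
next
  case (Suc k)
  show ?case
    using eventually_conj[OF Suc[of "x + s"] Suc[of "x + t"]]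
    by (auto simp: dif_def elim: eventually_mono)
qed

text \<open>\<open>dif t r\<close> is the difference of the commuting operators
  \<open>dif s r\<close> and \<open>dif s t\<close>, and every term in the binomial expansion of its
  power k + j contains enough factors of one of them. The induction on k + j peels off one factor
  instead of expanding.\<close>

lemma dif_pow_nilpotent:
  assumes "(dif s t ^^ k) f = (\<lambda>x. 0)" "(dif s r ^^ j) f = (\<lambda>x. 0)"
  shows "(dif t r ^^ (k + j)) f = (\<lambda>x. 0)"
  using assms
proof (induction "k + j" arbitrary: k j f)
  case 0
  then show ?case by simp
next
  case (Suc M)
  show ?case
  proof (cases "k = 0 \<or> j = 0")
    case True
    then have "f = (\<lambda>x. 0)" using Suc.prems by auto
    then show ?thesis by (simp add: dif_pow_zero)
  next
    case False
    then obtain k' j' where kj: "k = Suc k'" "j = Suc j'" by (metis not0_implies_Suc)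
    have "(dif t r ^^ (k' + j)) (dif s t f) = (\<lambda>x. 0)"
    proof (rule Suc.hyps(1))
      show "M = k' + j" using Suc.hyps(2) kj by simp
      show "(dif s t ^^ k') (dif s t f) = (\<lambda>x. 0)"
        using Suc.prems(1) by (simp add: kj funpow_swap1)
      show "(dif s r ^^ j) (dif s t f) = (\<lambda>x. 0)"
        unfolding dif_dif_pow[symmetric] Suc.prems(2) by (auto simp: dif_def)
    qed
    moreover have "(dif t r ^^ (k + j')) (dif s r f) = (\<lambda>x. 0)"
    proof (rule Suc.hyps(1))
      show "M = k + j'" using Suc.hyps(2) kj by simp
      show "(dif s r ^^ j') (dif s r f) = (\<lambda>x. 0)"
        using Suc.prems(2) by (simp add: kj funpow_swap1)
      show "(dif s t ^^ k) (dif s r f) = (\<lambda>x. 0)"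
        unfolding dif_dif_pow[symmetric] Suc.prems(1) by (auto simp: dif_def)
    qed
    moreover have "k' + j = M" "k + j' = M" using Suc.hyps(2) kj by auto
    moreover have "dif t r f = (\<lambda>x. dif s r f x - dif s t f x)"
      by (auto simp: dif_def)
    ultimately have "(dif t r ^^ M) (dif t r f) = (\<lambda>x. 0)"
      by (simp add: dif_pow_diff)
    then show ?thesis
      using Suc.hyps(2)[symmetric] by (simp add: funpow_Suc_right del: funpow.simps)
  qed
qed


lemma dif_pow_comp:
  assumes "\<And>x y. \<sigma> (x + y) = \<sigma> x + \<sigma> y"
  shows "(dif s t ^^ k) (\<lambda>x. f (\<sigma> x)) = (\<lambda>x. (dif (\<sigma> s) (\<sigma> t) ^^ k) f (\<sigma> x))"
  by (induction k) (simp_all add: dif_def assms fun_eq_iff)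

lemma lin_bor:
  assumes "fld a" "fld b"
  shows "lin (bor a b l m n)"
proof -
  have t: "bor_term a b l m n (x + y) i = bor_term a b l m n x i + bor_term a b l m n y i"
    "bor_term a b l m n (c *s x) i = c *s bor_term a b l m n x i" for x y c i
    using assms by (simp_all add: bor_term_def fld_simps scale_right_distrib scale_right_diff_distrib mult.commute)
  have "bor a b l m n (x + y) = bor a b l m n x + bor a b l m n y" for x y
  proof -
    have "\<forall>\<^sub>F M in sequentially. bor a b l m n (x + y) = bor a b l m n x + bor a b l m n y"
      using bor_sum_ev[OF assms, of l m n "x + y"] bor_sum_ev[OF assms, of l m n x]
        bor_sum_ev[OF assms, of l m n y]
      by eventually_elim (simp add: t scale_right_distrib sum.distrib)
    then show ?thesis by simp
  qed
  moreover have "bor a b l m n (c *s x) = c *s bor a b l m n x" for c x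
  proof -
    have "\<forall>\<^sub>F M in sequentially. bor a b l m n (c *s x) = c *s bor a b l m n x"
      using bor_sum_ev[OF assms, of l m n "c *s x"] bor_sum_ev[OF assms, of l m n x]
      by eventually_elim (simp add: t scale_sum_right mult.commute)
    then show ?thesis by simp
  qed
  ultimately show ?thesis
    by (simp add: lin_map_def)
qed

lemma fld_bor:
  assumes "fld a" "fld b"
  shows "fld (bor a b l 0)"
proof -
  have "\<exists>N. \<forall>n\<ge>N. bor a b l 0 n w = 0" for w
  proof -
    obtain N1 N2 where N: "\<forall>n\<ge>N1. a n w = 0" "\<forall>n\<ge>N2. b n w = 0"
      using assms unfolding fld_def by blast
    \<comment> \<open>Only the finitely many j below \<open>N1\<close> have a_j w nonzero, so one
      bound serves them all. Below, it is raised by \<open>int (nat N1)\<close> because the index of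
      \<open>b\<close> is lowered by i.\<close>
    have "\<exists>N3. \<forall>j<k. \<forall>n\<ge>N3. b n (a (int j) w) = 0" for k :: nat
    proof (induction k)
      case (Suc k)
      then obtain N3 N4 where "\<forall>j<k. \<forall>n\<ge>N3. b n (a (int j) w) = 0" "\<forall>n\<ge>N4. b n (a (int k) w) = 0"
        using assms unfolding fld_def by blast
      then show ?case
        by (intro exI[of _ "max N3 N4"]) (auto simp: less_Suc_eq)
    qed simp
    then obtain N3 where N3: "\<forall>j<nat N1. \<forall>n\<ge>N3. b n (a (int j) w) = 0"
      by blast
    have "bor_term a b l 0 n w i = 0" if n: "n \<ge> max N2 (N3 - l + int (nat N1))" for n i
    proof -
      have "b (n + int i) w = 0" using n N(2) by auto
      moreover have "b (n + l - int i) (a (int i) w) = 0"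
      proof (cases "i < nat N1")
        case True
        moreover from this n have "n + l - int i \<ge> N3" by linarith
        ultimately show ?thesis using N3 by blast
      next
        case False
        then have "a (int i) w = 0" using N(1) by auto
        then show ?thesis using assms by (simp add: fld_simps)
      qed
      ultimately show ?thesis
        using assms by (simp add: bor_term_def fld_simps)
    qed
    then have "bor a b l 0 n w = 0" if "n \<ge> max N2 (N3 - l + int (nat N1))" for n
      using that by (simp add: bor_def)
    then show ?thesis by blast
  qed
  then show ?thesis
    using lin_bor[OF assms] by (simp add: fld_def)
qed

text \<open>Dong's lemma: since \<open>y - z = (x - z) - (x - y)\<close>, a distribution in three variables killed by
  powers of \<open>x - y\<close> and of \<open>x - z\<close> is killed by a power of \<open>y - z\<close>.\<close>

abbreviation (input) ex :: "int \<times> int \<times> int" where "ex \<equiv> (1, 0, 0)"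
abbreviation (input) ey :: "int \<times> int \<times> int" where "ey \<equiv> (0, 1, 0)"
abbreviation (input) ez :: "int \<times> int \<times> int" where "ez \<equiv> (0, 0, 1)"

text \<open>The coefficients of [a(x) b(y), c(z)] w, arranged as one function of an index triple so
  that \<open>dif\<close> with \<open>ex\<close>, \<open>ey\<close>, \<open>ez\<close> multiplies by
  differences of x, y, z.\<close>

definition triple_comm ::
  "(int \<Rightarrow> 'v \<Rightarrow> 'v) \<Rightarrow> (int \<Rightarrow> 'v \<Rightarrow> 'v) \<Rightarrow> (int \<Rightarrow> 'v \<Rightarrow> 'v) \<Rightarrow> 'v \<Rightarrow> int \<times> int \<times> int \<Rightarrow> 'v" where
  "triple_comm a b c w = (\<lambda>(m, n, q). a m (b n (c q w)) - c q (a m (b n w)))"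

text \<open>By [a b, c] = a [b, c] + [a, c] b, the first summand dies under (y - z)^N and the second
  under (x - z)^N.\<close>

lemma triple_comm_killed:
  assumes "fld a" "fld b" "fld c"
    and "\<And>m n w. bor a c (int N) m n w = 0" "\<And>m n w. bor b c (int N) m n w = 0"
  shows "(dif ex ez ^^ N) ((dif ey ez ^^ N) (triple_comm a b c w)) = (\<lambda>x. 0)"
proof -
  define A1 where "A1 = (\<lambda>(m, n, q). a m (bor b c 0 n q w))"
  define A2 where "A2 = (\<lambda>(m, n, q). bor a c 0 m q (b n w))"
  have A: "triple_comm a b c w = (\<lambda>x. A1 x + A2 x)"
    using assms(1-3) by (auto simp: triple_comm_def A1_def A2_def bor_0 fld_simps)
  have "(dif ey ez ^^ j) A1 = (\<lambda>(m, n, q). a m (bor b c (int j) n q w))" for j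
  proof (induction j)
    case (Suc j)
    show ?case
      unfolding dif_pow_Suc Suc bor_Suc_nat[OF assms(2,3)]
      using assms(1) by (auto simp: dif_def fld_simps)
  qed (simp add: A1_def)
  then have 1: "(dif ey ez ^^ N) A1 = (\<lambda>x. 0)"
    using assms(1,5) by (auto simp: fld_simps)
  have "(dif ex ez ^^ j) A2 = (\<lambda>(m, n, q). bor a c (int j) m q (b n w))" for j
  proof (induction j)
    case (Suc j)
    show ?case
      unfolding dif_pow_Suc Suc bor_Suc_nat[OF assms(1,3)]
      by (auto simp: dif_def)
  qed (simp add: A2_def)
  then have 2: "(dif ex ez ^^ N) A2 = (\<lambda>x. 0)"
    using assms(4) by auto
  have "(dif ex ez ^^ N) ((dif ey ez ^^ N) A2) = (\<lambda>x. 0)"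
    unfolding dif_pow_commute[where s = ex and t = ez] 2 by (rule dif_pow_zero)
  then show ?thesis
    unfolding A dif_pow_add 1 by (simp add: dif_pow_zero)
qed

text \<open>The other ordering b(y) a(x), reduced to the previous lemma by exchanging the first two
  index coordinates.\<close>

lemma triple_comm_killed':
  assumes "fld a" "fld b" "fld c"
    and "\<And>m n w. bor a c (int N) m n w = 0" "\<And>m n w. bor b c (int N) m n w = 0"
  shows "(dif ex ez ^^ N) ((dif ey ez ^^ N) (\<lambda>(m, n, q). triple_comm b a c w (n, m, q))) = (\<lambda>x. 0)"
proof -
  define \<sigma> :: "int \<times> int \<times> int \<Rightarrow> int \<times> int \<times> int" where "\<sigma> = (\<lambda>(m, n, q). (n, m, q))"
  have s: "\<sigma> (x + y) = \<sigma> x + \<sigma> y" for x y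
    by (auto simp: \<sigma>_def split: prod.splits)
  have [simp]: "\<sigma> ex = ey" "\<sigma> ey = ex" "\<sigma> ez = ez"
    by (auto simp: \<sigma>_def)
  have "(\<lambda>(m, n, q). triple_comm b a c w (n, m, q)) = (\<lambda>x. triple_comm b a c w (\<sigma> x))"
    by (auto simp: \<sigma>_def)
  then have "(dif ex ez ^^ N) ((dif ey ez ^^ N) (\<lambda>(m, n, q). triple_comm b a c w (n, m, q)))
     = (\<lambda>x. (dif ey ez ^^ N) ((dif ex ez ^^ N) (triple_comm b a c w)) (\<sigma> x))"
    by (simp only:) (simp add: dif_pow_comp[of \<sigma>, OF s])
  also have "(dif ey ez ^^ N) ((dif ex ez ^^ N) (triple_comm b a c w)) = (\<lambda>x. 0)"
    unfolding dif_pow_commute[where s = ey and t = ez] using assms by (intro triple_comm_killed)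
  finally show ?thesis .
qed

lemma dong:
  assumes "fld a" "fld b" "fld c" "mloc a b" "mloc a c" "mloc b c"
  shows "mloc (bor a b k 0) c"
proof -
  obtain N0 where N0: "\<And>l m n w. l \<ge> int N0 \<Longrightarrow> bor a b l m n w = 0"
    using mloc_common[OF assms(1,2,4)] by blast
  obtain N1 where N1: "\<And>l m n w. l \<ge> int N1 \<Longrightarrow> bor a c l m n w = 0"
    using mloc_common[OF assms(1,3,5)] by blast
  obtain N2 where N2: "\<And>l m n w. l \<ge> int N2 \<Longrightarrow> bor b c l m n w = 0"
    using mloc_common[OF assms(2,3,6)] by blast
  define N where "N = max N1 N2"
  \<comment> \<open>The number of factors x - y that raise the exponent k to at least
    \<open>N0\<close>, where locality of \<open>a\<close> and \<open>b\<close> makes all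
    coefficients vanish.\<close>
  define K where "K = nat (int N0 - k)"
  have ac: "bor a c (int N) m n w = 0" and bc: "bor b c (int N) m n w = 0" for m n w
    using N1 N2 by (auto simp: N_def)
  \<comment> \<open>The coefficients of [F(x, y), c(z)] w, where F is the two-variable series with
    coefficients \<open>bor a b (k + int j)\<close>. The product of fields is only the slice m = 0,
    but multiplication by x - y moves m, so the whole series is kept.\<close>
  define f where "f w j = (\<lambda>(m, n, q). bor a b (k + int j) m n (c q w) - c q (bor a b (k + int j) m n w))"
    for w j
  have f_dif: "(dif ex ey ^^ j) (f w 0) = f w j" for w j
  proof (induction j)
    case (Suc j)
    have k: "k + int (Suc j) = (k + int j) + 1" by simp
    show ?case
      unfolding dif_pow_Suc Suc unfolding f_def k bor_Suc[OF assms(1,2)]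
      using assms(3) by (auto simp: dif_def fld_simps)
  qed simp
  have fK: "f w K = (\<lambda>x. 0)" for w
    using N0 assms(3) by (auto simp: f_def K_def fld_simps)
  have killed: "(dif ex ez ^^ N) ((dif ey ez ^^ N) (f w 0)) = (\<lambda>x. 0)" for w
  proof -
    define A where "A = triple_comm a b c w"
    define B where "B = (\<lambda>(m, n, q). triple_comm b a c w (n, m, q))"
    \<comment> \<open>A truncated expansion of \<open>f w 0\<close> into index shifts of the two
      triple commutators. Shifts commute with \<open>dif\<close>, so each summand is killed; the
      cutoff needed for equality depends on the point.\<close>
    define \<phi> where "\<phi> M = (\<lambda>x. \<Sum>i<M. altbin k i *s
       (A (x + (k - int i, int i, 0)) - ((-1) powi k) *s B (x + (int i, k - int i, 0))))" for M :: nat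
    have "\<forall>\<^sub>F M in sequentially. f w 0 x = \<phi> M x" for x
    proof -
      obtain m n q where x: "x = (m, n, q)" by (metis prod_cases3)
      show ?thesis
        using bor_sum_ev[OF assms(1,2), of k m n "c q w"] bor_sum_ev[OF assms(1,2), of k m n w]
      proof eventually_elim
        case (elim M)
        show ?case
          using assms(1-3)
          by (simp add: f_def \<phi>_def x elim A_def B_def triple_comm_def bor_term_def fld_simps
              sum_subtractf[symmetric] algebra_simps)
      qed
    qed
    from dif_pow_eventually[OF dif_pow_eventually[OF this]]
    have "\<forall>\<^sub>F M in sequentially. (dif ex ez ^^ N) ((dif ey ez ^^ N) (f w 0)) x =
       (dif ex ez ^^ N) ((dif ey ez ^^ N) (\<phi> M)) x" for x .
    moreover have "(dif ex ez ^^ N) ((dif ey ez ^^ N) (\<phi> M)) = (\<lambda>x. 0)" for M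
      unfolding \<phi>_def dif_pow_sum dif_pow_scale dif_pow_diff
      unfolding dif_pow_shift[of _ _ _ A] dif_pow_shift[of _ _ _ B]
      unfolding dif_pow_shift
      unfolding A_def B_def triple_comm_killed[OF assms(1-3) ac bc] triple_comm_killed'[OF assms(1-3) ac bc]
      by simp
    ultimately show ?thesis by auto
  qed
  \<comment> \<open>Powers of x - z are known to kill \<open>f w 0\<close> only after multiplication
    by (y - z)^N. The nilpotency lemma is therefore applied to that product, which accounts for the
    second N in the exponent.\<close>
  have "(dif ey ez ^^ (K + N)) ((dif ey ez ^^ N) (f w 0)) = (\<lambda>x. 0)" for w
  proof (rule dif_pow_nilpotent)
    show "(dif ex ey ^^ K) ((dif ey ez ^^ N) (f w 0)) = (\<lambda>x. 0)"
      unfolding dif_pow_commute[where s = ex and t = ey] f_dif fK by (rule dif_pow_zero)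
  qed (rule killed)
  then have *: "(dif ey ez ^^ (K + N + N)) (f w 0) = (\<lambda>x. 0)" for w
    by (metis comp_apply funpow_add)
  \<comment> \<open>Multiplication by y - z leaves the index of x alone, so the slice m = 0 can be
    taken at the end.\<close>
  have L: "bor (bor a b k 0) c (int j) n q w = (dif ey ez ^^ j) (f w 0) (0, n, q)" for j n q w
  proof (induction j arbitrary: n q)
    case 0
    then show ?case
      using assms fld_bor by (simp add: bor_0 f_def)
  next
    case (Suc j)
    show ?case
      unfolding bor_Suc_nat[OF fld_bor[OF assms(1,2)] assms(3)] Suc dif_pow_Suc
      by (simp add: dif_def)
  qed
  then show ?thesis
    unfolding mloc_def by (intro exI[of _ "K + N + N"]) (simp only: L *, simp)
qed

lemma bor_add_left:
  assumes "fld a" "fld b" "fld c"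
  shows "bor (\<lambda>n w. a n w + b n w) c (int j) m n w = bor a c (int j) m n w + bor b c (int j) m n w"
    and "bor (\<lambda>n w. r *s a n w) c (int j) m n w = r *s bor a c (int j) m n w"
    and "fld (\<lambda>n w. a n w + b n w)" "fld (\<lambda>n w. r *s a n w)"
proof -
  have "\<exists>N. \<forall>n\<ge>N. a n w + b n w = 0" for w
  proof -
    obtain N1 N2 where "\<forall>n\<ge>N1. a n w = 0" "\<forall>n\<ge>N2. b n w = 0"
      using assms(1,2) unfolding fld_def by blast
    then show ?thesis by (intro exI[of _ "max N1 N2"]) auto
  qed
  then show f1: "fld (\<lambda>n w. a n w + b n w)"
    using assms(1,2) by (auto simp: fld_def lin_map_def scale_right_distrib)
  show f2: "fld (\<lambda>n w. r *s a n w)"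
    using assms(1) by (auto simp: fld_def lin_map_def scale_right_distrib mult.commute) (metis scale_zero_right)
  show "bor (\<lambda>n w. a n w + b n w) c (int j) m n w = bor a c (int j) m n w + bor b c (int j) m n w"
  proof (induction j arbitrary: m n)
    case 0
    then show ?case using f1 assms by (simp add: bor_0 fld_simps)
  next
    case (Suc j)
    show ?case
      unfolding bor_Suc_nat[OF f1 assms(3)] bor_Suc_nat[OF assms(1,3)] bor_Suc_nat[OF assms(2,3)] Suc by simp
  qed
  show "bor (\<lambda>n w. r *s a n w) c (int j) m n w = r *s bor a c (int j) m n w"
  proof (induction j arbitrary: m n)
    case 0
    then show ?case using f2 assms by (simp add: bor_0 fld_simps scale_right_diff_distrib)
  next
    case (Suc j)
    show ?case
      unfolding bor_Suc_nat[OF f2 assms(3)] bor_Suc_nat[OF assms(1,3)] Suc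
      by (simp add: scale_right_diff_distrib)
  qed
qed

lemma mloc_add:
  assumes "fld a" "fld b" "fld c" "mloc a c" "mloc b c"
  shows "mloc (\<lambda>n w. a n w + b n w) c"
proof -
  obtain N1 where N1: "\<And>l m n w. l \<ge> int N1 \<Longrightarrow> bor a c l m n w = 0"
    using mloc_common[OF assms(1,3,4)] by blast
  obtain N2 where N2: "\<And>l m n w. l \<ge> int N2 \<Longrightarrow> bor b c l m n w = 0"
    using mloc_common[OF assms(2,3,5)] by blast
  show ?thesis
    unfolding mloc_def bor_add_left(1)[OF assms(1-3)] using N1 N2
    by (intro exI[of _ "max N1 N2"]) auto
qed

lemma mloc_scale: "fld a \<Longrightarrow> fld c \<Longrightarrow> mloc a c \<Longrightarrow> mloc (\<lambda>n w. r *s a n w) c"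
  unfolding mloc_def bor_add_left(2)[of a a c] by auto

text \<open>The condition [D, a(x)] = d/dx a(x) in components.\<close>

definition cov :: "('v \<Rightarrow> 'v) \<Rightarrow> (int \<Rightarrow> 'v \<Rightarrow> 'v) \<Rightarrow> bool" where
  "cov D a \<longleftrightarrow> (\<forall>n w. D (a n w) = a n (D w) - of_int n *s a (n - 1) w)"

text \<open>\<open>altbin_absorb\<close> makes consecutive summands cancel. This sum is the error
  term in the proof of \<open>cov_bor\<close>.\<close>

lemma altbin_telescope:
  "(\<Sum>i\<le>M. altbin l i *s (of_int (l - int i) *s h (int i) + of_int (int i) *s h (int i - 1)))
     = (altbin l M * of_int (l - int M)) *s h (int M)"
proof (induction M)
  case (Suc M)
  have "(altbin l (Suc M) * of_nat (Suc M)) *s h (int M) = (- (altbin l M * of_int (l - int M))) *s h (int M)"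
    unfolding altbin_absorb by simp
  then show ?case
    using Suc by (simp add: scale_right_distrib)
qed simp

text \<open>The product is a residue in x of (x - y)^l times the two orderings of a(x) and b(y).
  Since d/dx + d/dy kills (x - y)^l, covariance of the factors gives d/dy of the residue plus the
  residue of an x-derivative; the latter is zero, which in components is the telescoping sum in
  \<open>h\<close>.\<close>

lemma cov_bor:
  assumes "fld a" "fld b" "cov D a" "cov D b" "lin D"
  shows "cov D (bor a b l 0)"
proof -
  have "D (bor a b l 0 n w) = bor a b l 0 n (D w) - of_int n *s bor a b l 0 (n - 1) w" for n w
  proof -
    define \<sigma> :: complex where "\<sigma> = (-1) powi l"
    define h where "h i = a (l - i - 1) (b (n + i) w) - \<sigma> *s b (n + l - i - 1) (a i w)" for i
    have ca: "D (a m v) = a m (D v) - of_int m *s a (m - 1) v"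
      and cb: "D (b m v) = b m (D v) - of_int m *s b (m - 1) v" for m v
      using assms(3,4) by (auto simp: cov_def)
    have t: "D (bor_term a b l 0 n w i) = bor_term a b l 0 n (D w) i - of_int n *s bor_term a b l 0 (n - 1) w i
       - (of_int (l - int i) *s h (int i) + of_int (int i) *s h (int i - 1))" for i
      using assms(1,2)
      by (simp add: bor_term_def lin_map_simps[OF assms(5)] ca cb fld_simps h_def \<sigma>_def[symmetric]
          scale_right_diff_distrib scale_right_distrib scale_left_diff_distrib scale_left_distrib)
        (simp add: algebra_simps)
    obtain N where N: "\<forall>i\<ge>N. b (n + int i) w = 0 \<and> a (0 + int i) w = 0"
      using bor_term_zero[OF assms(1,2)] by blast
    have "\<forall>\<^sub>F M in sequentially. D (bor a b l 0 n w) = bor a b l 0 n (D w) - of_int n *s bor a b l 0 (n - 1) w"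
      using bor_sum_ev[OF assms(1,2), of l 0 n w] bor_sum_ev[OF assms(1,2), of l 0 n "D w"]
        bor_sum_ev[OF assms(1,2), of l 0 "n - 1" w] eventually_ge_at_top[of "Suc N"]
    proof eventually_elim
      case (elim M)
      then obtain M' where M': "M = Suc M'" "M' \<ge> N" by (cases M) auto
      have "h (int M') = 0"
        using N M'(2) assms(1,2) by (simp add: h_def fld_simps)
      then have z: "(\<Sum>i<M. altbin l i *s (of_int (l - int i) *s h (int i) + of_int (int i) *s h (int i - 1))) = 0"
        using altbin_telescope[of l h M'] by (simp add: M' lessThan_Suc_atMost)
      have "D (bor a b l 0 n w) = (\<Sum>i<M. altbin l i *s D (bor_term a b l 0 n w i))"
        by (simp add: elim lin_map_simps[OF assms(5)])
      also have "\<dots> = (\<Sum>i<M. altbin l i *s bor_term a b l 0 n (D w) i) -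
          (\<Sum>i<M. altbin l i *s (of_int n *s bor_term a b l 0 (n - 1) w i)) -
          (\<Sum>i<M. altbin l i *s (of_int (l - int i) *s h (int i) + of_int (int i) *s h (int i - 1)))"
        unfolding t by (simp only: scale_right_diff_distrib sum_subtractf)
      also have "\<dots> = bor a b l 0 n (D w) - of_int n *s bor a b l 0 (n - 1) w"
        unfolding z elim by (simp add: scale_sum_right mult.commute)
      finally show ?case .
    qed
    then show ?thesis by simp
  qed
  then show ?thesis by (simp add: cov_def)
qed

end

section \<open>The state-field correspondence\<close>

context complex_space begin

definition borcherds_lhs ::
  "('v \<Rightarrow> int \<Rightarrow> 'v \<Rightarrow> 'v) \<Rightarrow> 'v \<Rightarrow> 'v \<Rightarrow> int \<Rightarrow> int \<Rightarrow> int \<Rightarrow> 'v \<Rightarrow> 'v" where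
  "borcherds_lhs Y u v l m n w =
     Sum_any (\<lambda>i. (of_int m gchoose i) *s Y (Y u (l + int i) v) (m + n - int i) w)"

text \<open>Pascal's rule: in terms of the common summand \<open>Z\<close>, the sum for l + 1 is
  shifted by one place. The hypothesis bounds all three sums.\<close>

lemma borcherds_lhs_Suc:
  assumes "\<And>i. i \<ge> N \<Longrightarrow> Y (Y u i v) = (\<lambda>n w. 0)"
  shows "borcherds_lhs Y u v (l + 1) m n w = borcherds_lhs Y u v l (m + 1) n w - borcherds_lhs Y u v l m (n + 1) w"
proof -
  define M where "M = nat (N - l)"
  define Z where "Z i = Y (Y u (l + int i) v) (m + n + 1 - int i) w" for i
  have Z: "Z i = 0" if "i \<ge> M" for i
    using that assms[of "l + int i"] by (simp add: Z_def M_def)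
  have 1: "borcherds_lhs Y u v (l + 1) m n w = (\<Sum>i<M. (of_int m gchoose i) *s Z (Suc i))"
  proof -
    have *: "Y (Y u (l + 1 + int i) v) (m + n - int i) w = Z (Suc i)" for i
      by (simp add: Z_def algebra_simps)
    show ?thesis
      unfolding borcherds_lhs_def * by (rule Sum_any_eq_sum) (simp add: Z)
  qed
  have 2: "borcherds_lhs Y u v l (m + 1) n w = (\<Sum>i<Suc M. (of_int (m + 1) gchoose i) *s Z i)"
  proof -
    have *: "Y (Y u (l + int i) v) (m + 1 + n - int i) w = Z i" for i
      by (simp add: Z_def algebra_simps)
    show ?thesis
      unfolding borcherds_lhs_def * by (rule Sum_any_eq_sum) (simp add: Z)
  qed
  have 3: "borcherds_lhs Y u v l m (n + 1) w = (\<Sum>i<Suc M. (of_int m gchoose i) *s Z i)"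
  proof -
    have *: "Y (Y u (l + int i) v) (m + (n + 1) - int i) w = Z i" for i
      by (simp add: Z_def algebra_simps)
    show ?thesis
      unfolding borcherds_lhs_def * by (rule Sum_any_eq_sum) (simp add: Z)
  qed
  have pascal: "of_int (m + 1) gchoose Suc i = (complex_of_int m gchoose i) + (of_int m gchoose Suc i)" for i
    using gbinomial_Suc_Suc[of "complex_of_int m" i] by simp
  show ?thesis
    unfolding 1 2 3 sum.lessThan_Suc_shift pascal
    by (simp add: scale_left_distrib sum.distrib)
qed

text \<open>Both sides of the Borcherds identity satisfy the recursion
  \<open>f (l + 1) m n = f l (m + 1) n - f l m (n + 1)\<close>.  So the case \<open>m = 0\<close> propagates to all \<open>m \<ge> 0\<close>;
  for \<open>m < 0\<close> one descends in \<open>l\<close> from the region where both sides vanish by locality.\<close>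

lemma borcherds_identity:
  assumes "fld (Y u)" "fld (Y v)" "mloc (Y u) (Y v)" "Y 0 = (\<lambda>n w. 0)"
    and iter: "\<And>l. Y (Y u l v) = bor (Y u) (Y v) l 0"
  shows "borcherds_lhs Y u v l m n w = bor (Y u) (Y v) l m n w"
proof -
  obtain N1 where N1: "\<forall>i\<ge>N1. Y u i v = 0"
    using assms(1) unfolding fld_def by blast
  obtain N2 where N2: "\<And>l m n w. l \<ge> int N2 \<Longrightarrow> bor (Y u) (Y v) l m n w = 0"
    using mloc_common[OF assms(1-3)] by blast
  have N1': "Y (Y u i v) = (\<lambda>n w. 0)" if "i \<ge> N1" for i
    using N1 that assms(4) by simp
  have big: "borcherds_lhs Y u v l m n w = bor (Y u) (Y v) l m n w" if "l \<ge> max N1 (int N2)" for l m n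
    using that N2[of l] N1' by (simp add: borcherds_lhs_def)
  have zero: "borcherds_lhs Y u v l 0 n w = bor (Y u) (Y v) l 0 n w" for l n
  proof -
    have "borcherds_lhs Y u v l 0 n w = (\<Sum>i<Suc 0. (0 gchoose i) *s Y (Y u (l + int i) v) (n - int i) w)"
      unfolding borcherds_lhs_def by (simp only: of_int_0 add_0, rule Sum_any_eq_sum) (auto dest!: Suc_le_D)
    then show ?thesis by (simp add: iter)
  qed
  note rec = borcherds_lhs_Suc[of N1 Y u v, OF N1'] bor_Suc[OF assms(1,2)]
  have pos: "borcherds_lhs Y u v l (int m) n w = bor (Y u) (Y v) l (int m) n w" for m :: nat and l n
  proof (induction m arbitrary: l n)
    case (Suc m)
    have "borcherds_lhs Y u v l (int m + 1) n w = borcherds_lhs Y u v (l + 1) (int m) n w + borcherds_lhs Y u v l (int m) (n + 1) w"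
      by (simp add: rec(1))
    also have "\<dots> = bor (Y u) (Y v) l (int m + 1) n w"
      unfolding Suc by (simp add: rec(2))
    finally show ?case by (simp add: add.commute)
  qed (simp add: zero)
  have neg: "borcherds_lhs Y u v l (- int m) n w = bor (Y u) (Y v) l (- int m) n w" for m :: nat and l n
  proof (induction m arbitrary: l n)
    case 0
    then show ?case by (simp add: zero)
  next
    case (Suc m)
    define N where "N = max N1 (int N2)"
    have e: "- int (Suc m) + 1 = - int m" by simp
    have "borcherds_lhs Y u v (N - int k) (- int (Suc m)) n w = bor (Y u) (Y v) (N - int k) (- int (Suc m)) n w" for k n
    proof (induction k arbitrary: n)
      case 0
      then show ?case using big[of N] by (simp add: N_def)
    next
      case (Suc k)
      have e2: "N - int (Suc k) + 1 = N - int k" by simp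
      show ?case
        using rec(1)[of "N - int (Suc k)" "- int (Suc m)" "n - 1" w]
          rec(2)[of "N - int (Suc k)" "- int (Suc m)" "n - 1" w]
          Suc[of "n - 1"] \<open>\<And>l n. borcherds_lhs Y u v l (- int m) n w = _\<close>[of "N - int (Suc k)" "n - 1"]
        unfolding e e2 by simp
    qed
    from this[of "nat (N - l)"] big[of l] show ?case
      by (cases "l \<ge> N") (auto simp: N_def[symmetric])
  qed
  show ?thesis
    using pos[of l "nat m" n] neg[of l "nat (- m)" n] by (cases "m \<ge> 0") auto
qed

end

text \<open>A set \<open>G\<close> of generating fields on the range of the projection \<open>p\<close>, extended by \<open>0\<close> to the kernel.\<close>

locale field_family = complex_space scale
  for scale :: "complex \<Rightarrow> 'v::ab_group_add \<Rightarrow> 'v" (infixr "*s" 75) +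
  fixes p D :: "'v \<Rightarrow> 'v" and vac :: 'v and G :: "(int \<Rightarrow> 'v \<Rightarrow> 'v) set"
  assumes p_lin: "lin p" and p_p [simp]: "p (p w) = p w" and p_vac [simp]: "p vac = vac"
    and D_lin: "lin D" and D_p [simp]: "D (p w) = D w" and p_D [simp]: "p (D w) = D w" and D_vac: "D vac = 0"
    and G_fld: "a \<in> G \<Longrightarrow> fld a"
    and G_p: "a \<in> G \<Longrightarrow> a n (p w) = a n w" and p_G: "a \<in> G \<Longrightarrow> p (a n w) = a n w"
    and G_vac: "a \<in> G \<Longrightarrow> n \<ge> 0 \<Longrightarrow> a n vac = 0"
    and G_cov: "a \<in> G \<Longrightarrow> cov D a"
    and G_mloc: "a \<in> G \<Longrightarrow> b \<in> G \<Longrightarrow> mloc a b"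
    and gen_induct: "Q vac \<Longrightarrow> (\<And>x y. Q x \<Longrightarrow> Q y \<Longrightarrow> Q (x + y)) \<Longrightarrow> (\<And>c x. Q x \<Longrightarrow> Q (c *s x)) \<Longrightarrow>
          (\<And>a n x. a \<in> G \<Longrightarrow> Q x \<Longrightarrow> p x = x \<Longrightarrow> Q (a n x)) \<Longrightarrow> Q (p w)"
begin

section \<open>Fields on the range of \<open>p\<close> and the family generated by
  \<open>G\<close>\<close>

definition idf :: "int \<Rightarrow> 'v \<Rightarrow> 'v" where
  "idf n w = (if n = -1 then p w else 0)"

text \<open>The last clause makes the modes factor through \<open>p\<close> and land in its range.
  Equality of operators on that range thereby becomes equality of functions, which is what allows
  \<open>Yf\<close> to be defined by \<open>THE\<close>.\<close>

definition good :: "(int \<Rightarrow> 'v \<Rightarrow> 'v) \<Rightarrow> bool" where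
  "good a \<longleftrightarrow> fld a \<and> cov D a \<and> (\<forall>n\<ge>0. a n vac = 0) \<and> (\<forall>n w. a n (p w) = a n w \<and> p (a n w) = a n w)"

lemma good_fld: "good a \<Longrightarrow> fld a"
  and good_cov: "good a \<Longrightarrow> D (a n w) = a n (D w) - of_int n *s a (n - 1) w"
  and good_vac: "good a \<Longrightarrow> n \<ge> 0 \<Longrightarrow> a n vac = 0"
  and good_p: "good a \<Longrightarrow> a n (p w) = a n w"
  and p_good: "good a \<Longrightarrow> p (a n w) = a n w"
  by (auto simp: good_def cov_def)

lemma good_G: "a \<in> G \<Longrightarrow> good a"
  by (simp add: good_def G_fld G_cov G_vac G_p p_G)

lemma good_idf: "good idf"
proof -
  have "\<exists>N. \<forall>n\<ge>N. idf n w = 0" for w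
    by (intro exI[of _ 0]) (auto simp: idf_def)
  then show ?thesis
    by (auto simp: good_def fld_def lin_map_def idf_def lin_map_simps[OF p_lin] lin_map_simps[OF D_lin] cov_def)
qed

lemma good_add: "good a \<Longrightarrow> good b \<Longrightarrow> good (\<lambda>n w. a n w + b n w)"
  by (simp add: good_def bor_add_left(3)[of a b a] cov_def lin_map_simps[OF D_lin] lin_map_simps[OF p_lin] scale_right_distrib)

lemma good_scale: "good a \<Longrightarrow> good (\<lambda>n w. c *s a n w)"
  by (simp add: good_def bor_add_left[of a a a] cov_def lin_map_simps[OF D_lin] lin_map_simps[OF p_lin]
      scale_right_diff_distrib mult.commute)

lemma good_prod:
  assumes "good a" "good b"
  shows "good (bor a b l 0)"
proof -
  note f = good_fld[OF assms(1)] good_fld[OF assms(2)]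
  have *: "bor_term a b l 0 n (p w) i = bor_term a b l 0 n w i"
    "p (bor_term a b l 0 n w i) = bor_term a b l 0 n w i" for i n w
    using assms by (auto simp: bor_term_def lin_map_simps[OF p_lin] good_p p_good)
  have "p (bor a b l 0 n w) = bor a b l 0 n w" for n w
  proof -
    have "\<forall>\<^sub>F M in sequentially. p (bor a b l 0 n w) = bor a b l 0 n w"
      using bor_sum_ev[OF f, of l 0 n w] by eventually_elim (simp add: lin_map_simps[OF p_lin] *)
    then show ?thesis by simp
  qed
  moreover have "bor a b l 0 n (p w) = bor a b l 0 n w" for n w
    by (simp add: bor_def *)
  moreover have "bor a b l 0 n vac = 0" if "n \<ge> 0" for n
  proof -
    have "bor_term a b l 0 n vac i = 0" for i
      using assms that f by (simp add: bor_term_def good_vac fld_simps)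
    then show ?thesis by (simp add: bor_def)
  qed
  moreover have "cov D (bor a b l 0)"
    using assms f D_lin by (intro cov_bor) (auto simp: good_def)
  ultimately show ?thesis
    using fld_bor[OF f] by (auto simp: good_def)
qed

text \<open>Nonnegative modes of both fields kill the vacuum, so only the summand i = 0 of the first
  ordering survives.\<close>

lemma prod_state:
  assumes "good a" "good b"
  shows "bor a b l 0 (-1) vac = a l (b (-1) vac)"
proof -
  note f = good_fld[OF assms(1)] good_fld[OF assms(2)]
  have "bor_term a b l 0 (-1) vac i = (if i = 0 then a l (b (-1) vac) else 0)" for i
    using assms by (auto simp: bor_term_def good_vac fld_simps f)
  then have "bor a b l 0 (-1) vac = (\<Sum>i<Suc 0. altbin l i *s bor_term a b l 0 (-1) vac i)"
    unfolding bor_def by (intro Sum_any_eq_sum) auto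
  then show ?thesis
    using assms f by (simp add: bor_term_def good_vac fld_simps)
qed

lemma mloc_idf: "good a \<Longrightarrow> mloc idf a"
  unfolding mloc_def using good_fld[OF good_idf] good_fld[of a]
  by (intro exI[of _ 0]) (auto simp: bor_0 idf_def good_p p_good fld_simps)

text \<open>The left factor of a product is always a generator. This matches the form
  \<open>a n x\<close> of the vectors in \<open>gen_induct\<close>, and it keeps the inductions that
  use Dong's lemma on a single field.\<close>

inductive F :: "(int \<Rightarrow> 'v \<Rightarrow> 'v) \<Rightarrow> bool" where
  idf: "F idf"
| prod: "a \<in> G \<Longrightarrow> F b \<Longrightarrow> F (bor a b l 0)"
| add: "F a \<Longrightarrow> F b \<Longrightarrow> F (\<lambda>n w. a n w + b n w)"
| smult: "F a \<Longrightarrow> F (\<lambda>n w. c *s a n w)"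

lemma F_good: "F a \<Longrightarrow> good a"
  by (induction rule: F.induct) (auto simp: good_idf good_prod good_G good_add good_scale)

lemmas F_fld = good_fld[OF F_good]

text \<open>Locality against generators comes first: it supplies the locality of the two factors
  with each other, which Dong's lemma asks for here and again in \<open>mloc_F\<close>.\<close>

lemma mloc_F_G: "F a \<Longrightarrow> c \<in> G \<Longrightarrow> mloc a c"
proof (induction arbitrary: c rule: F.induct)
  case (prod a b l)
  have "mloc a b" by (rule mloc_sym[OF F_fld[OF prod(2)] G_fld[OF prod(1)] prod(3)[OF prod(1)]])
  then show ?case
    by (rule dong[OF G_fld[OF prod(1)] F_fld[OF prod(2)] G_fld[OF prod(4)] _ G_mloc[OF prod(1,4)] prod(3)[OF prod(4)]])
qed (auto simp: mloc_idf good_G mloc_add mloc_scale F_fld G_fld)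

lemma mloc_F: "F a \<Longrightarrow> F c \<Longrightarrow> mloc a c"
proof (induction rule: F.induct)
  case (prod a b l)
  have "mloc a b" by (rule mloc_sym[OF F_fld[OF prod(2)] G_fld[OF prod(1)] mloc_F_G[OF prod(2,1)]])
  moreover have "mloc a c"
    by (rule mloc_sym[OF F_fld[OF prod(4)] G_fld[OF prod(1)] mloc_F_G[OF prod(4,1)]])
  ultimately show ?case
    by (rule dong[OF G_fld[OF prod(1)] F_fld[OF prod(2)] F_fld[OF prod(4)] _ _ prod(3)[OF prod(4)]])
qed (auto simp: mloc_idf F_good mloc_add mloc_scale F_fld)

lemma F_surj: "\<exists>a. F a \<and> a (-1) vac = p w"
proof (rule gen_induct)
  show "\<exists>a. F a \<and> a (-1) vac = vac"
    using idf by (intro exI[of _ idf]) (simp add: idf_def)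
  show "\<exists>a. F a \<and> a (-1) vac = x + y"
    if "\<exists>a. F a \<and> a (-1) vac = x" "\<exists>a. F a \<and> a (-1) vac = y" for x y
    using that F.add by blast
  show "\<exists>a. F a \<and> a (-1) vac = c *s x" if "\<exists>a. F a \<and> a (-1) vac = x" for x c
    using that F.smult by blast
  show "\<exists>a'. F a' \<and> a' (-1) vac = a n x" if "a \<in> G" "\<exists>a. F a \<and> a (-1) vac = x" "p x = x" for a n x
    using that F.prod prod_state[OF good_G F_good] by blast
qed

text \<open>Goddard's uniqueness argument. As \<open>D vac = 0\<close>, covariance reads (k+1)
  a(-k-2) vac = D (a(-k-1) vac), so a(x) vac vanishes together with a(-1) vac. For a field
  \<open>b\<close> with b(-1) vac = p w, locality then gives (x - y)^N a(x) b(y) vac = 0, and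
  setting y = 0 leaves x^N a(x) p w = 0.\<close>

lemma goddard_zero:
  assumes "good a" "\<And>b. F b \<Longrightarrow> mloc a b" "a (-1) vac = 0"
  shows "a n w = 0"
proof -
  have "a (- int k - 1) vac = 0" for k
  proof (induction k)
    case 0
    then show ?case using assms(3) by simp
  next
    case (Suc k)
    have "D (a (- int k - 1) vac) = a (- int k - 1) (D vac) - of_int (- int k - 1) *s a (- int k - 1 - 1) vac"
      using good_cov[OF assms(1), of "- int k - 1" vac] by simp
    then have "of_int (- int k - 1) *s a (- int k - 1 - 1) vac = 0"
      using Suc good_fld[OF assms(1)] by (simp add: D_vac fld_simps lin_map_simps[OF D_lin])
    moreover have "complex_of_int (- int k - 1) \<noteq> 0"
      unfolding of_int_eq_0_iff by linarith
    ultimately have "a (- int k - 1 - 1) vac = 0"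
      using scale_eq_0_iff by blast
    then show ?case by (simp add: algebra_simps)
  qed
  note neg = this
  have v: "a n vac = 0" for n
    using good_vac[OF assms(1), of n] neg[of "nat (- n - 1)"] by (cases "n \<ge> 0") auto
  obtain b where b: "F b" "b (-1) vac = p w"
    using F_surj by blast
  note f = good_fld[OF assms(1)] F_fld[OF b(1)]
  obtain N where N: "\<And>m n w. bor a b (int N) m n w = 0"
    using assms(2)[OF b(1)] unfolding mloc_def by blast
  \<comment> \<open>The index n - N offsets the factor x^N, and -1 picks the coefficient of
    y^0.\<close>
  have t: "bor_term a b (int N) (n - int N) (-1) vac i = (if i = 0 then a n (p w) else 0)" for i
    using v good_vac[OF F_good[OF b(1)]] b(2) f by (simp add: bor_term_def fld_simps)
  have "bor a b (int N) (n - int N) (-1) vac =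
      (\<Sum>i<Suc 0. altbin N i *s bor_term a b (int N) (n - int N) (-1) vac i)"
    unfolding bor_def by (intro Sum_any_eq_sum) (simp add: t)
  then have "a n (p w) = 0"
    using N by (simp add: t)
  then show ?thesis
    using good_p[OF assms(1)] by simp
qed

lemma goddard:
  assumes "good a" "good a'" "\<And>b. F b \<Longrightarrow> mloc a b" "\<And>b. F b \<Longrightarrow> mloc a' b" "a (-1) vac = a' (-1) vac"
  shows "a = a'"
proof -
  have "a n w + (-1) *s a' n w = 0" for n w
  proof (rule goddard_zero[of "\<lambda>n w. a n w + (-1) *s a' n w"])
    show "good (\<lambda>n w. a n w + (-1) *s a' n w)"
      by (intro good_add good_scale assms)
    show "mloc (\<lambda>n w. a n w + (-1) *s a' n w) b" if "F b" for b
      using that by (intro mloc_add mloc_scale assms good_fld[OF good_scale] good_fld F_fld)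
    show "a (-1) vac + (-1) *s a' (-1) vac = 0"
      using assms(5) by simp
  qed
  then show ?thesis by (auto simp: fun_eq_iff)
qed

definition Yf :: "'v \<Rightarrow> int \<Rightarrow> 'v \<Rightarrow> 'v" where
  "Yf u = (THE a. F a \<and> a (-1) vac = p u)"

lemma Yf: "F (Yf u)" "Yf u (-1) vac = p u"
proof -
  have "\<exists>!a. F a \<and> a (-1) vac = p u"
    using F_surj[of u] goddard F_good mloc_F by metis
  from theI'[OF this] show "F (Yf u)" "Yf u (-1) vac = p u"
    by (simp_all add: Yf_def)
qed

lemma Yf_good: "good (Yf u)"
  by (simp add: F_good Yf)

lemmas Yf_fld = good_fld[OF Yf_good]
lemmas Yf_simps = fld_simps[OF Yf_fld]

text \<open>Each rule for \<open>Yf\<close> below comes from this: a candidate field is shown to be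
  good, local to all of \<open>F\<close>, and correct at the vacuum.\<close>

lemma Yf_unique: "good a \<Longrightarrow> (\<And>b. F b \<Longrightarrow> mloc a b) \<Longrightarrow> a (-1) vac = p u \<Longrightarrow> Yf u = a"
  using goddard[of "Yf u" a] Yf mloc_F F_good by auto

lemma Yf_G: "a \<in> G \<Longrightarrow> Yf (a (-1) vac) = a"
  by (intro Yf_unique) (auto simp: good_G p_G intro: mloc_sym[OF F_fld G_fld] mloc_F_G)

lemma Yf_add: "Yf (u + v) = (\<lambda>n w. Yf u n w + Yf v n w)"
  by (intro Yf_unique F_good F.add mloc_F) (simp_all add: Yf lin_map_simps[OF p_lin])

lemma Yf_scale: "Yf (c *s u) = (\<lambda>n w. c *s Yf u n w)"
  by (intro Yf_unique F_good F.smult mloc_F) (simp_all add: Yf lin_map_simps[OF p_lin])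

lemma Yf_p: "Yf (p u) = Yf u"
  by (simp add: Yf_def)

lemma Yf_0: "Yf 0 = (\<lambda>n w. 0)"
  using Yf_scale[of 0 0] by simp

lemma Yf_vac: "Yf vac = idf"
  by (intro Yf_unique) (auto simp: good_idf idf_def mloc_idf F_good)

lemma Yf_prod: "Yf (Yf u l v) = bor (Yf u) (Yf v) l 0"
proof (rule Yf_unique)
  show "good (bor (Yf u) (Yf v) l 0)"
    by (intro good_prod Yf_good)
  show "mloc (bor (Yf u) (Yf v) l 0) b" if "F b" for b
    using that by (intro dong Yf_fld F_fld mloc_F Yf)
  show "bor (Yf u) (Yf v) l 0 (-1) vac = p (Yf u l v)"
    by (simp add: prod_state Yf_good Yf good_p p_good)
qed

lemma Yf_D: "Yf u (-2) vac = D u"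
  using good_cov[OF Yf_good, of u "-1" vac] Yf(2) by (simp add: D_vac Yf_simps)

lemma Yf_jacobi: "borcherds_lhs Yf u v l m n w = bor (Yf u) (Yf v) l m n w"
  by (intro borcherds_identity Yf_fld Yf_0 Yf_prod mloc_F Yf)

end

section \<open>Quotients of complex modules and the free algebra\<close>

lemma carrier_CC [simp]: "carrier CC = UNIV"
  and add_CC [simp]: "c \<oplus>\<^bsub>CC\<^esub> d = c + d"
  and mult_CC [simp]: "c \<otimes>\<^bsub>CC\<^esub> d = c * d"
  and one_CC [simp]: "\<one>\<^bsub>CC\<^esub> = 1"
  and zero_CC [simp]: "\<zero>\<^bsub>CC\<^esub> = 0"
  by (simp_all add: ring_of_type_algebra_def)

lemma module_CC_I:
  assumes "abelian_group M"
    and "\<And>c x. x \<in> carrier M \<Longrightarrow> c \<odot>\<^bsub>M\<^esub> x \<in> carrier M"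
    and "\<And>c d x. x \<in> carrier M \<Longrightarrow> (c + d) \<odot>\<^bsub>M\<^esub> x = c \<odot>\<^bsub>M\<^esub> x \<oplus>\<^bsub>M\<^esub> d \<odot>\<^bsub>M\<^esub> x"
    and "\<And>c x y. x \<in> carrier M \<Longrightarrow> y \<in> carrier M \<Longrightarrow> c \<odot>\<^bsub>M\<^esub> (x \<oplus>\<^bsub>M\<^esub> y) = c \<odot>\<^bsub>M\<^esub> x \<oplus>\<^bsub>M\<^esub> c \<odot>\<^bsub>M\<^esub> y"
    and "\<And>c d x. x \<in> carrier M \<Longrightarrow> (c * d) \<odot>\<^bsub>M\<^esub> x = c \<odot>\<^bsub>M\<^esub> (d \<odot>\<^bsub>M\<^esub> x)"
    and "\<And>x. x \<in> carrier M \<Longrightarrow> 1 \<odot>\<^bsub>M\<^esub> x = x"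
  shows "module CC M"
  using assms by (intro moduleI) auto

section \<open>Submodules, spans and quotients of complex modules\<close>

locale cmodule = module CC M for M :: "(complex, 'v) module" (structure)
begin

lemma minus_smult: "x \<in> carrier M \<Longrightarrow> \<ominus> x = (-1) \<odot> x"
proof -
  assume x: "x \<in> carrier M"
  have "x \<oplus> (-1) \<odot> x = 0 \<odot> x"
    using smult_l_distr[of 1 "-1" x] smult_one[OF x] x by simp
  also have "\<dots> = \<zero>"
    using smult_l_null[OF x] by simp
  finally show ?thesis
    using x by (intro M.minus_equality) (simp_all add: M.a_comm)
qed

lemma subspaceI:
  assumes "W \<subseteq> carrier M" "\<zero> \<in> W" "\<And>x y. x \<in> W \<Longrightarrow> y \<in> W \<Longrightarrow> x \<oplus> y \<in> W"
    "\<And>c x. x \<in> W \<Longrightarrow> c \<odot> x \<in> W"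
  shows "submodule W CC M"
proof (rule submoduleI)
  show "\<ominus> a \<in> W" if "a \<in> W" for a
    using that assms(1) assms(4)[of a "-1"] minus_smult[of a] by (simp add: subset_iff)
qed (use assms in auto)

lemma subspaceD:
  assumes "submodule W CC M"
  shows "W \<subseteq> carrier M" "\<zero> \<in> W" "\<And>x y. x \<in> W \<Longrightarrow> y \<in> W \<Longrightarrow> x \<oplus> y \<in> W"
    "\<And>c x. x \<in> W \<Longrightarrow> c \<odot> x \<in> W" "\<And>x y. x \<in> W \<Longrightarrow> y \<in> W \<Longrightarrow> x \<ominus> y \<in> W"
proof -
  interpret W: submodule W CC M by fact
  show 1: "W \<subseteq> carrier M" "\<zero> \<in> W" "\<And>x y. x \<in> W \<Longrightarrow> y \<in> W \<Longrightarrow> x \<oplus> y \<in> W"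
    "\<And>c x. x \<in> W \<Longrightarrow> c \<odot> x \<in> W"
    using W.subset W.one_closed W.m_closed W.smult_closed by auto
  show "x \<ominus> y \<in> W" if "x \<in> W" "y \<in> W" for x y
    using 1(1) 1(3)[OF that(1) 1(4)[OF that(2), of "-1"]] that minus_smult[of y]
    by (simp add: a_minus_def subset_iff)
qed

lemma lin_span_submodule:
  assumes "P \<subseteq> carrier M"
  shows "submodule (lin_span M P) CC M"
proof -
  have "submodule (carrier M) CC M"
    by (rule subspaceI) auto
  then have c: "carrier M \<in> {W. submodule W CC M \<and> P \<subseteq> W}"
    using assms by simp
  show ?thesis
  proof (rule subspaceI)
    show "lin_span M P \<subseteq> carrier M"
      unfolding lin_span_def by (rule Inter_lower[OF c])
  qed (auto simp: lin_span_def subspaceD)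
qed

lemma lin_span_base: "P \<subseteq> lin_span M P"
  by (auto simp: lin_span_def)

lemma lin_span_minimal: "submodule W CC M \<Longrightarrow> P \<subseteq> W \<Longrightarrow> lin_span M P \<subseteq> W"
  by (auto simp: lin_span_def)

lemma lin_span_induct [consumes 2, case_names base zero add smult]:
  assumes "P \<subseteq> carrier M" "x \<in> lin_span M P"
    and "\<And>x. x \<in> P \<Longrightarrow> Q x" "Q \<zero>"
    and "\<And>x y. x \<in> carrier M \<Longrightarrow> y \<in> carrier M \<Longrightarrow> Q x \<Longrightarrow> Q y \<Longrightarrow> Q (x \<oplus> y)"
    and "\<And>c x. x \<in> carrier M \<Longrightarrow> Q x \<Longrightarrow> Q (c \<odot> x)"
  shows "Q x"
proof -
  have "submodule {x \<in> carrier M. Q x} CC M"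
    by (rule subspaceI) (use assms in auto)
  from lin_span_minimal[OF this, of P] show ?thesis
    using assms by auto
qed

end

locale cquot = cmodule M for M :: "(complex, 'v) module" (structure) +
  fixes I
  assumes sub: "submodule I CC M"
begin

abbreviation Q where "Q \<equiv> quotient_alg M I"

sublocale I: abelian_subgroup I M
proof (rule abelian_subgroupI3)
  show "additive_subgroup I M"
    using sub by (simp add: additive_subgroup.intro submodule_def)
qed (rule M.abelian_group_axioms)

lemmas I_subD = subspaceD[OF sub]

lemma coset_eq_iff:
  assumes "x \<in> carrier M" "y \<in> carrier M"
  shows "I +> x = I +> y \<longleftrightarrow> x \<ominus> y \<in> I"
proof
  assume "I +> x = I +> y"
  then have "x \<in> I +> y" using I.a_rcos_self[OF assms(1)] by simp
  then obtain h where "h \<in> I" "x = h \<oplus> y" by (auto simp: a_r_coset_def')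
  then show "x \<ominus> y \<in> I"
    using assms I.a_subset by (simp add: M.minus_eq M.a_assoc M.r_neg subset_iff)
next
  assume "x \<ominus> y \<in> I"
  then have "(x \<ominus> y) \<oplus> y \<in> I +> y"
    by (intro M.a_rcosI I.a_subset assms)
  then show "I +> x = I +> y"
    using M.a_repr_independence[OF _ assms(2) I.a_subgroup] assms
    by (simp add: M.minus_eq M.a_assoc M.l_neg)
qed

lemma coset_zero_iff: "x \<in> carrier M \<Longrightarrow> I +> x = I \<longleftrightarrow> x \<in> I"
  using M.a_coset_join1 M.a_coset_join2 I.a_subgroup by blast

lemma coset_elem: "y \<in> I +> x \<Longrightarrow> x \<in> carrier M \<Longrightarrow> y \<in> carrier M \<and> y \<ominus> x \<in> I \<and> I +> y = I +> x"
proof -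
  assume *: "y \<in> I +> x" "x \<in> carrier M"
  then have "I +> y = I +> x" "y \<in> carrier M"
    using M.a_repr_independence[OF *(1,2) I.a_subgroup] M.a_r_coset_subset_G[OF I.a_subset *(2)] by auto
  then show ?thesis using coset_eq_iff * by auto
qed

lemma carrier_Q: "carrier Q = (\<lambda>x. I +> x) ` carrier M"
  by (auto simp: quotient_alg_def A_RCOSETS_def')

lemma coset_in_Q [simp, intro]: "x \<in> carrier M \<Longrightarrow> I +> x \<in> carrier Q"
  by (simp add: carrier_Q)

lemma Q_cases: "Z \<in> carrier Q \<Longrightarrow> (\<And>x. x \<in> carrier M \<Longrightarrow> Z = I +> x \<Longrightarrow> thesis) \<Longrightarrow> thesis"
  by (auto simp: carrier_Q)

lemma zero_Q: "\<zero>\<^bsub>Q\<^esub> = I"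
  by (simp add: quotient_alg_def)

lemma zero_Q': "\<zero>\<^bsub>Q\<^esub> = I +> \<zero>"
  by (simp add: zero_Q I.a_subset)

lemma add_Q: "x \<in> carrier M \<Longrightarrow> y \<in> carrier M \<Longrightarrow> (I +> x) \<oplus>\<^bsub>Q\<^esub> (I +> y) = I +> (x \<oplus> y)"
  by (simp add: quotient_alg_def I.a_rcos_sum)

lemma union_coset:
  assumes "x \<in> carrier M" "\<And>y. y \<in> carrier M \<Longrightarrow> y \<ominus> x \<in> I \<Longrightarrow> f y = Z"
  shows "(\<Union>y\<in>I +> x. f y) = Z"
  using assms I.a_rcos_self[OF assms(1)] coset_elem by blast

text \<open>Scalar multiplication on a quotient and \<open>ind_act\<close> are unions of cosets over
  all representatives. For an additive map that preserves \<open>I\<close> all those cosets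
  coincide, so the union is the expected one.\<close>

lemma union_map:
  assumes "x \<in> carrier M" "f \<in> carrier M \<rightarrow> carrier M"
    "\<And>x y. x \<in> carrier M \<Longrightarrow> y \<in> carrier M \<Longrightarrow> f (x \<oplus> y) = f x \<oplus> f y" "\<And>x. x \<in> I \<Longrightarrow> f x \<in> I"
  shows "(\<Union>y\<in>I +> x. I +> f y) = I +> f x"
proof (rule union_coset[OF assms(1)])
  fix y assume y: "y \<in> carrier M" "y \<ominus> x \<in> I"
  have "f y = f ((y \<ominus> x) \<oplus> x)"
    using y assms(1) by (simp add: M.minus_eq M.a_assoc M.l_neg)
  also have "\<dots> = f (y \<ominus> x) \<oplus> f x"
    using y assms(1) by (intro assms(3)) auto
  finally have fy: "f y = f (y \<ominus> x) \<oplus> f x" .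
  have c: "f (y \<ominus> x) \<in> carrier M" "f x \<in> carrier M" "f y \<in> carrier M"
    using y assms(1,2) by auto
  then have "f y \<ominus> f x = f (y \<ominus> x)"
    unfolding fy by (simp add: M.minus_eq M.a_assoc M.r_neg)
  then show "I +> f y = I +> f x"
    using c assms(4)[OF y(2)] by (simp add: coset_eq_iff)
qed

lemma smult_Q: "x \<in> carrier M \<Longrightarrow> c \<odot>\<^bsub>Q\<^esub> (I +> x) = I +> (c \<odot> x)"
  unfolding quotient_alg_def by (simp, rule union_map) (auto simp: smult_r_distr I_subD)

text \<open>The version for two arguments, for the product of a quotient and for
  \<open>VB_Y\<close>; two-sided absorption by \<open>I\<close> makes the coset independent of both
  representatives.\<close>

lemma union_map2:
  assumes xy: "x \<in> carrier M" "y \<in> carrier M"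
    and f: "\<And>x y. x \<in> carrier M \<Longrightarrow> y \<in> carrier M \<Longrightarrow> f x y \<in> carrier M"
    and l: "\<And>x y z. x \<in> carrier M \<Longrightarrow> y \<in> carrier M \<Longrightarrow> z \<in> carrier M \<Longrightarrow> f (x \<oplus> y) z = f x z \<oplus> f y z"
    and r: "\<And>x y z. x \<in> carrier M \<Longrightarrow> y \<in> carrier M \<Longrightarrow> z \<in> carrier M \<Longrightarrow> f z (x \<oplus> y) = f z x \<oplus> f z y"
    and i: "\<And>x y. x \<in> I \<Longrightarrow> y \<in> carrier M \<Longrightarrow> f x y \<in> I" "\<And>x y. x \<in> I \<Longrightarrow> y \<in> carrier M \<Longrightarrow> f y x \<in> I"
  shows "(\<Union>a\<in>I +> x. \<Union>b\<in>I +> y. I +> f a b) = I +> f x y"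
proof -
  have "(\<Union>b\<in>I +> y. I +> f a b) = I +> f a y" if "a \<in> carrier M" for a
    by (intro union_map xy Pi_I f r i that)
  then have "(\<Union>a\<in>I +> x. \<Union>b\<in>I +> y. I +> f a b) = (\<Union>a\<in>I +> x. I +> f a y)"
    using coset_elem[OF _ xy(1)] by blast
  also have "\<dots> = I +> f x y"
    by (intro union_map xy Pi_I f l i)
  finally show ?thesis .
qed

lemma module_Q: "module CC Q"
proof (rule module_CC_I)
  show "abelian_group Q"
  proof (rule abelian_groupI)
    show "\<exists>y\<in>carrier Q. y \<oplus>\<^bsub>Q\<^esub> x = \<zero>\<^bsub>Q\<^esub>" if x: "x \<in> carrier Q" for x
    proof -
      obtain z where z: "z \<in> carrier M" "x = I +> z" using Q_cases[OF x] by blast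
      then have "(I +> (\<ominus> z)) \<oplus>\<^bsub>Q\<^esub> x = \<zero>\<^bsub>Q\<^esub>"
        by (simp add: add_Q zero_Q' M.l_neg)
      then show ?thesis using z by blast
    qed
  qed (auto elim!: Q_cases simp: add_Q M.a_ac zero_Q')
qed (auto elim!: Q_cases simp: add_Q smult_Q smult_l_distr[simplified] smult_r_distr smult_assoc1[simplified] smult_one[simplified])

lemma mult_Q:
  assumes "x \<in> carrier M" "y \<in> carrier M"
    "\<And>x y. x \<in> carrier M \<Longrightarrow> y \<in> carrier M \<Longrightarrow> x \<otimes> y \<in> carrier M"
    "\<And>x y z. x \<in> carrier M \<Longrightarrow> y \<in> carrier M \<Longrightarrow> z \<in> carrier M \<Longrightarrow> (x \<oplus> y) \<otimes> z = x \<otimes> z \<oplus> y \<otimes> z"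
    "\<And>x y z. x \<in> carrier M \<Longrightarrow> y \<in> carrier M \<Longrightarrow> z \<in> carrier M \<Longrightarrow> z \<otimes> (x \<oplus> y) = z \<otimes> x \<oplus> z \<otimes> y"
    "\<And>x y. x \<in> I \<Longrightarrow> y \<in> carrier M \<Longrightarrow> x \<otimes> y \<in> I" "\<And>x y. x \<in> I \<Longrightarrow> y \<in> carrier M \<Longrightarrow> y \<otimes> x \<in> I"
  shows "(I +> x) \<otimes>\<^bsub>Q\<^esub> (I +> y) = I +> (x \<otimes> y)"
  unfolding quotient_alg_def using union_map2[OF assms] by (simp add: rcoset_mult_def)

end

section \<open>The free associative algebra and its evaluation at operators\<close>

abbreviation pscale :: "complex \<Rightarrow> ('k \<Rightarrow>\<^sub>0 complex) \<Rightarrow> 'k \<Rightarrow>\<^sub>0 complex" where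
  "pscale c \<equiv> Poly_Mapping.map ((*) c)"

lemma lookup_pscale [simp]: "Poly_Mapping.lookup (pscale c f) k = c * Poly_Mapping.lookup f k"
  by (simp add: Poly_Mapping.map.rep_eq when_def)

lemma poly_mapping_add_induct [case_names zero add]:
  fixes f :: "'k \<Rightarrow>\<^sub>0 'y::comm_monoid_add"
  assumes "P 0" "\<And>k v f. P f \<Longrightarrow> P (Poly_Mapping.single k v + f)"
  shows "P f"
proof (induction "Poly_Mapping.keys f" arbitrary: f rule: infinite_finite_induct)
  case (insert k K)
  define g where "g = Poly_Mapping.update k 0 f"
  have f: "f = Poly_Mapping.single k (Poly_Mapping.lookup f k) + g"
    by (rule poly_mapping_eqI) (auto simp: g_def lookup_add lookup_update lookup_single when_def)
  have "K = Poly_Mapping.keys g"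
    using insert by (auto simp: g_def keys_update)
  then show ?case
    using insert f assms(2) by metis
qed (use assms(1) in \<open>auto simp: eq_commute[of "{}"]\<close>)

lemma pscale_mult: "pscale c (f * g) = pscale c f * g" "f * pscale c g = pscale c (f * g)"
  for f g :: "'k::monoid_add \<Rightarrow>\<^sub>0 complex"
proof -
  show "pscale c (f * g) = pscale c f * g"
    by (simp add: mult_map_scale_conv_mult mult.assoc)
  have "f * Poly_Mapping.single 0 c = Poly_Mapping.single 0 c * f" for f :: "'k \<Rightarrow>\<^sub>0 complex"
  proof (induction f rule: poly_mapping_add_induct)
    case (add k v f)
    then show ?case by (simp add: distrib_left distrib_right mult_single mult.commute)
  qed simp
  then show "f * pscale c g = pscale c (f * g)"
    by (metis mult_map_scale_conv_mult mult.assoc)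
qed

interpretation pscale: complex_space pscale
  by unfold_locales (auto intro!: poly_mapping_eqI simp: lookup_add algebra_simps)

text \<open>The action of the free algebra in which the letter x acts by \<open>\<rho> x\<close>.
  The first letter of a word acts last, so concatenation becomes composition.\<close>

definition ev :: "(complex \<Rightarrow> 'y::ab_group_add \<Rightarrow> 'y) \<Rightarrow> ('x \<Rightarrow> 'y \<Rightarrow> 'y) \<Rightarrow> ('x list \<Rightarrow>\<^sub>0 complex) \<Rightarrow> 'y \<Rightarrow> 'y" where
  "ev s \<rho> f w = (\<Sum>k\<in>Poly_Mapping.keys f. s (Poly_Mapping.lookup f k) (foldr \<rho> k w))"

lemma keys_pscale: "Poly_Mapping.keys (pscale c f) \<subseteq> Poly_Mapping.keys f"
  by (auto simp: in_keys_iff)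

lemma free_alg_simps [simp]:
  "carrier (free_alg P) = {f. Poly_Mapping.keys f \<subseteq> lists P}"
  "f \<otimes>\<^bsub>free_alg P\<^esub> g = f * g" "\<one>\<^bsub>free_alg P\<^esub> = 1"
  "f \<oplus>\<^bsub>free_alg P\<^esub> g = f + g" "\<zero>\<^bsub>free_alg P\<^esub> = 0"
  "c \<odot>\<^bsub>free_alg P\<^esub> f = pscale c f"
  by (simp_all add: free_alg_def)

lemma free_alg_closed:
  assumes "Poly_Mapping.keys f \<subseteq> lists P" "Poly_Mapping.keys g \<subseteq> lists P"
  shows "Poly_Mapping.keys (f + g) \<subseteq> lists P" "Poly_Mapping.keys (f - g) \<subseteq> lists P"
    "Poly_Mapping.keys (- f) \<subseteq> lists P" "Poly_Mapping.keys (f * g) \<subseteq> lists P"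
    "Poly_Mapping.keys (pscale c f) \<subseteq> lists P"
    "Poly_Mapping.keys (1 :: 'x list \<Rightarrow>\<^sub>0 complex) \<subseteq> lists P"
proof -
  show "Poly_Mapping.keys (f + g) \<subseteq> lists P"
    using assms Poly_Mapping.keys_add[of f g] by blast
  show "Poly_Mapping.keys (f - g) \<subseteq> lists P"
    using assms keys_diff[of f g] by blast
  show "Poly_Mapping.keys (- f) \<subseteq> lists P"
    using assms by simp
  have *: "a + b \<in> lists P" if "a \<in> Poly_Mapping.keys f" "b \<in> Poly_Mapping.keys g" for a b
    using subsetD[OF assms(1) that(1)] subsetD[OF assms(2) that(2)] by (simp add: plus_list_def)
  show "Poly_Mapping.keys (f * g) \<subseteq> lists P"
  proof
    fix k assume "k \<in> Poly_Mapping.keys (f * g)"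
    from subsetD[OF keys_mult this] obtain a b
      where "k = a + b" "a \<in> Poly_Mapping.keys f" "b \<in> Poly_Mapping.keys g"
      by (elim CollectE exE conjE)
    then show "k \<in> lists P" using *[of a b] by simp
  qed
  show "Poly_Mapping.keys (pscale c f) \<subseteq> lists P"
    using keys_pscale[of c f] assms(1) by (rule subset_trans)
qed (simp add: zero_list_def)

lemma free_alg_abelian_group: "abelian_group (free_alg P)"
proof (rule abelian_groupI)
  show "\<exists>y\<in>carrier (free_alg P). y \<oplus>\<^bsub>free_alg P\<^esub> x = \<zero>\<^bsub>free_alg P\<^esub>"
    if "x \<in> carrier (free_alg P)" for x
    using that by (intro bexI[of _ "- x"]) auto
qed (simp_all add: free_alg_closed(1) add.assoc add.commute)

lemma free_alg_module: "module CC (free_alg P)"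
  by (rule module_CC_I[OF free_alg_abelian_group])
     (auto simp: free_alg_closed pscale.scale_left_distrib pscale.scale_right_distrib)

lemma free_alg_ring: "ring (free_alg P)"
proof (rule ringI[OF free_alg_abelian_group])
  show "Group.monoid (free_alg P)"
    by (rule monoidI) (simp_all add: free_alg_closed(4) zero_list_def mult.assoc)
qed (simp_all add: distrib_left distrib_right)

context complex_space begin

lemma ev_superset: "finite A \<Longrightarrow> Poly_Mapping.keys f \<subseteq> A \<Longrightarrow>
   ev scale \<rho> f w = (\<Sum>k\<in>A. Poly_Mapping.lookup f k *s foldr \<rho> k w)"
  unfolding ev_def by (intro sum.mono_neutral_left) (auto simp: in_keys_iff)

lemma ev_add: "ev scale \<rho> (f + g) w = ev scale \<rho> f w + ev scale \<rho> g w"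
proof -
  define A where "A = Poly_Mapping.keys f \<union> Poly_Mapping.keys g"
  have "ev scale \<rho> h w = (\<Sum>k\<in>A. Poly_Mapping.lookup h k *s foldr \<rho> k w)" if "h \<in> {f, g, f + g}" for h
    using that Poly_Mapping.keys_add[of f g] by (intro ev_superset) (auto simp: A_def)
  then show ?thesis
    by (simp add: lookup_add scale_left_distrib sum.distrib)
qed

lemma ev_scale: "ev scale \<rho> (pscale c f) w = c *s ev scale \<rho> f w"
proof -
  have "ev scale \<rho> (pscale c f) w = (\<Sum>k\<in>Poly_Mapping.keys f. Poly_Mapping.lookup (pscale c f) k *s foldr \<rho> k w)"
    by (intro ev_superset) (auto simp: in_keys_iff)
  then show ?thesis
    by (simp add: ev_def scale_sum_right)
qed

lemma lin_ev: "lin_map pscale scale (\<lambda>f. ev scale \<rho> f w)"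
  by (simp add: lin_map_def ev_add ev_scale)

lemma ev_single [simp]: "ev scale \<rho> (Poly_Mapping.single k c) w = c *s foldr \<rho> k w"
  by (subst ev_superset[of "{k}"]) auto

lemma lin_foldr: "(\<And>x. lin (\<rho> x)) \<Longrightarrow> lin (foldr \<rho> k)"
  by (induction k) (auto simp: lin_map_def)

lemma ev_lin:
  assumes "\<And>x. lin (\<rho> x)"
  shows "lin (ev scale \<rho> f)"
  unfolding lin_map_def ev_def
  by (simp add: lin_map_simps[OF lin_foldr[OF assms]] scale_right_distrib sum.distrib scale_sum_right mult.commute)

lemma ev_mult:
  assumes "\<And>x. lin (\<rho> x)"
  shows "ev scale \<rho> (f * g) w = ev scale \<rho> f (ev scale \<rho> g w)"
proof (induction f rule: poly_mapping_add_induct)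
  case (add k c f)
  have "ev scale \<rho> (Poly_Mapping.single k c * g) w = c *s foldr \<rho> k (ev scale \<rho> g w)"
  proof (induction g rule: poly_mapping_add_induct)
    case (add l d g)
    then show ?case
      by (simp add: distrib_left ev_add mult_single plus_list_def scale_right_distrib
         lin_map_simps[OF lin_foldr[OF assms]])
  qed (simp add: ev_def lin_map_simps[OF lin_foldr[OF assms]])
  then show ?case by (simp add: distrib_right ev_add add)
qed (simp add: ev_def)

end

section \<open>Induced modules of Lie algebras\<close>

declare free_alg_simps(1) [simp del]

text \<open>With linear retractions \<open>c\<close> onto \<open>C\<close> and \<open>k\<close> onto
  \<open>K\<close>, the map c - k c projects onto a complement of \<open>K\<close> inside
  \<open>C\<close>. Extending it to the whole space, beyond \<open>C\<close>, keeps it a total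
  linear map.\<close>

lemma (in complex_space) complement_projection:
  assumes "subspace K" "subspace C" "K \<subseteq> C"
  obtains p where "lin p" "\<And>x. p (p x) = p x" "\<And>x. p x \<in> C" "\<And>x. x \<in> C \<Longrightarrow> x - p x \<in> K"
    "\<And>x. x \<in> K \<Longrightarrow> p x = 0"
proof -
  interpret vp: vector_space_pair scale scale by unfold_locales
  have "\<exists>r. lin r \<and> (\<forall>x. r x \<in> S) \<and> (\<forall>x\<in>S. r x = x)" if "subspace S" for S
  proof -
    have "Vector_Spaces.linear scale scale (\<lambda>x. x)"
      by (rule linear_ident)
    from vp.linear_exists_left_inverse_on[OF this that] obtain r
      where r: "range r \<subseteq> S" "Vector_Spaces.linear scale scale r" "\<forall>v\<in>S. r v = v" by auto
    interpret r: Vector_Spaces.linear scale scale r by fact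
    have "lin r" by (simp add: lin_map_def r.add r.scale)
    then show ?thesis using r by auto
  qed
  from this[OF assms(1)] this[OF assms(2)] obtain k c where
    k: "lin k" "\<And>x. k x \<in> K" "\<And>x. x \<in> K \<Longrightarrow> k x = x" and
    c: "lin c" "\<And>x. c x \<in> C" "\<And>x. x \<in> C \<Longrightarrow> c x = x" by metis
  define p where "p x = c x - k (c x)" for x
  have pC: "p x \<in> C" for x
    unfolding p_def using c(2) k(2) assms(2,3) by (intro subspace_diff) auto
  have "k (p x) = 0" for x
    by (simp add: p_def lin_map_simps[OF k(1)] k(2,3))
  then have "p (p x) = p x" for x
    using c(3)[OF pC[of x]] by (simp add: p_def)
  moreover have "lin p"
    by (simp add: lin_map_def p_def lin_map_simps[OF k(1)] lin_map_simps[OF c(1)] scale_right_diff_distrib)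
  moreover have "x - p x \<in> K" if "x \<in> C" for x
    using that c(3) k(2) by (simp add: p_def)
  moreover have "p x = 0" if "x \<in> K" for x
    using that c(3) k(3) assms(3) by (auto simp: p_def)
  ultimately show ?thesis using that pC by blast
qed

lemma poly_mapping_sum_single:
  "f = (\<Sum>k\<in>Poly_Mapping.keys f. pscale (Poly_Mapping.lookup f k) (Poly_Mapping.single k 1))"
  by (rule poly_mapping_eqI) (simp add: lookup_sum lookup_single when_def in_keys_iff)

locale induced =
  fixes L :: "(complex, 'x) module" and H :: "'x set"
  assumes L_add: "x \<in> carrier L \<Longrightarrow> y \<in> carrier L \<Longrightarrow> x \<oplus>\<^bsub>L\<^esub> y \<in> carrier L"
    and L_smult: "x \<in> carrier L \<Longrightarrow> c \<odot>\<^bsub>L\<^esub> x \<in> carrier L"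
    and L_mult: "x \<in> carrier L \<Longrightarrow> y \<in> carrier L \<Longrightarrow> x \<otimes>\<^bsub>L\<^esub> y \<in> carrier L"
    and H_sub: "H \<subseteq> carrier L"
begin

abbreviation "A \<equiv> free_alg (carrier L)"
abbreviation "J \<equiv> env_ideal L"
abbreviation "U \<equiv> env_alg L"
abbreviation "N \<equiv> ind_ideal L H"
abbreviation "V \<equiv> ind_module L H"

sublocale A: ring A
  by (rule free_alg_ring)

definition fc :: "('x list \<Rightarrow>\<^sub>0 complex) set" where
  "fc = {f. Poly_Mapping.keys f \<subseteq> lists (carrier L)}"

lemma carrier_A [simp]: "carrier A = fc"
  by (simp add: fc_def free_alg_simps)

lemma fc_closed [simp, intro]:
  "f \<in> fc \<Longrightarrow> g \<in> fc \<Longrightarrow> f + g \<in> fc" "f \<in> fc \<Longrightarrow> g \<in> fc \<Longrightarrow> f - g \<in> fc"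
  "f \<in> fc \<Longrightarrow> - f \<in> fc" "f \<in> fc \<Longrightarrow> g \<in> fc \<Longrightarrow> f * g \<in> fc"
  "f \<in> fc \<Longrightarrow> pscale c f \<in> fc" "1 \<in> fc" "0 \<in> fc"
  using free_alg_closed[of f "carrier L" g] free_alg_closed[of f "carrier L" f]
    free_alg_closed(6)[of 0 "carrier L" 0] by (simp_all add: fc_def)

lemma single_fc [simp, intro]: "set k \<subseteq> carrier L \<Longrightarrow> Poly_Mapping.single k c \<in> fc"
  by (auto simp: fc_def)

lemma H_carrier [simp]: "x \<in> H \<Longrightarrow> x \<in> carrier L"
  using H_sub by blast

lemma env_relations_closed: "env_relations L \<subseteq> carrier A"
  by (auto simp: env_relations_def L_add L_smult L_mult)

lemma J_ideal: "ideal J A"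
  unfolding env_ideal_def by (rule A.genideal_ideal[OF env_relations_closed])

sublocale J: ideal J A by (rule J_ideal)

lemma J_submodule: "submodule J CC A"
proof -
  interpret cmodule A by (simp add: cmodule_def free_alg_module)
  show ?thesis
  proof (rule subspaceI)
    show "c \<odot>\<^bsub>A\<^esub> x \<in> J" if "x \<in> J" for c x
    proof -
      have "Poly_Mapping.single 0 c \<otimes>\<^bsub>A\<^esub> x \<in> J"
        using that by (intro J.I_l_closed) (auto simp: zero_list_def)
      then show ?thesis by (simp add: mult_map_scale_conv_mult)
    qed
  qed (use J.a_subset J.zero_closed J.a_closed in auto)
qed

sublocale AQ: cquot A J
  by (simp add: cquot_def cquot_axioms_def cmodule_def free_alg_module J_submodule)

definition ucl :: "('x list \<Rightarrow>\<^sub>0 complex) \<Rightarrow> ('x list \<Rightarrow>\<^sub>0 complex) set" where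
  "ucl f = J +>\<^bsub>A\<^esub> f"

lemma minus_A: "f \<in> fc \<Longrightarrow> \<ominus>\<^bsub>A\<^esub> f = - f"
  by (rule A.minus_equality) (auto simp:)

lemma diff_A: "f \<in> fc \<Longrightarrow> g \<in> fc \<Longrightarrow> f \<ominus>\<^bsub>A\<^esub> g = f - g"
  by (simp add: a_minus_def minus_A)

lemma u_simps0:
  assumes "f \<in> fc" "g \<in> fc"
  shows "ucl f \<in> carrier U" "ucl f \<oplus>\<^bsub>U\<^esub> ucl g = ucl (f + g)" "c \<odot>\<^bsub>U\<^esub> ucl f = ucl (pscale c f)"
    "ucl f \<otimes>\<^bsub>U\<^esub> ucl g = ucl (f * g)" "ucl f = ucl g \<longleftrightarrow> f - g \<in> J"
proof -
  show "ucl f \<in> carrier U" "ucl f \<oplus>\<^bsub>U\<^esub> ucl g = ucl (f + g)" "c \<odot>\<^bsub>U\<^esub> ucl f = ucl (pscale c f)"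
    using assms AQ.add_Q[of f g] AQ.smult_Q[of f c] AQ.coset_in_Q[of f] by (simp_all add: ucl_def env_alg_def)
  show "ucl f = ucl g \<longleftrightarrow> f - g \<in> J"
    using assms AQ.coset_eq_iff[of f g] diff_A by (simp add: ucl_def)
  have "ucl f \<otimes>\<^bsub>U\<^esub> ucl g = J +>\<^bsub>A\<^esub> (f \<otimes>\<^bsub>A\<^esub> g)"
    unfolding ucl_def env_alg_def
    by (rule AQ.mult_Q) (use assms J.I_l_closed J.I_r_closed in \<open>simp_all add: distrib_left distrib_right\<close>)
  then show "ucl f \<otimes>\<^bsub>U\<^esub> ucl g = ucl (f * g)" by (simp add: ucl_def)
qed

lemma u_simps:
  "f \<in> fc \<Longrightarrow> ucl f \<in> carrier U"
  "f \<in> fc \<Longrightarrow> g \<in> fc \<Longrightarrow> ucl f \<oplus>\<^bsub>U\<^esub> ucl g = ucl (f + g)"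
  "f \<in> fc \<Longrightarrow> c \<odot>\<^bsub>U\<^esub> ucl f = ucl (pscale c f)"
  "f \<in> fc \<Longrightarrow> g \<in> fc \<Longrightarrow> ucl f \<otimes>\<^bsub>U\<^esub> ucl g = ucl (f * g)"
  "f \<in> fc \<Longrightarrow> g \<in> fc \<Longrightarrow> ucl f = ucl g \<longleftrightarrow> f - g \<in> J"
  by (rule u_simps0, assumption+)+

lemma U_cases: assumes "z \<in> carrier U" obtains f where "f \<in> fc" "z = ucl f"
  using assms AQ.carrier_Q by (auto simp: ucl_def env_alg_def)

lemma zero_U: "\<zero>\<^bsub>U\<^esub> = ucl 0" and one_U: "\<one>\<^bsub>U\<^esub> = ucl 1"
  using AQ.zero_Q' by (simp_all add: ucl_def env_alg_def quotient_alg_def)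

lemma env_gen_u: "env_gen L x = ucl (gen x)"
  by (simp add: env_gen_def ucl_def)

sublocale U: cmodule U
  using AQ.module_Q by (simp add: cmodule_def env_alg_def)

lemma N_gens_closed: "{z \<otimes>\<^bsub>U\<^esub> env_gen L x | z x. z \<in> carrier U \<and> x \<in> H} \<subseteq> carrier U"
proof clarify
  fix z x assume "z \<in> carrier U" "x \<in> H"
  then show "z \<otimes>\<^bsub>U\<^esub> env_gen L x \<in> carrier U"
    using H_sub by (auto elim!: U_cases simp: env_gen_u u_simps )
qed

lemma N_submodule: "submodule N CC U"
  unfolding ind_ideal_def by (rule U.lin_span_submodule[OF N_gens_closed])

sublocale UQ: cquot U N
  by (simp add: cquot_def cquot_axioms_def U.cmodule_axioms N_submodule)

text \<open>The preimage in the free algebra of the left ideal \<open>N\<close>. Together with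
  \<open>q\<close> it collapses the two layers of cosets: the induced module is \<open>fc\<close>
  modulo \<open>K\<close>.\<close>

definition K where "K = {f \<in> fc. ucl f \<in> N}"
definition q where "q f = N +>\<^bsub>U\<^esub> ucl f"

lemma J_K: "f \<in> J \<Longrightarrow> f \<in> K"
proof -
  assume f: "f \<in> J"
  then have "f \<in> fc" using J.a_subset by auto
  then have "ucl f = ucl 0" using f by (subst u_simps) auto
  then show "f \<in> K" using \<open>f \<in> fc\<close> UQ.I_subD(2) by (simp add: K_def zero_U)
qed

lemma N_left:
  assumes "z \<in> carrier U" "y \<in> N"
  shows "z \<otimes>\<^bsub>U\<^esub> y \<in> N"
proof -
  have "y \<in> {y \<in> carrier U. z \<otimes>\<^bsub>U\<^esub> y \<in> N}"
  proof (rule subsetD[OF U.lin_span_minimal assms(2)[unfolded ind_ideal_def]])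
    obtain f where f: "f \<in> fc" "z = ucl f" using assms(1) by (rule U_cases)
    show "submodule {y \<in> carrier U. z \<otimes>\<^bsub>U\<^esub> y \<in> N} CC U"
    proof (rule U.subspaceI)
      show "\<zero>\<^bsub>U\<^esub> \<in> {y \<in> carrier U. z \<otimes>\<^bsub>U\<^esub> y \<in> N}"
        using f UQ.I_subD(2) by (simp add: zero_U u_simps)
      fix c x y assume xy: "x \<in> {y \<in> carrier U. z \<otimes>\<^bsub>U\<^esub> y \<in> N}" "y \<in> {y \<in> carrier U. z \<otimes>\<^bsub>U\<^esub> y \<in> N}"
      then obtain g h where gh: "g \<in> fc" "x = ucl g" "h \<in> fc" "y = ucl h" by (auto elim!: U_cases)
      then have "z \<otimes>\<^bsub>U\<^esub> (x \<oplus>\<^bsub>U\<^esub> y) = (z \<otimes>\<^bsub>U\<^esub> x) \<oplus>\<^bsub>U\<^esub> (z \<otimes>\<^bsub>U\<^esub> y)"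
        using f by (simp add: u_simps distrib_left)
      then show "x \<oplus>\<^bsub>U\<^esub> y \<in> {y \<in> carrier U. z \<otimes>\<^bsub>U\<^esub> y \<in> N}"
        using xy UQ.I_subD(3) by simp
    next
      fix c x assume x: "x \<in> {y \<in> carrier U. z \<otimes>\<^bsub>U\<^esub> y \<in> N}"
      then obtain g where g: "g \<in> fc" "x = ucl g" by (auto elim!: U_cases)
      then have "z \<otimes>\<^bsub>U\<^esub> (c \<odot>\<^bsub>U\<^esub> x) = c \<odot>\<^bsub>U\<^esub> (z \<otimes>\<^bsub>U\<^esub> x)"
        using f by (simp add: u_simps pscale_mult)
      then show "c \<odot>\<^bsub>U\<^esub> x \<in> {y \<in> carrier U. z \<otimes>\<^bsub>U\<^esub> y \<in> N}"
        using x UQ.I_subD(4) by (simp add: U.smult_closed)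
    qed auto
    show "{z \<otimes>\<^bsub>U\<^esub> env_gen L x | z x. z \<in> carrier U \<and> x \<in> H} \<subseteq> {y \<in> carrier U. z \<otimes>\<^bsub>U\<^esub> y \<in> N}"
    proof
      fix y assume y: "y \<in> {z \<otimes>\<^bsub>U\<^esub> env_gen L x | z x. z \<in> carrier U \<and> x \<in> H}"
      then obtain g x where g: "g \<in> fc" "x \<in> H" "y = ucl g \<otimes>\<^bsub>U\<^esub> env_gen L x" by (auto elim!: U_cases)
      then have "z \<otimes>\<^bsub>U\<^esub> y = ucl (f * g) \<otimes>\<^bsub>U\<^esub> env_gen L x"
        using f H_sub by (simp add: env_gen_u u_simps mult.assoc)
      also have "\<dots> \<in> N"
        unfolding ind_ideal_def using f g by (intro subsetD[OF U.lin_span_base]) (auto intro!: u_simps)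
      finally show "y \<in> {y \<in> carrier U. z \<otimes>\<^bsub>U\<^esub> y \<in> N}"
        using y N_gens_closed by auto
    qed
  qed
  then show ?thesis by simp
qed

lemma K_fc: "f \<in> K \<Longrightarrow> f \<in> fc"
  by (simp add: K_def)

lemma K_add: "f \<in> K \<Longrightarrow> g \<in> K \<Longrightarrow> f + g \<in> K"
  using UQ.I_subD(3)[of "ucl f" "ucl g"] by (simp add: K_def u_simps)

lemma K_scale: "f \<in> K \<Longrightarrow> pscale c f \<in> K"
  using UQ.I_subD(4)[of "ucl f" c] by (simp add: K_def u_simps)

lemma K_left: "f \<in> fc \<Longrightarrow> g \<in> K \<Longrightarrow> f * g \<in> K"
  using N_left[of "ucl f" "ucl g"] by (simp add: K_def u_simps)

lemma K_gen:
  assumes "f \<in> fc" "x \<in> H"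
  shows "f * gen x \<in> K"
proof -
  have "ucl f \<otimes>\<^bsub>U\<^esub> env_gen L x \<in> N"
    unfolding ind_ideal_def using assms by (intro subsetD[OF U.lin_span_base]) (auto intro!: u_simps)
  then show ?thesis
    using assms H_sub by (auto simp: K_def env_gen_u u_simps)
qed

lemma subspace_K: "pscale.subspace K" and subspace_fc: "pscale.subspace fc"
  using J_K[of 0] J.zero_closed by (auto simp: pscale.subspace_def K_add K_scale)

lemma q_simps0:
  assumes "f \<in> fc" "g \<in> fc"
  shows "q f \<in> carrier V" "q f \<oplus>\<^bsub>V\<^esub> q g = q (f + g)" "c \<odot>\<^bsub>V\<^esub> q f = q (pscale c f)"
    "q f = q g \<longleftrightarrow> f - g \<in> K" "ind_act L H (ucl f) (q g) = q (f * g)"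
proof -
  show "q f \<in> carrier V" "q f \<oplus>\<^bsub>V\<^esub> q g = q (f + g)" "c \<odot>\<^bsub>V\<^esub> q f = q (pscale c f)"
    using assms UQ.add_Q[of "ucl f" "ucl g"] UQ.smult_Q[of "ucl f" c] UQ.coset_in_Q[of "ucl f"]
    by (simp_all add: q_def ind_module_def u_simps)
  have "ucl f \<ominus>\<^bsub>U\<^esub> ucl g = ucl f \<oplus>\<^bsub>U\<^esub> (-1) \<odot>\<^bsub>U\<^esub> ucl g"
    using assms U.minus_smult[of "ucl g"] by (simp add: a_minus_def u_simps)
  also have "\<dots> = ucl (f - g)"
    using assms pscale.scale_minus_left[of 1 g] by (simp add: u_simps)
  finally show "q f = q g \<longleftrightarrow> f - g \<in> K"
    using assms UQ.coset_eq_iff[of "ucl f" "ucl g"] by (simp add: q_def K_def u_simps)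
  have "ind_act L H (ucl f) (q g) = N +>\<^bsub>U\<^esub> (ucl f \<otimes>\<^bsub>U\<^esub> ucl g)"
    unfolding ind_act_def q_def
  proof (rule UQ.union_map)
    show "ucl g \<in> carrier U" using assms by (simp add: u_simps)
    show "(\<otimes>\<^bsub>U\<^esub>) (ucl f) \<in> carrier U \<rightarrow> carrier U"
      using assms by (auto elim!: U_cases simp: u_simps)
    show "ucl f \<otimes>\<^bsub>U\<^esub> (x \<oplus>\<^bsub>U\<^esub> y) = (ucl f \<otimes>\<^bsub>U\<^esub> x) \<oplus>\<^bsub>U\<^esub> (ucl f \<otimes>\<^bsub>U\<^esub> y)"
      if "x \<in> carrier U" "y \<in> carrier U" for x y
      using assms that by (auto elim!: U_cases simp: u_simps distrib_left)
    show "ucl f \<otimes>\<^bsub>U\<^esub> x \<in> N" if "x \<in> N" for x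
      using assms that by (intro N_left) (simp add: u_simps)
  qed
  then show "ind_act L H (ucl f) (q g) = q (f * g)"
    using assms by (simp add: u_simps q_def)
qed

lemma q_simps:
  "f \<in> fc \<Longrightarrow> q f \<in> carrier V"
  "f \<in> fc \<Longrightarrow> g \<in> fc \<Longrightarrow> q f \<oplus>\<^bsub>V\<^esub> q g = q (f + g)"
  "f \<in> fc \<Longrightarrow> c \<odot>\<^bsub>V\<^esub> q f = q (pscale c f)"
  "f \<in> fc \<Longrightarrow> g \<in> fc \<Longrightarrow> q f = q g \<longleftrightarrow> f - g \<in> K"
  "f \<in> fc \<Longrightarrow> g \<in> fc \<Longrightarrow> ind_act L H (ucl f) (q g) = q (f * g)"
  by (rule q_simps0, assumption+)+

lemma V_cases: assumes "z \<in> carrier V" obtains f where "f \<in> fc" "z = q f"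
  using assms UQ.carrier_Q by (auto simp: q_def ind_module_def elim!: U_cases)

lemma ind_one_q: "ind_one L H = q 1"
  by (simp add: ind_one_def one_U q_def)

lemma module_V: "module CC V"
  using UQ.module_Q by (simp add: ind_module_def)

lemma zero_V: "\<zero>\<^bsub>V\<^esub> = q 0"
  using UQ.zero_Q' by (simp add: ind_module_def q_def zero_U)

text \<open>The elements that act as zero on every vector form a two-sided ideal containing the
  enveloping relations, hence \<open>J\<close>. Elements of \<open>N\<close> are only killed at
  \<open>w0\<close>, and only up to the choice of a representative: an element of \<open>K\<close>
  differs by something in \<open>J\<close> from one that vanishes at \<open>w0\<close>.\<close>

lemma ev_K_zero:
  assumes s: "complex_space s" and lin: "\<And>x. lin_map s s (\<rho> x)"
    and add: "\<And>x y w. x \<in> carrier L \<Longrightarrow> y \<in> carrier L \<Longrightarrow> \<rho> (x \<oplus>\<^bsub>L\<^esub> y) w = \<rho> x w + \<rho> y w"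
    and smult: "\<And>c x w. x \<in> carrier L \<Longrightarrow> \<rho> (c \<odot>\<^bsub>L\<^esub> x) w = s c (\<rho> x w)"
    and mult: "\<And>x y w. x \<in> carrier L \<Longrightarrow> y \<in> carrier L \<Longrightarrow>
        \<rho> (x \<otimes>\<^bsub>L\<^esub> y) w = \<rho> x (\<rho> y w) - \<rho> y (\<rho> x w)"
    and H: "\<And>x. x \<in> H \<Longrightarrow> \<rho> x w0 = 0"
    and "f \<in> K"
  shows "ev s \<rho> f w0 = 0"
proof -
  interpret s: complex_space s by fact
  note ev_simps = s.ev_add s.ev_scale s.ev_mult[of \<rho>, OF lin] lin_map_simps[OF s.lin_ev]
    lin_map_simps[OF s.ev_lin[of \<rho>, OF lin]]
  have "ideal {f \<in> fc. \<forall>w. ev s \<rho> f w = 0} A"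
  proof (rule idealI)
    show "subgroup {f \<in> fc. \<forall>w. ev s \<rho> f w = 0} (add_monoid A)"
    proof (rule A.add.subgroupI)
      fix a assume a: "a \<in> {f \<in> fc. \<forall>w. ev s \<rho> f w = 0}"
      then have "\<ominus>\<^bsub>A\<^esub> a = - a" using minus_A[of a] by simp
      then show "\<ominus>\<^bsub>A\<^esub> a \<in> {f \<in> fc. \<forall>w. ev s \<rho> f w = 0}"
        using a by (simp add: ev_simps)
    next
      show "{f \<in> fc. \<forall>w. ev s \<rho> f w = 0} \<noteq> {}"
        by (auto intro!: exI[of _ 0] simp: ev_simps)
    qed (auto simp: ev_simps)
  qed (simp_all add: A.ring_axioms ev_simps)
  moreover have "env_relations L \<subseteq> {f \<in> fc. \<forall>w. ev s \<rho> f w = 0}"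
    by (auto simp: env_relations_def ev_simps add smult mult L_add L_smult L_mult)
  ultimately have J: "J \<subseteq> {f \<in> fc. \<forall>w. ev s \<rho> f w = 0}"
    unfolding env_ideal_def by (rule A.genideal_minimal)
  have "N \<subseteq> ucl ` {f \<in> fc. ev s \<rho> f w0 = 0}"
    unfolding ind_ideal_def
  proof (rule U.lin_span_minimal)
    show "submodule (ucl ` {f \<in> fc. ev s \<rho> f w0 = 0}) CC U"
      by (rule U.subspaceI) (auto simp: u_simps zero_U ev_simps intro!: imageI)
    show "{z \<otimes>\<^bsub>U\<^esub> env_gen L x | z x. z \<in> carrier U \<and> x \<in> H} \<subseteq> ucl ` {f \<in> fc. ev s \<rho> f w0 = 0}"
    proof clarify
      fix z x assume "z \<in> carrier U" "x \<in> H"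
      moreover then obtain f where "f \<in> fc" "z = ucl f" by (auto elim: U_cases)
      ultimately have "z \<otimes>\<^bsub>U\<^esub> env_gen L x = ucl (f * gen x)" "f * gen x \<in> fc" "ev s \<rho> (f * gen x) w0 = 0"
        using H_sub by (simp_all add: env_gen_u u_simps ev_simps H)
      then show "z \<otimes>\<^bsub>U\<^esub> env_gen L x \<in> ucl ` {f \<in> fc. ev s \<rho> f w0 = 0}" by blast
    qed
  qed
  then obtain g where g: "g \<in> fc" "ev s \<rho> g w0 = 0" "ucl f = ucl g"
    using \<open>f \<in> K\<close> by (auto simp: K_def)
  have "f - g \<in> J"
    using g K_fc[OF \<open>f \<in> K\<close>] u_simps(5)[of f g] by simp
  then have "ev s \<rho> (f - g) w0 = 0" using J by blast
  then show ?thesis using g by (simp add: ev_simps)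
qed

text \<open>The induced module is modelled on the range of a linear projection of the free algebra that has
  the relations in its kernel, so that its elements live in a type with a total addition.\<close>

definition p :: "('x list \<Rightarrow>\<^sub>0 complex) \<Rightarrow> ('x list \<Rightarrow>\<^sub>0 complex)" where
  "p = (SOME p. lin_map pscale pscale p \<and> (\<forall>x. p (p x) = p x) \<and> (\<forall>x. p x \<in> fc) \<and>
     (\<forall>x\<in>fc. x - p x \<in> K) \<and> (\<forall>x\<in>K. p x = 0))"

lemma p_lin: "lin_map pscale pscale p" and p_p [simp]: "p (p f) = p f" and p_fc [simp]: "p f \<in> fc"
  and p_diff: "f \<in> fc \<Longrightarrow> f - p f \<in> K" and p_K: "f \<in> K \<Longrightarrow> p f = 0"
proof -
  have "K \<subseteq> fc" using K_fc by blast
  have "\<exists>p. lin_map pscale pscale p \<and> (\<forall>x. p (p x) = p x) \<and> (\<forall>x. p x \<in> fc) \<and>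
     (\<forall>x\<in>fc. x - p x \<in> K) \<and> (\<forall>x\<in>K. p x = 0)"
    by (rule pscale.complement_projection[OF subspace_K subspace_fc \<open>K \<subseteq> fc\<close>], rule exI, intro conjI ballI allI)
  from someI_ex[OF this, folded p_def]
  show "lin_map pscale pscale p" "p (p f) = p f" "p f \<in> fc" "f \<in> fc \<Longrightarrow> f - p f \<in> K" "f \<in> K \<Longrightarrow> p f = 0"
    by auto
qed

lemmas p_simps = lin_map_simps[OF p_lin]

definition vac :: "'x list \<Rightarrow>\<^sub>0 complex" where "vac = p 1"

text \<open>The action of x on the model. The inner \<open>p\<close> makes it factor through
  \<open>p\<close> on the whole type, as \<open>field_family\<close> requires of its
  generators.\<close>

definition op :: "'x \<Rightarrow> ('x list \<Rightarrow>\<^sub>0 complex) \<Rightarrow> ('x list \<Rightarrow>\<^sub>0 complex)" where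
  "op x f = p (gen x * p f)"

lemma p_vac [simp]: "p vac = vac"
  by (simp add: vac_def)

lemma p_cong: "f - g \<in> K \<Longrightarrow> p f = p g"
  using p_K[of "f - g"] by (simp add: p_simps)

lemma p_mult: "f \<in> fc \<Longrightarrow> g \<in> fc \<Longrightarrow> p (f * p g) = p (f * g)"
  using K_left[OF _ p_diff, of f g] by (intro sym[OF p_cong]) (simp add: right_diff_distrib)

lemma op_lin: "lin_map pscale pscale (op x)"
  by (simp add: lin_map_def op_def p_simps distrib_left pscale_mult(2))

lemma op_p [simp]: "op x (p f) = op x f" and p_op [simp]: "p (op x f) = op x f"
  by (simp_all add: op_def)

lemma op_eq: "x \<in> carrier L \<Longrightarrow> f \<in> fc \<Longrightarrow> op x f = p (gen x * f)"
  by (simp add: op_def p_mult)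

lemma rel_p:
  assumes "r \<in> env_relations L"
  shows "p (r * p f) = 0"
proof -
  have "r \<in> J" unfolding env_ideal_def
    using A.genideal_self[OF env_relations_closed] assms by blast
  then have "r * p f \<in> J" using J.I_r_closed[of r "p f"] by simp
  then show ?thesis by (intro p_K J_K)
qed

lemma op_add: "x \<in> carrier L \<Longrightarrow> y \<in> carrier L \<Longrightarrow> op (x \<oplus>\<^bsub>L\<^esub> y) f = op x f + op y f"
proof -
  assume "x \<in> carrier L" "y \<in> carrier L"
  then have "p ((gen (x \<oplus>\<^bsub>L\<^esub> y) - gen x - gen y) * p f) = 0"
    by (intro rel_p) (unfold env_relations_def, blast)
  then show ?thesis
    by (simp add: op_def left_diff_distrib p_simps diff_eq_eq add.commute)
qed

lemma op_smult: "x \<in> carrier L \<Longrightarrow> op (c \<odot>\<^bsub>L\<^esub> x) f = pscale c (op x f)"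
proof -
  assume "x \<in> carrier L"
  then have "p (gen (c \<odot>\<^bsub>L\<^esub> x) * p f) = p (Poly_Mapping.single [x] c * p f)"
    using rel_p[of "gen (c \<odot>\<^bsub>L\<^esub> x) - Poly_Mapping.single [x] c" f]
    unfolding env_relations_def by (fastforce simp: left_diff_distrib p_simps)
  moreover have "Poly_Mapping.single [x] c * p f = pscale c (gen x * p f)"
    unfolding pscale_mult(1) by (simp add: map_single)
  ultimately show ?thesis by (simp add: op_def p_simps)
qed

lemma op_mult:
  assumes "x \<in> carrier L" "y \<in> carrier L"
  shows "op (x \<otimes>\<^bsub>L\<^esub> y) f = op x (op y f) - op y (op x f)"
proof -
  have "op x (op y f) = p (gen x * gen y * p f)" if "x \<in> carrier L" "y \<in> carrier L" for x y
    using that by (simp add: op_def[of y] op_eq p_mult[of "gen x"] mult.assoc)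
  moreover have "p ((gen x * gen y - gen y * gen x - gen (x \<otimes>\<^bsub>L\<^esub> y)) * p f) = 0"
    using assms by (intro rel_p) (unfold env_relations_def, blast)
  ultimately show ?thesis
    using assms by (simp add: op_def[of "x \<otimes>\<^bsub>L\<^esub> y"] left_diff_distrib p_simps)
qed

lemma op_vac: "x \<in> H \<Longrightarrow> op x vac = 0"
  using K_gen[of 1 x] by (simp add: vac_def op_eq p_K)

text \<open>Induction along the words of \<open>f\<close>, starting from an arbitrary
  \<open>w\<close>. It is used with the vacuum, to induct over all of V_L, and with translates of
  relations, to induct over I_B.\<close>

lemma p_mult_closed:
  assumes "P w" "p w = w" "f \<in> fc"
    and "\<And>x y. P x \<Longrightarrow> P y \<Longrightarrow> P (x + y)" "\<And>c x. P x \<Longrightarrow> P (pscale c x)"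
    and "\<And>x h. x \<in> carrier L \<Longrightarrow> P h \<Longrightarrow> p h = h \<Longrightarrow> P (op x h)"
  shows "P (p (f * w))"
proof -
  have P0: "P 0" using assms(5)[OF assms(1), of 0] by simp
  have w: "w \<in> fc" using p_fc[of w] assms(2) by simp
  have single: "P (p (Poly_Mapping.single k 1 * w))" if "set k \<subseteq> carrier L" for k
    using that
  proof (induction k)
    case Nil
    then show ?case using assms(1,2) by (simp add: zero_list_def[symmetric])
  next
    case (Cons x k)
    have "Poly_Mapping.single (x # k) 1 = gen x * Poly_Mapping.single k (1::complex)"
      by (simp add: mult_single plus_list_def)
    then have "p (Poly_Mapping.single (x # k) 1 * w) = op x (p (Poly_Mapping.single k 1 * w))"
      using Cons.prems w by (simp add: op_eq mult.assoc)
    then show ?case using assms(6)[of x "p (Poly_Mapping.single k 1 * w)"] Cons by simp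
  qed
  have keys: "set k \<subseteq> carrier L" if "k \<in> Poly_Mapping.keys f" for k
    using that assms(3) by (auto simp: fc_def)
  have "P (\<Sum>k\<in>I. pscale (c k) (p (Poly_Mapping.single k 1 * w)))" if "\<forall>k\<in>I. set k \<subseteq> carrier L" for I c
    using that by (induction I rule: infinite_finite_induct) (auto simp: P0 assms(4,5) single)
  then have "P (p ((\<Sum>k\<in>Poly_Mapping.keys f.
      pscale (Poly_Mapping.lookup f k) (Poly_Mapping.single k 1)) * w))"
    using keys by (simp add: p_simps sum_distrib_right pscale_mult(1)[symmetric] del: map_single)
  then show ?thesis
    unfolding poly_mapping_sum_single[symmetric] .
qed

text \<open>Evaluation at \<open>w0\<close> kills \<open>K\<close>, so it is unchanged by
  \<open>p\<close> on \<open>fc\<close>; multiplication by \<open>gen x\<close> then evaluates to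
  \<open>\<rho> x\<close>.\<close>

lemma universal:
  assumes s: "complex_space s" and lin: "\<And>x. lin_map s s (\<rho> x)"
    and add: "\<And>x y w. x \<in> carrier L \<Longrightarrow> y \<in> carrier L \<Longrightarrow> \<rho> (x \<oplus>\<^bsub>L\<^esub> y) w = \<rho> x w + \<rho> y w"
    and smult: "\<And>c x w. x \<in> carrier L \<Longrightarrow> \<rho> (c \<odot>\<^bsub>L\<^esub> x) w = s c (\<rho> x w)"
    and mult: "\<And>x y w. x \<in> carrier L \<Longrightarrow> y \<in> carrier L \<Longrightarrow>
        \<rho> (x \<otimes>\<^bsub>L\<^esub> y) w = \<rho> x (\<rho> y w) - \<rho> y (\<rho> x w)"
    and H: "\<And>x. x \<in> H \<Longrightarrow> \<rho> x w0 = 0"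
  obtains \<Phi> where "lin_map pscale s \<Phi>" "\<Phi> vac = w0" "\<And>w. \<Phi> (p w) = \<Phi> w"
    "\<And>x w. x \<in> carrier L \<Longrightarrow> \<Phi> (op x w) = \<rho> x (\<Phi> w)"
proof -
  interpret s: complex_space s by fact
  have K0: "ev s \<rho> f w0 = 0" if "f \<in> K" for f
    by (rule ev_K_zero[OF s lin add smult mult H that])
  define \<Phi> where "\<Phi> f = ev s \<rho> (p f) w0" for f
  have \<Phi>: "\<Phi> f = ev s \<rho> f w0" if "f \<in> fc" for f
    using K0[OF p_diff[OF that]] by (simp add: \<Phi>_def lin_map_simps[OF s.lin_ev])
  show ?thesis
  proof
    show "lin_map pscale s \<Phi>"
      unfolding \<Phi>_def by (rule lin_map_comp[OF p_lin s.lin_ev])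
    show "\<Phi> vac = w0"
    proof -
      have "\<Phi> vac = \<Phi> 1" by (simp add: vac_def \<Phi>_def)
      also have "\<dots> = ev s \<rho> (Poly_Mapping.single [] 1) w0"
        by (subst \<Phi>) (simp_all add: zero_list_def[symmetric])
      finally show ?thesis by simp
    qed
    show "\<Phi> (p w) = \<Phi> w" for w by (simp add: \<Phi>_def)
    show "\<Phi> (op x w) = \<rho> x (\<Phi> w)" if "x \<in> carrier L" for x w
    proof -
      have "\<Phi> (op x w) = \<Phi> (gen x * p w)" by (simp add: \<Phi>_def op_def)
      also have "\<dots> = ev s \<rho> (gen x * p w) w0" using that by (intro \<Phi>) auto
      finally show ?thesis by (simp add: s.ev_mult lin \<Phi>_def)
    qed
  qed
qed

lemma q_p: "f \<in> fc \<Longrightarrow> q (p f) = q f"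
  using p_diff[of f] by (subst eq_commute) (simp add: q_simps)

text \<open>The range of \<open>p\<close> is a complement of \<open>K\<close> in \<open>fc\<close>
  and so holds exactly one representative of each coset. Through this bijection results on the model
  become results on V_L.\<close>

lemma q_bij: "bij_betw q {w. p w = w} (carrier V)"
proof (rule bij_betw_imageI)
  have fcI: "w \<in> fc" if "p w = w" for w using p_fc[of w] that by simp
  show "inj_on q {w. p w = w}"
  proof (rule inj_onI)
    fix w w' assume "w \<in> {w. p w = w}" "w' \<in> {w. p w = w}" "q w = q w'"
    then have "w - w' \<in> K" "p w = w" "p w' = w'" using fcI by (auto simp: q_simps)
    then show "w = w'" using p_cong[of w w'] by simp
  qed
  show "q ` {w. p w = w} = carrier V"
  proof
    show "q ` {w. p w = w} \<subseteq> carrier V" using fcI by (auto simp: q_simps)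
    show "carrier V \<subseteq> q ` {w. p w = w}"
    proof
      fix z assume "z \<in> carrier V"
      then obtain f where "f \<in> fc" "z = q f" by (rule V_cases)
      then have "z = q (p f)" by (simp add: q_p)
      then show "z \<in> q ` {w. p w = w}" by (rule image_eqI) simp
    qed
  qed
qed

lemma q_vac: "q vac = ind_one L H"
  by (simp add: vac_def q_p ind_one_q)

lemma q_op: "x \<in> carrier L \<Longrightarrow> p w = w \<Longrightarrow> q (op x w) = ind_act L H (env_gen L x) (q w)"
  using p_fc[of w] by (simp add: op_eq q_p env_gen_u q_simps)

end

section \<open>The Lie algebra of a vertex algebroid\<close>

text \<open>The common form of the sums over keys in \<open>hat_del\<close> and
  \<open>loop_bracket\<close>. Keys of a sum may cancel, so additivity is shown once here and then
  inherited.\<close>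

definition pm_extend :: "('k \<Rightarrow> 'x::comm_monoid_add \<Rightarrow> 'y::comm_monoid_add) \<Rightarrow> ('k \<Rightarrow>\<^sub>0 'x) \<Rightarrow> 'y" where
  "pm_extend \<phi> r = (\<Sum>k\<in>Poly_Mapping.keys r. \<phi> k (Poly_Mapping.lookup r k))"

lemma pm_extend_superset:
  assumes "\<And>k. \<phi> k 0 = 0" "finite I" "Poly_Mapping.keys r \<subseteq> I"
  shows "pm_extend \<phi> r = (\<Sum>k\<in>I. \<phi> k (Poly_Mapping.lookup r k))"
  unfolding pm_extend_def using assms by (intro sum.mono_neutral_left) (auto simp: in_keys_iff)

lemma pm_extend_add:
  assumes "\<And>k. \<phi> k 0 = 0" "\<And>k x y. \<phi> k (x + y) = \<phi> k x + \<phi> k y"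
  shows "pm_extend \<phi> (r + t) = pm_extend \<phi> r + pm_extend \<phi> t"
proof -
  define I where "I = Poly_Mapping.keys r \<union> Poly_Mapping.keys t"
  have "pm_extend \<phi> h = (\<Sum>k\<in>I. \<phi> k (Poly_Mapping.lookup h k))" if "h \<in> {r, t, r + t}" for h
    using that Poly_Mapping.keys_add[of r t] by (intro pm_extend_superset assms(1)) (auto simp: I_def)
  then show ?thesis by (simp add: lookup_add assms(2) sum.distrib)
qed

lemma pm_extend_single: "(\<And>k. \<phi> k 0 = 0) \<Longrightarrow> pm_extend \<phi> (Poly_Mapping.single k x) = \<phi> k x"
  by (subst pm_extend_superset[of _ "{k}"]) auto

lemma pm_extend_0 [simp]: "pm_extend \<phi> 0 = 0"
  by (simp add: pm_extend_def)

lemma pm_extend_pointwise_add: "pm_extend (\<lambda>k x. \<phi> k x + \<psi> k x) r = pm_extend \<phi> r + pm_extend \<psi> r"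
  by (simp add: pm_extend_def sum.distrib)

lemma bilinear_map_simps:
  assumes "bilinear_map s1 s2 s3 f"
  shows "f (x + x') y = f x y + f x' y" "f x (y + y') = f x y + f x y'"
    "f (s1 c x) y = s3 c (f x y)" "f x (s2 c y) = s3 c (f x y)"
    "f 0 y = 0" "f x 0 = 0"
proof -
  have 1: "Vector_Spaces.linear s2 s3 (f x)" and 2: "Vector_Spaces.linear s1 s3 (\<lambda>x. f x y)" for x y
    using assms by (auto simp: bilinear_map_def)
  interpret l1: Vector_Spaces.linear s2 s3 "f x" for x by (rule 1)
  interpret l2: Vector_Spaces.linear s1 s3 "\<lambda>x. f x y" for y by (rule 2)
  show "f (x + x') y = f x y + f x' y" "f x (y + y') = f x y + f x y'"
    "f (s1 c x) y = s3 c (f x y)" "f x (s2 c y) = s3 c (f x y)" "f 0 y = 0" "f x 0 = 0"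
    by (simp_all add: l1.add l1.scale l2.add l2.scale l1.zero l2.zero)
qed

type_synonym ('a, 'b) free_loop = "('a, 'b) loop set list \<Rightarrow>\<^sub>0 complex"

section \<open>The loop algebra and the ideal \<open>range (hat_del S)\<close>\<close>

context vertex_algebroid
begin

lemma vsA: "vector_space (smulA S)"
  using algebra_A by (simp add: unital_comm_algebra_def)

sublocale vA: complex_space "smulA S"
  by (simp add: complex_space_def vsA)

sublocale vB: complex_space "smulB S"
  by (simp add: complex_space_def vector_space_B)

lemma smulC_Pair [simp]: "smulC S c (a, b) = (smulA S c a, smulB S c b)"
  by (simp add: smulC_def)

sublocale vC: complex_space "smulC S"
  by unfold_locales
     (auto simp: smulC_def plus_prod_def vA.scale_right_distrib vB.scale_right_distrib
       vA.scale_left_distrib vB.scale_left_distrib split: prod.splits)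

lemmas alg_simps = bilinear_map_simps[OF act_bilinear] bilinear_map_simps[OF lbr_bilinear]
  bilinear_map_simps[OF anchor_bilinear] bilinear_map_simps[OF pairing_bilinear]

lemma del_lin: "lin_map (smulA S) (smulB S) (del S)"
proof -
  interpret l: Vector_Spaces.linear "smulA S" "smulB S" "del S" by (rule del_linear)
  show ?thesis by (simp add: lin_map_def l.add l.scale)
qed

lemmas del_simps = lin_map_simps[OF del_lin]

lemma prod0_simps:
  "prod0 S (x + x') y = prod0 S x y + prod0 S x' y" "prod0 S x (y + y') = prod0 S x y + prod0 S x y'"
  "prod0 S (smulC S c x) y = smulC S c (prod0 S x y)" "prod0 S x (smulC S c y) = smulC S c (prod0 S x y)"
  "prod0 S 0 y = 0" "prod0 S x 0 = 0"
  by (cases x; cases x'; cases y; cases y';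
      simp add: alg_simps zero_prod_def vA.scale_right_diff_distrib)+

lemma prod1_simps:
  "prod1 S (x + x') y = prod1 S x y + prod1 S x' y" "prod1 S x (y + y') = prod1 S x y + prod1 S x y'"
  "prod1 S (smulC S c x) y = smulC S c (prod1 S x y)" "prod1 S x (smulC S c y) = smulC S c (prod1 S x y)"
  "prod1 S 0 y = 0" "prod1 S x 0 = 0"
  by (cases x; cases x'; cases y; cases y'; simp add: alg_simps zero_prod_def)+

abbreviation "sg \<equiv> Poly_Mapping.single"
abbreviation "LA \<equiv> loop_alg S"
abbreviation "I \<equiv> range (hat_del S)"
abbreviation lscale :: "complex \<Rightarrow> ('a, 'b) loop \<Rightarrow> ('a, 'b) loop" where
  "lscale c \<equiv> Poly_Mapping.map (smulC S c)"

lemma loop_simps [simp]: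
  "carrier LA = UNIV" "x \<otimes>\<^bsub>LA\<^esub> y = loop_bracket S x y" "x \<oplus>\<^bsub>LA\<^esub> y = x + y" "\<zero>\<^bsub>LA\<^esub> = 0"
  "c \<odot>\<^bsub>LA\<^esub> x = lscale c x"
  by (simp_all add: loop_alg_def)

lemma lookup_lscale [simp]: "Poly_Mapping.lookup (lscale c r) n = smulC S c (Poly_Mapping.lookup r n)"
  by (simp add: Poly_Mapping.map.rep_eq when_def)

lemma lscale_add: "lscale c (r + t) = lscale c r + lscale c t"
  by (rule poly_mapping_eqI) (simp add: lookup_add vC.scale_right_distrib)

lemma loop_module: "module CC LA"
proof (rule module_CC_I)
  show "abelian_group LA"
  proof (rule abelian_groupI)
    show "\<exists>y\<in>carrier LA. y \<oplus>\<^bsub>LA\<^esub> x = \<zero>\<^bsub>LA\<^esub>" for x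
      by (auto intro: exI[of _ "- x"])
  qed (simp_all add: add.assoc add.commute)
qed (simp_all add: lscale_add, (rule poly_mapping_eqI, simp add: lookup_add vC.scale_left_distrib)+)

definition hd1 :: "int \<Rightarrow> 'a \<Rightarrow> ('a, 'b) loop" where
  "hd1 n a = sg n (0, del S a) + sg (n - 1) (smulA S (of_int n) a, 0)"

lemma hat_del_ext: "hat_del S r = pm_extend hd1 r"
  by (simp add: hat_del_def pm_extend_def hd1_def)

lemma hd1_0: "hd1 n 0 = 0"
  by (simp add: hd1_def del_simps zero_prod_def[symmetric])

lemma hd1_add: "hd1 n (a + a') = hd1 n a + hd1 n a'"
  by (rule poly_mapping_eqI)
     (simp add: hd1_def lookup_add lookup_single when_def del_simps vA.scale_right_distrib)

lemma hd1_scale: "hd1 n (smulA S c a) = lscale c (hd1 n a)"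
  by (rule poly_mapping_eqI)
     (simp add: hd1_def lookup_add lookup_single when_def del_simps mult.commute)

lemma hat_del_single: "hat_del S (sg n a) = hd1 n a"
  by (simp add: hat_del_ext pm_extend_single hd1_0)

lemma hat_del_add: "hat_del S (r + t) = hat_del S r + hat_del S t"
  unfolding hat_del_ext by (rule pm_extend_add) (simp_all add: hd1_0 hd1_add)

lemma hat_del_0: "hat_del S 0 = 0"
  by (simp add: hat_del_ext)

lemma hd1_I: "hd1 n a \<in> I"
  by (metis hat_del_single rangeI)

lemma I_add: "r \<in> I \<Longrightarrow> t \<in> I \<Longrightarrow> r + t \<in> I"
  using hat_del_add by (auto simp: image_iff) metis

lemma I_induct [consumes 1, case_names zero add]:
  assumes "r \<in> I" "P 0" "\<And>n a r. P r \<Longrightarrow> P (hd1 n a + r)"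
  shows "P r"
proof -
  have "P (hat_del S t)" for t
    by (induction t rule: poly_mapping_add_induct) (auto simp: hat_del_0 hat_del_add hat_del_single assms)
  then show ?thesis using assms(1) by auto
qed

lemma I_zero: "0 \<in> I"
  by (metis hat_del_0 rangeI)

lemma lscale_0 [simp]: "lscale c 0 = 0"
  by (rule poly_mapping_eqI) simp

lemma I_scale: "r \<in> I \<Longrightarrow> lscale c r \<in> I"
  by (induction rule: I_induct) (auto simp: I_zero lscale_add hd1_scale[symmetric] intro: I_add hd1_I)

definition br1 :: "int \<Rightarrow> 'a \<times> 'b \<Rightarrow> int \<Rightarrow> 'a \<times> 'b \<Rightarrow> ('a, 'b) loop" where
  "br1 m x n y = sg (m + n) (prod0 S x y) + sg (m + n - 1) (smulC S (of_int m) (prod1 S x y))"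

lemma br1_simps:
  "br1 m (x + x') n y = br1 m x n y + br1 m x' n y" "br1 m x n (y + y') = br1 m x n y + br1 m x n y'"
  "br1 m 0 n y = 0" "br1 m x n 0 = 0"
  by (simp_all add: br1_def prod0_simps prod1_simps single_add vC.scale_right_distrib algebra_simps)

lemma bracket_ext: "loop_bracket S r t = pm_extend (\<lambda>m x. pm_extend (\<lambda>n y. br1 m x n y) t) r"
  by (simp add: loop_bracket_def pm_extend_def br1_def)

lemma bracket_add_left: "loop_bracket S (r + r') t = loop_bracket S r t + loop_bracket S r' t"
  unfolding bracket_ext
  by (rule pm_extend_add) (simp_all add: br1_simps sum.distrib pm_extend_def)

lemma bracket_add_right: "loop_bracket S r (t + t') = loop_bracket S r t + loop_bracket S r t'"
  unfolding bracket_ext pm_extend_add[of "\<lambda>n y. br1 m x n y" for m x, OF br1_simps(4,2)]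
  by (rule pm_extend_pointwise_add)

lemma bracket_single: "loop_bracket S (sg m x) (sg n y) = br1 m x n y"
  unfolding bracket_ext by (simp add: pm_extend_single br1_simps)

lemma bracket_0: "loop_bracket S 0 t = 0" "loop_bracket S r 0 = 0"
  by (simp_all add: bracket_ext) (simp add: pm_extend_def)

text \<open>The bracket with the image of a t^n on the left is already zero in the loop algebra:
  \<open>anchor_del\<close> and [del a, b] = 0 remove two terms, and n <del a, b> t^(n+m-1) cancels
  against the contribution of n a t^(n-1), because a_0 b is minus the anchor of b at a.\<close>

lemma I_left:
  assumes "r \<in> I"
  shows "loop_bracket S r t \<in> I"
proof -
  have "br1 n (0, del S a) m y + br1 (n - 1) (smulA S (of_int n) a, 0) m y = 0" for n m a y
  proof -
    obtain a' b where y: "y = (a', b)" by (cases y)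
    have "lbr S (del S a) b = 0"
      using lbr_skew[of b "del S a"] lbr_del[of b a] pairing_del[of b a] by simp
    moreover have "pairing S (del S a) b = anchor S b a"
      using pairing_del pairing_sym by metis
    moreover have "sg (n + m - 1) (smulA S (of_int n) (anchor S b a), 0) +
       sg (n - 1 + m) (- smulA S (of_int n) (anchor S b a), 0 :: 'b) = 0"
      by (rule poly_mapping_eqI) (simp add: lookup_add lookup_single when_def zero_prod_def)
    ultimately show ?thesis
      by (simp add: y br1_def anchor_del alg_simps zero_prod_def[symmetric])
  qed
  then have *: "loop_bracket S (hd1 n a) t = 0" for n a
    by (induction t rule: poly_mapping_add_induct)
       (simp_all add: bracket_0 bracket_add_right, simp add: hd1_def bracket_add_left bracket_single)
  show ?thesis
    using assms by (induction rule: I_induct) (auto simp: * bracket_0 I_zero bracket_add_left)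
qed

text \<open>The loop bracket is skew only modulo \<open>range (hat_del S)\<close>, so this side is
  computed separately: bracketing b t^m with the image of a t^n gives the image of
  \<open>anchor S b a\<close> times t^(m+n).\<close>

lemma I_right:
  assumes "r \<in> I"
  shows "loop_bracket S t r \<in> I"
proof -
  have "br1 m y n (0, del S a) + br1 m y (n - 1) (smulA S (of_int n) a, 0) \<in> I" for n m a y
  proof -
    obtain a' b where y: "y = (a', b)" by (cases y)
    have "br1 m y n (0, del S a) + br1 m y (n - 1) (smulA S (of_int n) a, 0) = hd1 (m + n) (anchor S b a)"
      by (rule poly_mapping_eqI)
         (simp add: y br1_def hd1_def anchor_del lbr_del pairing_del alg_simps lookup_add lookup_single when_def
          vA.scale_left_distrib algebra_simps zero_prod_def)
    then show ?thesis using hd1_I by simp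
  qed
  then have *: "loop_bracket S t (hd1 n a) \<in> I" for n a
    by (induction t rule: poly_mapping_add_induct)
       (auto simp: bracket_0 bracket_add_left I_zero intro!: I_add, simp add: hd1_def bracket_add_right bracket_single)
  show ?thesis
    using assms by (induction rule: I_induct) (auto simp: bracket_0 I_zero bracket_add_right intro: I_add *)
qed

lemma I_submodule: "submodule I CC LA"
proof -
  interpret cmodule LA by (simp add: cmodule_def loop_module)
  show ?thesis by (rule subspaceI) (simp_all add: I_zero I_add I_scale)
qed

sublocale LQ: cquot LA I
  by (simp add: cquot_def cquot_axioms_def cmodule_def loop_module I_submodule)

abbreviation "LL \<equiv> lie_alg S"

definition lc :: "('a, 'b) loop \<Rightarrow> ('a, 'b) loop set" where
  "lc r = I +>\<^bsub>LA\<^esub> r"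

lemma lc_simps:
  "lc r \<in> carrier LL" "lc r \<oplus>\<^bsub>LL\<^esub> lc t = lc (r + t)" "c \<odot>\<^bsub>LL\<^esub> lc r = lc (lscale c r)"
  "lc r \<otimes>\<^bsub>LL\<^esub> lc t = lc (loop_bracket S r t)"
proof -
  show "lc r \<in> carrier LL" "lc r \<oplus>\<^bsub>LL\<^esub> lc t = lc (r + t)" "c \<odot>\<^bsub>LL\<^esub> lc r = lc (lscale c r)"
    using LQ.coset_in_Q[of r] LQ.add_Q[of r t] LQ.smult_Q[of r c] by (simp_all add: lc_def lie_alg_def)
  show "lc r \<otimes>\<^bsub>LL\<^esub> lc t = lc (loop_bracket S r t)"
    using LQ.mult_Q[of r t] by (simp add: lc_def lie_alg_def bracket_add_left bracket_add_right I_left I_right)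
qed

lemma lc_cases: assumes "x \<in> carrier LL" obtains r where "x = lc r"
  using assms LQ.carrier_Q by (auto simp: lc_def lie_alg_def)

lemma lc_eqD: "lc r = lc t \<Longrightarrow> \<exists>i\<in>I. r = i + t"
  using LQ.I.a_rcos_self[of r] by (auto simp: lc_def a_r_coset_def')

lemma lie_mode_lc: "lie_mode S u n = lc (sg n u)"
  by (simp add: lie_mode_def lc_def)

sublocale induced "lie_alg S" "lie_nonneg S"
proof
  show "lie_nonneg S \<subseteq> carrier LL"
    using lc_simps(1) by (auto simp: lie_nonneg_def lc_def[symmetric])
qed (auto elim!: lc_cases simp: lc_simps)

section \<open>The modes of \<open>A \<oplus> B\<close> on the model of V_L\<close>

definition md :: "'a \<times> 'b \<Rightarrow> int \<Rightarrow> ('a, 'b) free_loop \<Rightarrow> ('a, 'b) free_loop" where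
  "md u n = op (lie_mode S u n)"


lemma md_lin: "lin_map pscale pscale (md v n)"
  by (simp add: md_def op_lin)

lemmas md_simps = lin_map_simps[OF md_lin]

lemma md_p [simp]: "md v n (p w) = md v n w" and p_md [simp]: "p (md v n w) = md v n w"
  by (simp_all add: md_def)

lemma lie_mode_carrier [simp]: "lie_mode S v n \<in> carrier LL"
  by (simp add: lie_mode_lc lc_simps)

lemma md_add: "md (v + v') n w = md v n w + md v' n w"
  using op_add[of "lie_mode S v n" "lie_mode S v' n" w]
  by (simp add: md_def lie_mode_lc lc_simps single_add)

lemma md_scale: "md (smulC S c v) n w = pscale c (md v n w)"
  using op_smult[of "lie_mode S v n" c w]
  by (simp add: md_def lie_mode_lc lc_simps)

lemma op_lc_0: "op (lc 0) w = 0"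
  using op_smult[of "lc 0" 0 w] by (simp add: lc_simps)

lemma md_del: "md (0, del S a) n w = - pscale (of_int n) (md (a, 0) (n - 1) w)"
proof -
  have "lc (hd1 n a) = lc 0"
    using LQ.coset_zero_iff[of "hd1 n a"] LQ.coset_zero_iff[of 0] hd1_I I_zero by (simp add: lc_def)
  then have "lie_mode S (0, del S a) n \<oplus>\<^bsub>LL\<^esub> lie_mode S (smulC S (of_int n) (a, 0)) (n - 1) = lc 0"
    by (simp add: lie_mode_lc lc_simps hd1_def)
  then have "md (0, del S a) n w + md (smulC S (of_int n) (a, 0)) (n - 1) w = 0"
    unfolding md_def using op_add[OF lie_mode_carrier lie_mode_carrier] op_lc_0 by metis
  then show ?thesis
    unfolding md_scale by (simp add: eq_neg_iff_add_eq_0)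
qed

lemma md_comm: "md v m (md v' n w) - md v' n (md v m w) =
    md (prod0 S v v') (m + n) w + pscale (of_int m) (md (prod1 S v v') (m + n - 1) w)"
proof -
  have "lie_mode S v m \<otimes>\<^bsub>LL\<^esub> lie_mode S v' n = lie_mode S (prod0 S v v') (m + n) \<oplus>\<^bsub>LL\<^esub>
      lie_mode S (smulC S (of_int m) (prod1 S v v')) (m + n - 1)"
    by (simp add: lie_mode_lc lc_simps bracket_single br1_def)
  then have "md v m (md v' n w) - md v' n (md v m w) =
      md (prod0 S v v') (m + n) w + md (smulC S (of_int m) (prod1 S v v')) (m + n - 1) w"
    unfolding md_def using op_mult[of "lie_mode S v m" "lie_mode S v' n" w]
      op_add[of "lie_mode S (prod0 S v v') (m + n)" "lie_mode S (smulC S (of_int m) (prod1 S v v')) (m + n - 1)" w]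
    by simp
  then show ?thesis by (simp only: md_scale)
qed

lemma md_vac: "n \<ge> 0 \<Longrightarrow> md v n vac = 0"
  unfolding md_def lie_mode_lc by (rule op_vac) (auto simp: lie_nonneg_def lc_def intro!: exI[of _ "sg n v"] split: if_splits)

lemma md_mult_closed:
  assumes "P w" "p w = w" "f \<in> fc"
    and "\<And>x y. P x \<Longrightarrow> P y \<Longrightarrow> P (x + y)" "\<And>c x. P x \<Longrightarrow> P (pscale c x)"
    and "\<And>v n x. P x \<Longrightarrow> p x = x \<Longrightarrow> P (md v n x)"
  shows "P (p (f * w))"
proof (rule p_mult_closed[OF assms(1-5)])
  fix x h assume "x \<in> carrier LL" "P h" "p h = h"
  obtain r where x: "x = lc r" using \<open>x \<in> carrier LL\<close> by (rule lc_cases)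
  have P0: "P 0" using assms(5)[OF assms(1), of 0] by simp
  have "P (op (lc r) h)"
  proof (induction r rule: poly_mapping_add_induct)
    case zero
    then show ?case by (simp add: op_lc_0 P0)
  next
    case (add n v r)
    have "op (lc (sg n v + r)) h = md v n h + op (lc r) h"
      using op_add[of "lc (sg n v)" "lc r" h] by (simp add: lc_simps md_def lie_mode_lc)
    then show ?case using add assms(4) assms(6)[OF \<open>P h\<close> \<open>p h = h\<close>] by simp
  qed
  then show "P (op x h)" by (simp add: x)
qed

lemma md_induct:
  assumes "P vac" "\<And>x y. P x \<Longrightarrow> P y \<Longrightarrow> P (x + y)" "\<And>c x. P x \<Longrightarrow> P (pscale c x)"
    and "\<And>v n x. P x \<Longrightarrow> p x = x \<Longrightarrow> P (md v n x)"
  shows "P (p w)"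
proof -
  have "P (p (p w * vac))"
    by (rule md_mult_closed) (use assms in auto)
  then show ?thesis by (simp add: vac_def p_mult)
qed

text \<open>The universal property in terms of modes. The operators are extended additively to
  loops; \<open>del\<close> is what makes the extension vanish on \<open>range (hat_del S)\<close>
  and \<open>mult\<close> makes it a representation of the Lie algebra.\<close>

lemma md_universal:
  assumes s: "complex_space s" and lin: "\<And>v n. lin_map s s (\<rho> v n)"
    and add: "\<And>v v' n w. \<rho> (v + v') n w = \<rho> v n w + \<rho> v' n w"
    and smult: "\<And>c v n w. \<rho> (smulC S c v) n w = s c (\<rho> v n w)"
    and del: "\<And>a n w. \<rho> (0, del S a) n w + s (of_int n) (\<rho> (a, 0) (n - 1) w) = 0"
    and mult: "\<And>v v' m n w. \<rho> v m (\<rho> v' n w) - \<rho> v' n (\<rho> v m w) =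
        \<rho> (prod0 S v v') (m + n) w + s (of_int m) (\<rho> (prod1 S v v') (m + n - 1) w)"
    and w0: "\<And>v n. n \<ge> 0 \<Longrightarrow> \<rho> v n w0 = 0"
  obtains \<Phi> where "lin_map pscale s \<Phi>" "\<Phi> vac = w0" "\<And>w. \<Phi> (p w) = \<Phi> w"
    "\<And>v n w. \<Phi> (md v n w) = \<rho> v n (\<Phi> w)"
proof -
  interpret s: complex_space s by fact
  define E where "E r w = pm_extend (\<lambda>n v. \<rho> v n w) r" for r w
  have \<rho>0: "\<rho> 0 n w = 0" for n w using add[of 0 0 n w] by simp
  have E_add: "E (r + t) w = E r w + E t w" for r t w
    unfolding E_def by (rule pm_extend_add) (simp_all add: \<rho>0 add)
  have E_single: "E (sg n v) w = \<rho> v n w" for n v w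
    unfolding E_def by (rule pm_extend_single) (simp add: \<rho>0)
  have E_0: "E 0 w = 0" for w by (simp add: E_def)
  have E_lin: "lin_map s s (E r)" for r
    by (induction r rule: poly_mapping_add_induct)
       (simp_all add: lin_map_def E_0 E_add E_single lin_map_simps[OF lin] s.scale_right_distrib)
  have E_scale: "E (lscale c r) w = s c (E r w)" for c r w
    by (induction r rule: poly_mapping_add_induct)
       (simp_all add: E_0 E_add E_single smult lscale_add s.scale_right_distrib)
  have E_I: "E r w = 0" if "r \<in> I" for r w
    using that by (induction rule: I_induct)
      (simp_all add: E_0 E_add E_single hd1_def del smult[of _ "(a, 0)" for a, simplified])
  have E_br: "E (loop_bracket S r t) w = E r (E t w) - E t (E r w)" for r t w
  proof (induction r rule: poly_mapping_add_induct)
    case (add m v r)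
    have "E (loop_bracket S (sg m v) t) w = \<rho> v m (E t w) - E t (\<rho> v m w)"
    proof (induction t rule: poly_mapping_add_induct)
      case (add n v' t)
      then show ?case
        using mult[of v m v' n w]
        by (simp add: bracket_add_right bracket_single E_add E_single br1_def smult lin_map_simps[OF lin])
    qed (simp add: bracket_0 E_0 lin_map_simps[OF lin])
    then show ?case
      using add by (simp add: bracket_add_left E_add E_single lin_map_simps[OF E_lin])
  qed (simp add: bracket_0 E_0 lin_map_simps[OF E_lin])
  \<comment> \<open>By \<open>E_I\<close> the operator is constant on cosets, so the arbitrary
    representative does not matter.\<close>
  define R where "R x w = E (SOME r. x = lc r) w" for x w
  have R: "R (lc r) w = E r w" for r w
  proof -
    have "lc r = lc (SOME t. lc r = lc t)" by (rule someI[of _ r]) simp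
    from lc_eqD[OF this] obtain i where i: "i \<in> I" "r = i + (SOME t. lc r = lc t)" by blast
    have "E r w = E i w + E (SOME t. lc r = lc t) w"
      using arg_cong[OF i(2), of "\<lambda>r. E r w"] by (simp only: E_add)
    then show ?thesis using i(1) by (simp add: R_def E_I)
  qed
  show ?thesis
  proof (rule universal[of s R w0, OF s])
    show "lin_map s s (R x)" for x unfolding R_def[abs_def] by (rule E_lin)
    show "R x w0 = 0" if "x \<in> lie_nonneg S" for x
    proof -
      from that obtain r where r: "x = lc r" "Poly_Mapping.keys r \<subseteq> {0..}"
        by (auto simp: lie_nonneg_def lc_def)
      then show ?thesis by (auto simp: R E_def pm_extend_def w0 intro!: sum.neutral)
    qed
    fix \<Phi> assume \<Phi>: "lin_map pscale s \<Phi>" "\<Phi> vac = w0" "\<And>w. \<Phi> (p w) = \<Phi> w"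
      "\<And>x w. x \<in> carrier LL \<Longrightarrow> \<Phi> (op x w) = R x (\<Phi> w)"
    have "\<Phi> (md v n w) = \<rho> v n (\<Phi> w)" for v n w
      using \<Phi>(4)[OF lie_mode_carrier] by (simp add: md_def lie_mode_lc R E_single)
    with \<Phi>(1-3) show thesis by (rule that)
  qed (auto elim!: lc_cases simp: lc_simps R E_add E_scale E_br)
qed

definition pair_scale :: "complex \<Rightarrow> (('k \<Rightarrow>\<^sub>0 complex) \<times> ('k \<Rightarrow>\<^sub>0 complex)) \<Rightarrow> _" where
  "pair_scale c = map_prod (pscale c) (pscale c)"

text \<open>The translation operator is the second component of the map from the induced module to its
  square on which \<open>v(n)\<close> acts by \<open>(x, y) \<mapsto> (v(n) x, v(n) y - n v(n-1) x)\<close>.\<close>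

lemma translation_ex:
  "\<exists>D. lin_map pscale pscale D \<and> D vac = 0 \<and> (\<forall>w. D (p w) = D w) \<and> (\<forall>w. p (D w) = D w) \<and>
     (\<forall>v n w. D (md v n w) = md v n (D w) - pscale (of_int n) (md v (n - 1) w))"
proof -
  define \<rho> where "\<rho> v n = (\<lambda>(x, y). (md v n x, md v n y - pscale (of_int n) (md v (n - 1) x)))" for v n
  have ps: "pair_scale c (x, y) = (pscale c x, pscale c y)" for c and x y :: "'k \<Rightarrow>\<^sub>0 complex"
    by (simp add: pair_scale_def)
  have cs: "complex_space (pair_scale :: complex \<Rightarrow> (('k \<Rightarrow>\<^sub>0 complex) \<times> ('k \<Rightarrow>\<^sub>0 complex)) \<Rightarrow> _)"
    by unfold_locales (auto simp: ps pscale.scale_right_distrib pscale.scale_left_distrib)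
  show ?thesis
  proof (rule md_universal[of pair_scale \<rho> "(vac, 0)", OF cs])
    show "lin_map pair_scale pair_scale (\<rho> v n)" for v n
      by (auto simp: lin_map_def \<rho>_def ps md_simps pscale.scale_right_distrib pscale.scale_right_diff_distrib mult.commute)
    show "\<rho> (v + v') n w = \<rho> v n w + \<rho> v' n w" for v v' n w
      by (cases w) (auto simp: \<rho>_def md_add pscale.scale_right_distrib)
    show "\<rho> (smulC S c v) n w = pair_scale c (\<rho> v n w)" for c v n w
      by (cases w) (auto simp: \<rho>_def md_scale ps pscale.scale_right_diff_distrib mult.commute)
    show "\<rho> (0, del S a) n w + pair_scale (of_int n) (\<rho> (a, 0) (n - 1) w) = 0" for a n w
      by (cases w) (auto simp: \<rho>_def md_del ps pscale.scale_right_diff_distrib mult.commute zero_prod_def)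
    show "\<rho> v n (vac, 0) = 0" if "n \<ge> 0" for v n
      using that md_vac[of n v] md_vac[of "n - 1" v]
      by (cases "n = 0") (auto simp: \<rho>_def md_simps zero_prod_def)
    show "\<rho> v m (\<rho> v' n w) - \<rho> v' n (\<rho> v m w) =
        \<rho> (prod0 S v v') (m + n) w + pair_scale (of_int m) (\<rho> (prod1 S v v') (m + n - 1) w)" for v v' m n w
    proof -
      obtain x y where w: "w = (x, y)" by (cases w)
      have c1: "md v m (md v' (n - 1) x) = md v' (n - 1) (md v m x) + (md (prod0 S v v') (m + n - 1) x +
          pscale (of_int m) (md (prod1 S v v') (m + n - 2) x))"
        using md_comm[of v m v' "n - 1" x] by (simp add: algebra_simps)
      have c2: "md v (m - 1) (md v' n x) = md v' n (md v (m - 1) x) + (md (prod0 S v v') (m + n - 1) x +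
          pscale (of_int (m - 1)) (md (prod1 S v v') (m + n - 2) x))"
        using md_comm[of v "m - 1" v' n x] by (simp add: algebra_simps)
      have c3: "md v m (md v' n z) = md v' n (md v m z) + (md (prod0 S v v') (m + n) z +
          pscale (of_int m) (md (prod1 S v v') (m + n - 1) z))" for z
        using md_comm[of v m v' n z] by (simp add: algebra_simps)
      show ?thesis
        by (simp add: w \<rho>_def ps md_simps c1 c2 c3 pscale.scale_right_diff_distrib pscale.scale_right_distrib
            pscale.scale_left_diff_distrib pscale.scale_left_distrib)
    qed
    fix \<Phi> assume \<Phi>: "lin_map pscale pair_scale \<Phi>" "\<Phi> vac = (vac, 0)" "\<And>w. \<Phi> (p w) = \<Phi> w"
      "\<And>v n w. \<Phi> (md v n w) = \<rho> v n (\<Phi> w)"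
    have "fst (\<Phi> (p w)) = p (p w)" for w
    proof (rule md_induct[where P = "\<lambda>x. fst (\<Phi> x) = p x"])
      show "fst (\<Phi> (x + y)) = p (x + y)" if "fst (\<Phi> x) = p x" "fst (\<Phi> y) = p y" for x y
        using that by (simp add: lin_map_simps[OF \<Phi>(1)] p_simps)
      show "fst (\<Phi> (pscale c x)) = p (pscale c x)" if "fst (\<Phi> x) = p x" for c x
        using that by (simp add: lin_map_simps[OF \<Phi>(1)] p_simps pair_scale_def)
      show "fst (\<Phi> (md v n x)) = p (md v n x)" if "fst (\<Phi> x) = p x" for v n x
        using that by (cases "\<Phi> x") (simp add: \<Phi>(4) \<rho>_def)
    qed (simp add: \<Phi>(2))
    then have fst: "fst (\<Phi> w) = p w" for w by (simp add: \<Phi>(3))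
    have "snd (\<Phi> (md v n w)) = md v n (snd (\<Phi> w)) - pscale (of_int n) (md v (n - 1) w)" for v n w
      using fst[of w] by (cases "\<Phi> w") (simp add: \<Phi>(4) \<rho>_def)
    then show ?thesis
      by (intro exI[of _ "\<lambda>w. p (snd (\<Phi> w))"])
         (simp add: \<Phi>(2,3) lin_map_def lin_map_simps[OF \<Phi>(1)] p_simps pair_scale_def)
  qed
qed

definition tr :: "('a, 'b) free_loop \<Rightarrow> ('a, 'b) free_loop" where
  "tr = (SOME D. lin_map pscale pscale D \<and> D vac = 0 \<and> (\<forall>w. D (p w) = D w) \<and> (\<forall>w. p (D w) = D w) \<and>
     (\<forall>v n w. D (md v n w) = md v n (D w) - pscale (of_int n) (md v (n - 1) w)))"

lemma tr_lin: "lin_map pscale pscale tr" and tr_vac: "tr vac = 0" and tr_p: "tr (p w) = tr w"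
  and p_tr: "p (tr w) = tr w" and tr_md: "tr (md v n w) = md v n (tr w) - pscale (of_int n) (md v (n - 1) w)"
  using someI_ex[OF translation_ex, folded tr_def] by blast+

text \<open>Moving v(n) past v'(k) produces modes of v_0 v' and v_1 v', so the induction hypothesis
  has to range over all states at once.\<close>

lemma md_truncation: "\<exists>N. \<forall>n\<ge>N. md v n w = 0"
proof -
  have "\<forall>v. \<exists>N. \<forall>n\<ge>N. md v n (p w) = 0"
  proof (rule md_induct[where P = "\<lambda>x. \<forall>v. \<exists>N. \<forall>n\<ge>N. md v n x = 0"])
    show "\<forall>v. \<exists>N. \<forall>n\<ge>N. md v n vac = 0" using md_vac by blast
    show "\<forall>v. \<exists>N. \<forall>n\<ge>N. md v n (x + y) = 0"
      if *: "\<forall>v. \<exists>N. \<forall>n\<ge>N. md v n x = 0" "\<forall>v. \<exists>N. \<forall>n\<ge>N. md v n y = 0" for x y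
    proof
      fix v
      obtain N1 N2 where "\<forall>n\<ge>N1. md v n x = 0" "\<forall>n\<ge>N2. md v n y = 0" using * by blast
      then show "\<exists>N. \<forall>n\<ge>N. md v n (x + y) = 0"
        by (intro exI[of _ "max N1 N2"]) (simp add: md_simps)
    qed
    show "\<forall>v. \<exists>N. \<forall>n\<ge>N. md v n (pscale c x) = 0" if "\<forall>v. \<exists>N. \<forall>n\<ge>N. md v n x = 0" for c x
      using that by (simp add: md_simps) (metis pscale.scale_zero_right)
    show "\<forall>v. \<exists>N. \<forall>n\<ge>N. md v n (md v' k x) = 0" if *: "\<forall>v. \<exists>N. \<forall>n\<ge>N. md v n x = 0" for v' k x
    proof
      fix v
      obtain N1 N2 N3 where "\<forall>n\<ge>N1. md v n x = 0" "\<forall>n\<ge>N2. md (prod0 S v v') n x = 0"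
        "\<forall>n\<ge>N3. md (prod1 S v v') n x = 0" using * by meson
      then have "md v n (md v' k x) = 0" if "n \<ge> max N1 (max (N2 - k) (N3 - k + 1))" for n
        using that md_comm[of v n v' k x] by (simp add: md_simps)
      then show "\<exists>N. \<forall>n\<ge>N. md v n (md v' k x) = 0" by blast
    qed
  qed
  then have "\<exists>N. \<forall>n\<ge>N. md v n (p w) = 0" by (rule spec)
  then show ?thesis by simp
qed

lemma md_fld: "pscale.fld (md v)"
  by (simp add: pscale.fld_def md_lin md_truncation)

text \<open>The exponent 2 suffices: for fixed m + n the commutator formula is affine in m, so its
  second difference vanishes. Equivalently, (x - y)^2 kills the delta function and its first
  derivative.\<close>

lemma md_mloc: "pscale.mloc (md v) (md v')"
proof -
  have b0: "pscale.bor (md v) (md v') (int 0) m n w =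
     md (prod0 S v v') (m + n) w + pscale (of_int m) (md (prod1 S v v') (m + n - 1) w)" for m n w
    using pscale.bor_0[OF md_fld md_fld] md_comm by simp
  have "pscale.bor (md v) (md v') (int (Suc (Suc 0))) m n w = 0" for m n w
    using pscale.scale_left_distrib[of 1 1] unfolding pscale.bor_Suc_nat[OF md_fld md_fld] b0
    by (simp add: pscale.scale_left_distrib algebra_simps)
  then show ?thesis unfolding pscale.mloc_def by blast
qed

sublocale FF: field_family pscale p tr vac "range md"
proof
  show "lin_map pscale pscale p" by (rule p_lin)
  show "P (p w)" if "P vac" "\<And>x y. P x \<Longrightarrow> P y \<Longrightarrow> P (x + y)" "\<And>c x. P x \<Longrightarrow> P (pscale c x)"
      "\<And>a n x. a \<in> range md \<Longrightarrow> P x \<Longrightarrow> p x = x \<Longrightarrow> P (a n x)" for P w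
    by (rule md_induct) (use that in auto)
qed (auto simp: tr_lin tr_p p_tr tr_vac md_fld md_vac md_mloc pscale.cov_def tr_md)

end

section \<open>The vertex algebra \<open>V\<^sub>L\<close>\<close>

context cmodule
begin

text \<open>The map \<open>h\<close> preserves supports, and both sums are zero by convention on
  infinite supports, so the two notions of sum agree in every case.\<close>

lemma fsum_image:
  assumes h: "\<And>x y. x \<in> W \<Longrightarrow> y \<in> W \<Longrightarrow> h (x + y) = h x \<oplus> h y" "h 0 = \<zero>"
    "\<And>x. x \<in> W \<Longrightarrow> h x \<in> carrier M" "\<And>x. x \<in> W \<Longrightarrow> h x = \<zero> \<longleftrightarrow> x = 0"
    and W: "0 \<in> W" "\<And>x y. x \<in> W \<Longrightarrow> y \<in> W \<Longrightarrow> x + y \<in> W"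
    and f: "\<And>i. f i \<in> (W :: 'w::ab_group_add set)"
  shows "fsum M (\<lambda>i. h (f i)) = h (Sum_any f)"
proof -
  have e: "{i. h (f i) \<noteq> \<zero>} = {i. f i \<noteq> 0}"
    using h(4) f by blast
  have *: "finsum M (\<lambda>i. h (f i)) I = h (\<Sum>i\<in>I. f i) \<and> (\<Sum>i\<in>I. f i) \<in> W" if "finite I" for I
    using that
  proof (induction I rule: finite_induct)
    case empty
    then show ?case using h(2) W(1) by simp
  next
    case (insert i I)
    have "(\<lambda>i. h (f i)) \<in> I \<rightarrow> carrier M" "h (f i) \<in> carrier M" using h f by auto
    then have "finsum M (\<lambda>i. h (f i)) (insert i I) = h (f i) \<oplus> finsum M (\<lambda>i. h (f i)) I"
      using insert by (intro finsum_insert) auto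
    then show ?case using insert h W f by simp
  qed
  show ?thesis
    using * by (simp add: fsum_def e Sum_any.expand_set h(2))
qed

end

context vertex_algebroid
begin

abbreviation "W \<equiv> {w. p w = w}"

sublocale VM: cmodule "VL S"
  using module_V by (simp add: cmodule_def VL_def)

lemma W_fc: "p w = w \<Longrightarrow> w \<in> fc"
  using p_fc[of w] by simp

lemma W_closed [simp]: "p w = w \<Longrightarrow> p w' = w' \<Longrightarrow> p (w + w') = w + w'" "p w = w \<Longrightarrow> p (pscale c w) = pscale c w"
  "p w = w \<Longrightarrow> p w' = w' \<Longrightarrow> p (w - w') = w - w'" "p 0 = 0" "p (FF.Yf x n w) = FF.Yf x n w"
  by (simp_all add: p_simps FF.p_good[OF FF.Yf_good])

lemma qW:
  "p w = w \<Longrightarrow> q w \<in> carrier (VL S)"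
  "p w = w \<Longrightarrow> p w' = w' \<Longrightarrow> q w \<oplus>\<^bsub>VL S\<^esub> q w' = q (w + w')"
  "p w = w \<Longrightarrow> c \<odot>\<^bsub>VL S\<^esub> q w = q (pscale c w)"
  "p w = w \<Longrightarrow> p w' = w' \<Longrightarrow> q w = q w' \<longleftrightarrow> w = w'"
  "\<zero>\<^bsub>VL S\<^esub> = q 0"
proof -
  show "p w = w \<Longrightarrow> p w' = w' \<Longrightarrow> q w = q w' \<longleftrightarrow> w = w'"
    using q_bij by (auto simp: bij_betw_def inj_on_def)
qed (simp_all add: VL_def q_simps W_fc zero_V)

lemma qW_minus: "p w = w \<Longrightarrow> p w' = w' \<Longrightarrow> q w \<ominus>\<^bsub>VL S\<^esub> q w' = q (w - w')"
proof -
  assume w: "p w = w" "p w' = w'"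
  then have "q w \<ominus>\<^bsub>VL S\<^esub> q w' = q w \<oplus>\<^bsub>VL S\<^esub> (-1) \<odot>\<^bsub>VL S\<^esub> q w'"
    using VM.minus_smult[of "q w'"] by (simp add: a_minus_def qW)
  also have "\<dots> = q (w + pscale (-1) w')" using w by (simp only: qW W_closed)
  finally show ?thesis by simp
qed

lemma VL_cases: assumes "z \<in> carrier (VL S)" obtains w where "p w = w" "z = q w"
  using assms q_bij by (auto simp: VL_def bij_betw_def)

definition iq where "iq z = (THE w. p w = w \<and> q w = z)"

lemma iq_q [simp]: "p w = w \<Longrightarrow> iq (q w) = w"
  unfolding iq_def by (rule the_equality) (auto simp: qW)

lemma q_mode: "p w = w \<Longrightarrow> q (md v n w) = VL_mode S v n (q w)"
  using q_op[of "lie_mode S v n" w] by (simp add: md_def VL_mode_def)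

lemma q_vac': "q vac = VL_vac S"
  by (simp add: q_vac VL_vac_def)

lemma q_emb: "q (md v (-1) vac) = VL_emb S v"
  by (simp add: VL_emb_def q_mode q_vac')

lemma fsum_q: "(\<And>i. p (f i) = f i) \<Longrightarrow> fsum (VL S) (\<lambda>i. q (f i)) = q (Sum_any f)"
  by (rule VM.fsum_image[where W = W]) (auto simp: qW)

definition YV where "YV z n z' = q (FF.Yf (iq z) n (iq z'))"

lemma YV_q [simp]: "p w = w \<Longrightarrow> p w' = w' \<Longrightarrow> YV (q w) n (q w') = q (FF.Yf w n w')"
  by (simp add: YV_def)

lemma bor_fsum:
  assumes "p u = u" "p v = v" "p w = w"
  shows "fsum (VL S) (\<lambda>i. ((-1) ^ i * (of_int l gchoose i)) \<odot>\<^bsub>VL S\<^esub>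
             (YV (q u) (m + l - int i) (YV (q v) (n + int i) (q w)) \<ominus>\<^bsub>VL S\<^esub>
              ((-1) powi l) \<odot>\<^bsub>VL S\<^esub> YV (q v) (n + l - int i) (YV (q u) (m + int i) (q w))))
     = q (pscale.bor (FF.Yf u) (FF.Yf v) l m n w)"
proof -
  have "((-1) ^ i * (of_int l gchoose i)) \<odot>\<^bsub>VL S\<^esub>
             (YV (q u) (m + l - int i) (YV (q v) (n + int i) (q w)) \<ominus>\<^bsub>VL S\<^esub>
              ((-1) powi l) \<odot>\<^bsub>VL S\<^esub> YV (q v) (n + l - int i) (YV (q u) (m + int i) (q w)))
     = q (pscale (altbin l i) (pscale.bor_term (FF.Yf u) (FF.Yf v) l m n w i))" for i
    using assms by (simp add: qW qW_minus altbin_def pscale.bor_term_def)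
  moreover have "p (pscale (altbin l i) (pscale.bor_term (FF.Yf u) (FF.Yf v) l m n w i))
      = pscale (altbin l i) (pscale.bor_term (FF.Yf u) (FF.Yf v) l m n w i)" for i
    using assms by (simp add: pscale.bor_term_def)
  ultimately show ?thesis
    by (simp add: fsum_q pscale.bor_def)
qed

lemma vertex_algebra_YV: "vertex_algebra (VL S) (VL_vac S) YV"
proof -
  have "module CC (VL S)" by (simp add: VL_def module_V)
  moreover have "vertex_algebra_axioms (VL S) (VL_vac S) YV"
  proof
    show "VL_vac S \<in> carrier (VL S)" by (simp add: q_vac'[symmetric] qW)
  next
    fix u v and n :: int assume "u \<in> carrier (VL S)" "v \<in> carrier (VL S)"
    then show "YV u n v \<in> carrier (VL S)" by (auto elim!: VL_cases simp: qW)
  next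
    fix u u' v and n :: int
    assume "u \<in> carrier (VL S)" "u' \<in> carrier (VL S)" "v \<in> carrier (VL S)"
    then show "YV (u \<oplus>\<^bsub>VL S\<^esub> u') n v = YV u n v \<oplus>\<^bsub>VL S\<^esub> YV u' n v"
      by (auto elim!: VL_cases simp: qW FF.Yf_add)
  next
    fix u v c and n :: int assume "u \<in> carrier (VL S)" "v \<in> carrier (VL S)"
    then show "YV (c \<odot>\<^bsub>VL S\<^esub> u) n v = c \<odot>\<^bsub>VL S\<^esub> YV u n v"
      by (auto elim!: VL_cases simp: qW FF.Yf_scale)
  next
    fix u v v' and n :: int
    assume "u \<in> carrier (VL S)" "v \<in> carrier (VL S)" "v' \<in> carrier (VL S)"
    then show "YV u n (v \<oplus>\<^bsub>VL S\<^esub> v') = YV u n v \<oplus>\<^bsub>VL S\<^esub> YV u n v'"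
      by (auto elim!: VL_cases simp: qW FF.Yf_simps)
  next
    fix u v c and n :: int assume "u \<in> carrier (VL S)" "v \<in> carrier (VL S)"
    then show "YV u n (c \<odot>\<^bsub>VL S\<^esub> v) = c \<odot>\<^bsub>VL S\<^esub> YV u n v"
      by (auto elim!: VL_cases simp: qW FF.Yf_simps)
  next
    fix u v assume "u \<in> carrier (VL S)" "v \<in> carrier (VL S)"
    then obtain w w' where w: "p w = w" "u = q w" "p w' = w'" "v = q w'" by (auto elim!: VL_cases)
    obtain N where "\<forall>n\<ge>N. FF.Yf w n w' = 0" using FF.Yf_fld[of w] unfolding pscale.fld_def by blast
    then show "\<exists>N. \<forall>n\<ge>N. YV u n v = \<zero>\<^bsub>VL S\<^esub>" using w by (auto simp: qW)
  next
    fix v and n :: int assume "v \<in> carrier (VL S)"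
    then show "YV (VL_vac S) n v = (if n = -1 then v else \<zero>\<^bsub>VL S\<^esub>)"
      by (auto elim!: VL_cases simp: q_vac'[symmetric] FF.Yf_vac FF.idf_def qW)
  next
    fix v assume "v \<in> carrier (VL S)"
    then show "YV v (-1) (VL_vac S) = v"
      by (auto elim!: VL_cases simp: q_vac'[symmetric] FF.Yf)
  next
    fix v and n :: int assume "v \<in> carrier (VL S)" "n \<ge> 0"
    then show "YV v n (VL_vac S) = \<zero>\<^bsub>VL S\<^esub>"
      by (auto elim!: VL_cases simp: q_vac'[symmetric] FF.good_vac[OF FF.Yf_good] qW)
  next
    fix u' v' w' and m n l :: int
    assume "u' \<in> carrier (VL S)" "v' \<in> carrier (VL S)" "w' \<in> carrier (VL S)"
    then obtain u v w where [simp]: "p u = u" "p v = v" "p w = w" and e: "u' = q u" "v' = q v" "w' = q w"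
      by (auto elim!: VL_cases)
    have "fsum (VL S) (\<lambda>i. (of_int m gchoose i) \<odot>\<^bsub>VL S\<^esub> YV (YV (q u) (l + int i) (q v)) (m + n - int i) (q w))
        = q (pscale.borcherds_lhs FF.Yf u v l m n w)"
      by (simp add: qW pscale.borcherds_lhs_def fsum_q)
    then show "fsum (VL S) (\<lambda>i. (of_int m gchoose i) \<odot>\<^bsub>VL S\<^esub> YV (YV u' (l + int i) v') (m + n - int i) w')
         = fsum (VL S) (\<lambda>i. ((-1) ^ i * (of_int l gchoose i)) \<odot>\<^bsub>VL S\<^esub>
             (YV u' (m + l - int i) (YV v' (n + int i) w') \<ominus>\<^bsub>VL S\<^esub>
              ((-1) powi l) \<odot>\<^bsub>VL S\<^esub> YV v' (n + l - int i) (YV u' (m + int i) w')))"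
      by (simp only: e bor_fsum[OF \<open>p u = u\<close> \<open>p v = v\<close> \<open>p w = w\<close>] FF.Yf_jacobi)
  qed
  ultimately show ?thesis by (simp add: vertex_algebra_def)
qed

lemma Yf_md: "FF.Yf (md v (-1) vac) = md v"
  by (simp add: FF.Yf_G)

lemma Yf_md_iterate: "FF.Yf (md v k x) = pscale.bor (md v) (FF.Yf x) k 0"
  using FF.Yf_prod[of "md v (-1) vac" k x] by (simp add: Yf_md)

lemma YV_mode: "z \<in> carrier (VL S) \<Longrightarrow> YV (VL_emb S v) n z = VL_mode S v n z"
proof -
  assume "z \<in> carrier (VL S)"
  then obtain w where w: "p w = w" "z = q w" by (rule VL_cases)
  then have "YV (q (md v (-1) vac)) n (q w) = q (md v n w)" by (simp add: Yf_md)
  then show ?thesis using w by (simp only: q_emb q_mode)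
qed

text \<open>Induction on \<open>w\<close>: the Borcherds identity at m = 0 expresses the field of
  v(k) x through those of v and x, and the field of v is prescribed. This makes the choice in
  \<open>VL_Y\<close> harmless.\<close>

lemma vertex_structure_unique:
  assumes Y: "vertex_algebra (VL S) (VL_vac S) Y"
    and mode: "\<And>v n z. z \<in> carrier (VL S) \<Longrightarrow> Y (VL_emb S v) n z = VL_mode S v n z"
    and w: "p w = w" "p w' = w'"
  shows "Y (q w) n (q w') = q (FF.Yf w n w')"
proof -
  interpret Y: vertex_algebra "VL S" "VL_vac S" Y by fact
  \<comment> \<open>The induction passes through arbitrary elements of the type, also outside the
    range of \<open>p\<close>; the additional \<open>p\<close> in the predicate gives it a meaning
    there.\<close>
  have "\<forall>n w'. p w' = w' \<longrightarrow> Y (q (p (p w))) n (q w') = q (FF.Yf (p w) n w')"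
  proof (rule md_induct[where P = "\<lambda>x. \<forall>n w'. p w' = w' \<longrightarrow> Y (q (p x)) n (q w') = q (FF.Yf x n w')"])
    show "\<forall>n w'. p w' = w' \<longrightarrow> Y (q (p vac)) n (q w') = q (FF.Yf vac n w')"
      using Y.vacuum by (simp add: q_vac' FF.Yf_vac FF.idf_def qW)
  next
    fix x y
    assume *: "\<forall>n w'. p w' = w' \<longrightarrow> Y (q (p x)) n (q w') = q (FF.Yf x n w')"
      "\<forall>n w'. p w' = w' \<longrightarrow> Y (q (p y)) n (q w') = q (FF.Yf y n w')"
    show "\<forall>n w'. p w' = w' \<longrightarrow> Y (q (p (x + y))) n (q w') = q (FF.Yf (x + y) n w')"
      using Y.Y_add_left[of "q (p x)" "q (p y)"] * by (simp add: qW p_simps FF.Yf_add)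
  next
    fix c x
    assume *: "\<forall>n w'. p w' = w' \<longrightarrow> Y (q (p x)) n (q w') = q (FF.Yf x n w')"
    show "\<forall>n w'. p w' = w' \<longrightarrow> Y (q (p (pscale c x))) n (q w') = q (FF.Yf (pscale c x) n w')"
      using Y.Y_smult_left[of "q (p x)"] * by (simp add: qW p_simps FF.Yf_scale)
  next
    fix v k x
    assume *: "\<forall>n w'. p w' = w' \<longrightarrow> Y (q (p x)) n (q w') = q (FF.Yf x n w')" and x: "p x = x"
    have emb: "Y (VL_emb S v) n (q y) = q (md v n y)" if "p y = y" for n y
      using mode[of "q y"] that by (simp add: qW q_mode)
    have "Y (q (md v k x)) n (q w') = q (FF.Yf (md v k x) n w')" if w': "p w' = w'" for n w'
    proof -
      have c: "VL_emb S v \<in> carrier (VL S)" "q x \<in> carrier (VL S)" "q w' \<in> carrier (VL S)"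
        using x w' by (simp_all add: q_emb[symmetric] qW)
      have *: "Y (q x) n (q w') = q (FF.Yf x n w')" if "p w' = w'" for n w' using * that x by simp
      \<comment> \<open>At m = 0 all binomials except the one for i = 0 vanish, and the left side is
        just the field of v(k) x.\<close>
      have "fsum (VL S) (\<lambda>i. (of_int 0 gchoose i) \<odot>\<^bsub>VL S\<^esub> Y (Y (VL_emb S v) (k + int i) (q x)) (0 + n - int i) (q w'))
        = fsum (VL S) (\<lambda>i. ((-1) ^ i * (of_int k gchoose i)) \<odot>\<^bsub>VL S\<^esub>
             (Y (VL_emb S v) (0 + k - int i) (Y (q x) (n + int i) (q w')) \<ominus>\<^bsub>VL S\<^esub>
              ((-1) powi k) \<odot>\<^bsub>VL S\<^esub> Y (q x) (n + k - int i) (Y (VL_emb S v) (0 + int i) (q w'))))"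
        by (rule Y.jacobi[OF c])
      also have "\<dots> = fsum (VL S) (\<lambda>i. ((-1) ^ i * (of_int k gchoose i)) \<odot>\<^bsub>VL S\<^esub>
             (YV (q (md v (-1) vac)) (0 + k - int i) (YV (q x) (n + int i) (q w')) \<ominus>\<^bsub>VL S\<^esub>
              ((-1) powi k) \<odot>\<^bsub>VL S\<^esub> YV (q x) (n + k - int i) (YV (q (md v (-1) vac)) (0 + int i) (q w'))))"
        using x w' by (simp add: emb * Yf_md)
      also have "\<dots> = q (FF.Yf (md v k x) n w')"
        using x w' by (subst bor_fsum) (simp_all only: Yf_md p_md FF.p_vac, simp only: Yf_md_iterate)
      finally have R: "fsum (VL S) (\<lambda>i. (of_int 0 gchoose i) \<odot>\<^bsub>VL S\<^esub>
        Y (Y (VL_emb S v) (k + int i) (q x)) (0 + n - int i) (q w')) = q (FF.Yf (md v k x) n w')" .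
      define z where "z = Y (q (md v k x)) n (q w')"
      have zc: "z \<in> carrier (VL S)" unfolding z_def using w' by (intro Y.Y_closed) (auto simp: qW)
      have yc: "Y (q (md v j x)) m (q w') \<in> carrier (VL S)" for j m
        using w' by (intro Y.Y_closed) (auto simp: qW)
      obtain y where y: "p y = y" "z = q y" using zc by (rule VL_cases)
      have t: "(of_int 0 gchoose i) \<odot>\<^bsub>VL S\<^esub> Y (Y (VL_emb S v) (k + int i) (q x)) (0 + n - int i) (q w')
         = q (if i = 0 then y else 0)" for i
        using x zc yc by (cases i) (simp_all add: emb z_def[symmetric] y qW(5)[symmetric] VM.smult_l_null[simplified]
            VM.smult_one[simplified])
      have "Sum_any (\<lambda>i::nat. if i = 0 then y else 0) = (\<Sum>i<Suc 0. if i = 0 then y else 0)"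
        by (rule Sum_any_eq_sum) simp
      then have "q y = q (FF.Yf (md v k x) n w')"
        using R unfolding t by (subst (asm) fsum_q) (auto simp: y)
      then show ?thesis using y z_def by simp
    qed
    then show "\<forall>n w'. p w' = w' \<longrightarrow> Y (q (p (md v k x))) n (q w') = q (FF.Yf (md v k x) n w')"
      by simp
  qed
  then show ?thesis using w by simp
qed

lemma VL_Y_props:
  "vertex_algebra (VL S) (VL_vac S) (VL_Y S)"
  "\<And>v n z. z \<in> carrier (VL S) \<Longrightarrow> VL_Y S (VL_emb S v) n z = VL_mode S v n z"
proof -
  have "\<exists>Y. vertex_algebra (VL S) (VL_vac S) Y \<and>
     (\<forall>u n. \<forall>v\<in>carrier (VL S). Y (VL_emb S u) n v = VL_mode S u n v)"
    using vertex_algebra_YV YV_mode by blast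
  from someI_ex[OF this, folded VL_Y_def]
  show "vertex_algebra (VL S) (VL_vac S) (VL_Y S)"
    "\<And>v n z. z \<in> carrier (VL S) \<Longrightarrow> VL_Y S (VL_emb S v) n z = VL_mode S v n z" by auto
qed

lemma VL_Y_q: "p w = w \<Longrightarrow> p w' = w' \<Longrightarrow> VL_Y S (q w) n (q w') = q (FF.Yf w n w')"
  by (rule vertex_structure_unique[OF VL_Y_props])

lemma VL_D_q: "p w = w \<Longrightarrow> VL_D S (q w) = q (tr w)"
  by (simp add: VL_D_def q_vac'[symmetric] VL_Y_q FF.Yf_D)

lemma tr_pow_W: "p w = w \<Longrightarrow> p ((tr ^^ k) w) = (tr ^^ k) w"
  by (induction k) (auto simp: p_tr)

lemma VL_D_pow_q: "p w = w \<Longrightarrow> (VL_D S ^^ k) (q w) = q ((tr ^^ k) w)"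
  by (induction k) (auto simp: VL_D_q tr_pow_W)

end

section \<open>The ideal \<open>I\<^sub>B\<close> and the quotient \<open>V\<^sub>B\<close>\<close>

context vertex_algebroid
begin

lemma lin_span_q_induct [consumes 3, case_names base zero add smult]:
  assumes "R \<subseteq> W" "p w = w" "q w \<in> lin_span (VL S) (q ` R)"
    and "\<And>x. x \<in> R \<Longrightarrow> P x" "P 0" "\<And>x y. P x \<Longrightarrow> P y \<Longrightarrow> P (x + y)" "\<And>c x. P x \<Longrightarrow> P (pscale c x)"
  shows "P w"
proof -
  have c: "q ` R \<subseteq> carrier (VL S)" using assms(1) by (auto simp: qW)
  have "P (iq (q w))"
    using c assms(3)
  proof (induction rule: VM.lin_span_induct)
    case (base z)
    then show ?case using assms(1,4) by auto
  next
    case zero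
    then show ?case using assms(5) by (simp add: qW)
  next
    case (add x y)
    then show ?case using assms(6) by (auto elim!: VL_cases simp: qW)
  next
    case (smult c x)
    then show ?case using assms(7) by (auto elim!: VL_cases simp: qW)
  qed
  then show ?thesis using assms(2) by simp
qed

text \<open>Model versions of the generators of \<open>E\<close>, of \<open>E\<close> and of the generators of \<open>I\<^sub>B\<close>.\<close>

definition RW :: "('a, 'b) free_loop set" where
  "RW = {md (idA S, 0) (-1) vac - vac} \<union>
     {md (a, 0) (-1) (md (a', 0) (-1) vac) - md (a * a', 0) (-1) vac | a a'. True} \<union>
     {md (a, 0) (-1) (md (0, b) (-1) vac) - md (0, act S a b) (-1) vac | a b. True}"

definition EW :: "('a, 'b) free_loop set" where
  "EW = {w. p w = w \<and> q w \<in> VB_relations S}"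

definition GW :: "('a, 'b) free_loop set" where
  "GW = {p (f * (tr ^^ k) r) | f k r. f \<in> fc \<and> r \<in> EW}"

definition IW :: "('a, 'b) free_loop set" where
  "IW = {w. p w = w \<and> q w \<in> VB_ideal S}"

lemma RW_I:
  "md (idA S, 0) (-1) vac - vac \<in> RW"
  "md (a, 0) (-1) (md (a', 0) (-1) vac) - md (a * a', 0) (-1) vac \<in> RW"
  "md (a, 0) (-1) (md (0, b) (-1) vac) - md (0, act S a b) (-1) vac \<in> RW"
  unfolding RW_def by blast+

lemma RW_W: "RW \<subseteq> W"
  by (auto simp: RW_def)

lemma VB_relations_RW: "VB_relations S = lin_span (VL S) (q ` RW)"
proof -
  have "q ` RW = {VL_emb S (idA S, 0) \<ominus>\<^bsub>VL S\<^esub> VL_vac S} \<union>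
      {VL_mode S (a, 0) (-1) (VL_emb S (a', 0)) \<ominus>\<^bsub>VL S\<^esub> VL_emb S (a * a', 0) | a a'. True} \<union>
      {VL_mode S (a, 0) (-1) (VL_emb S (0, b)) \<ominus>\<^bsub>VL S\<^esub> VL_emb S (0, act S a b) | a b. True}"
    unfolding RW_def image_Un
    by (intro arg_cong2[where f = "(\<union>)"]) (auto simp: q_emb[symmetric] q_vac'[symmetric] q_mode[symmetric] qW_minus image_iff)
  then show ?thesis by (simp add: VB_relations_def)
qed

lemma VB_relations_submodule: "submodule (VB_relations S) CC (VL S)"
  unfolding VB_relations_RW using RW_W by (intro VM.lin_span_submodule) (auto simp: qW)

lemma EW_RW: "RW \<subseteq> EW"
  using RW_W VM.lin_span_base[of "q ` RW"] by (auto simp: EW_def VB_relations_RW)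

lemma VB_relations_EW: "VB_relations S = q ` EW"
proof
  show "VB_relations S \<subseteq> q ` EW"
  proof
    fix z assume z: "z \<in> VB_relations S"
    then have "z \<in> carrier (VL S)" using VM.subspaceD(1)[OF VB_relations_submodule] by blast
    then show "z \<in> q ` EW" using z by (auto elim!: VL_cases simp: EW_def)
  qed
qed (auto simp: EW_def)

lemma EW_p: "r \<in> EW \<Longrightarrow> p r = r" by (simp add: EW_def)

lemma GW_I: "f \<in> fc \<Longrightarrow> r \<in> EW \<Longrightarrow> p (f * (tr ^^ k) r) \<in> GW"
  unfolding GW_def by blast

lemma GW_W: "GW \<subseteq> W"
  by (auto simp: GW_def)

lemma VB_ideal_GW: "VB_ideal S = lin_span (VL S) (q ` GW)"
proof -
  have 1: "ind_act LL (lie_nonneg S) (ucl f) ((VL_D S ^^ k) (q r)) = q (p (f * (tr ^^ k) r))"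
    if "f \<in> fc" "r \<in> EW" for f k r
    using that EW_p[of r] tr_pow_W[of r k] by (simp add: VL_D_pow_q q_simps W_fc q_p)
  have "{ind_act LL (lie_nonneg S) u ((VL_D S ^^ k) v) | u k v. u \<in> carrier U \<and> v \<in> VB_relations S} = q ` GW"
  proof
    show "{ind_act LL (lie_nonneg S) u ((VL_D S ^^ k) v) | u k v. u \<in> carrier U \<and> v \<in> VB_relations S} \<subseteq> q ` GW"
      by (auto elim!: U_cases simp: VB_relations_EW 1) (auto simp: GW_def)
    show "q ` GW \<subseteq> {ind_act LL (lie_nonneg S) u ((VL_D S ^^ k) v) | u k v. u \<in> carrier U \<and> v \<in> VB_relations S}"
      unfolding GW_def VB_relations_EW using 1 u_simps(1) by blast
  qed
  then show ?thesis by (simp add: VB_ideal_def)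
qed

lemma VB_ideal_submodule: "submodule (VB_ideal S) CC (VL S)"
  unfolding VB_ideal_GW using GW_W by (intro VM.lin_span_submodule) (auto simp: qW)

lemma IW_p: "w \<in> IW \<Longrightarrow> p w = w" by (simp add: IW_def)

lemma IW_closed: "0 \<in> IW" "w \<in> IW \<Longrightarrow> w' \<in> IW \<Longrightarrow> w + w' \<in> IW" "w \<in> IW \<Longrightarrow> pscale c w \<in> IW"
  using VM.subspaceD(2)[OF VB_ideal_submodule] VM.subspaceD(3)[OF VB_ideal_submodule, of "q w" "q w'"]
    VM.subspaceD(4)[OF VB_ideal_submodule, of "q w" c]
  by (simp_all add: IW_def qW)

lemma IW_neg: "w \<in> IW \<Longrightarrow> - w \<in> IW"
  using IW_closed(3)[of w "-1"] by simp

lemma IW_diff: "w \<in> IW \<Longrightarrow> w' \<in> IW \<Longrightarrow> w - w' \<in> IW"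
  using IW_closed(2)[of w "- w'"] IW_neg[of w'] by simp

lemma IW_sum: "(\<And>i. i \<in> T \<Longrightarrow> f i \<in> IW) \<Longrightarrow> sum f T \<in> IW"
  by (induction T rule: infinite_finite_induct) (auto intro: IW_closed)

lemma IW_Sum_any: "(\<And>i. f i \<in> IW) \<Longrightarrow> Sum_any f \<in> IW"
  by (simp add: Sum_any.expand_set IW_sum)

lemma GW_IW: "GW \<subseteq> IW"
  using GW_W VM.lin_span_base[of "q ` GW"] by (auto simp: IW_def VB_ideal_GW)

lemma IW_induct [consumes 1, case_names base zero add smult]:
  assumes "w \<in> IW" "\<And>x. x \<in> GW \<Longrightarrow> P x" "P 0" "\<And>x y. P x \<Longrightarrow> P y \<Longrightarrow> P (x + y)" "\<And>c x. P x \<Longrightarrow> P (pscale c x)"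
  shows "P w"
  by (rule lin_span_q_induct[OF GW_W, of w P]) (use assms in \<open>auto simp: IW_def VB_ideal_GW\<close>)

lemma EW_IW: assumes "r \<in> EW" shows "(tr ^^ k) r \<in> IW"
proof -
  have "p (1 * (tr ^^ k) r) \<in> GW" unfolding GW_def using assms by blast
  then show ?thesis using GW_IW tr_pow_W[OF EW_p[OF assms]] by auto
qed

lemma IW_md: assumes "w \<in> IW" shows "md v n w \<in> IW"
  using assms
proof (induction rule: IW_induct)
  case (base x)
  then obtain f k r where x: "x = p (f * (tr ^^ k) r)" "f \<in> fc" "r \<in> EW" by (auto simp: GW_def)
  have t: "(tr ^^ k) r \<in> fc" using tr_pow_W[OF EW_p[OF x(3)]] by (rule W_fc)
  have "md v n x = p ((gen (lie_mode S v n) * f) * (tr ^^ k) r)"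
    using x t by (simp add: md_def op_eq mult.assoc)
  moreover have "gen (lie_mode S v n) * f \<in> fc" using x by auto
  ultimately show ?case using GW_I[OF _ x(3)] GW_IW by auto
qed (auto simp: md_simps IW_closed)

text \<open>In I_B the powers of the translation operator stand inside and the modes outside. Moving
  \<open>tr\<close> inwards by \<open>tr_md\<close> leaves a mode applied to the untranslated
  vector, so membership of x and of \<open>tr x\<close> is carried through the induction
  together.\<close>

lemma IW_tr: assumes "w \<in> IW" shows "tr w \<in> IW"
  using assms
proof (induction rule: IW_induct)
  case (base x)
  then obtain f k r where x: "x = p (f * (tr ^^ k) r)" "f \<in> fc" "r \<in> EW" by (auto simp: GW_def)
  have "p (f * (tr ^^ k) r) \<in> IW \<and> tr (p (f * (tr ^^ k) r)) \<in> IW"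
  proof (rule md_mult_closed[where P = "\<lambda>w. w \<in> IW \<and> tr w \<in> IW"])
    show "(tr ^^ k) r \<in> IW \<and> tr ((tr ^^ k) r) \<in> IW"
      using EW_IW[OF x(3), of k] EW_IW[OF x(3), of "Suc k"] by simp
  qed (use x tr_pow_W EW_p in \<open>auto simp: lin_map_simps[OF tr_lin] IW_closed tr_md IW_diff IW_md\<close>)
  then show ?case by (simp add: x)
qed (auto simp: lin_map_simps[OF tr_lin] IW_closed)

text \<open>I_B as the least subspace that contains the generating relations and is stable under
  modes and translation. In this form its invariance under a map that intertwines both is
  immediate.\<close>

lemma IW_minimal:
  assumes "w \<in> IW" "P 0" "\<And>x y. P x \<Longrightarrow> P y \<Longrightarrow> P (x + y)" "\<And>c x. P x \<Longrightarrow> P (pscale c x)"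
    and "\<And>r. r \<in> RW \<Longrightarrow> P r" "\<And>v n x. P x \<Longrightarrow> P (md v n x)" "\<And>x. P x \<Longrightarrow> P (tr x)"
  shows "P w"
  using assms(1)
proof (induction rule: IW_induct)
  case (base x)
  then obtain f k r where x: "x = p (f * (tr ^^ k) r)" "f \<in> fc" "r \<in> EW" by (auto simp: GW_def)
  have "P r"
    by (rule lin_span_q_induct[OF RW_W, of r P]) (use x assms in \<open>auto simp: EW_def VB_relations_RW\<close>)
  then have k: "P ((tr ^^ k) r)" by (induction k) (simp_all add: assms(7))
  show ?case
    unfolding x(1)
    by (rule md_mult_closed[where P = P, OF k tr_pow_W[OF EW_p[OF x(3)]] x(2)])
      (simp_all add: assms(3,4,6))
qed (simp_all add: assms(2-4))

lemma bor_IW: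
  assumes "\<And>i. pscale.bor_term a b l m n w i \<in> IW"
  shows "pscale.bor a b l m n w \<in> IW"
  unfolding pscale.bor_def by (intro IW_Sum_any IW_closed assms)

lemma IW_right: assumes "i \<in> IW" shows "FF.Yf u n i \<in> IW"
proof -
  have "\<forall>n. \<forall>i\<in>IW. FF.Yf (p u) n i \<in> IW"
  proof (rule md_induct)
    show "\<forall>n. \<forall>i\<in>IW. FF.Yf vac n i \<in> IW"
      by (auto simp: FF.Yf_vac FF.idf_def IW_p IW_closed)
    show "\<forall>n. \<forall>i\<in>IW. FF.Yf (md v k x) n i \<in> IW" if "\<forall>n. \<forall>i\<in>IW. FF.Yf x n i \<in> IW" for v k x
      using that unfolding Yf_md_iterate
      by (intro allI ballI bor_IW) (auto simp: pscale.bor_term_def intro!: IW_diff IW_closed IW_md)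
  qed (auto simp: FF.Yf_add FF.Yf_scale IW_closed)
  then show ?thesis using assms by (simp add: FF.Yf_p)
qed

text \<open>On the vacuum, i(-1) gives \<open>i\<close> back and the lower modes follow by
  covariance and \<open>IW_tr\<close>. On v(k) x, the Borcherds identity with l = 0 writes the
  commutator of v(k) and i(n) as a sum of modes of the vectors v(j) i, which lie in
  \<open>IW\<close> again; hence the induction covers all \<open>i\<close> at once.\<close>

lemma IW_left: assumes "i \<in> IW" shows "FF.Yf i n w \<in> IW"
proof -
  have v: "FF.Yf i n vac \<in> IW" if i: "i \<in> IW" for i n
  proof (cases "n \<ge> 0")
    case True
    then show ?thesis by (simp add: FF.good_vac[OF FF.Yf_good] IW_closed)
  next
    case False
    have "FF.Yf i (- int k - 1) vac \<in> IW" for k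
    proof (induction k)
      case 0
      then show ?case using i by (simp add: FF.Yf IW_p)
    next
      case (Suc k)
      define c :: complex where "c = of_int (- int k - 1)"
      have "c \<noteq> 0" unfolding c_def of_int_eq_0_iff by linarith
      have "tr (FF.Yf i (- int k - 1) vac) = FF.Yf i (- int k - 1) (tr vac) - pscale c (FF.Yf i (- int k - 1 - 1) vac)"
        unfolding c_def by (rule FF.good_cov[OF FF.Yf_good])
      then have "pscale c (FF.Yf i (- int k - 1 - 1) vac) = - tr (FF.Yf i (- int k - 1) vac)"
        by (simp add: tr_vac FF.Yf_simps)
      then have "pscale (inverse c) (pscale c (FF.Yf i (- int k - 1 - 1) vac)) \<in> IW"
        using Suc by (auto intro!: IW_closed IW_neg IW_tr)
      then show ?case using \<open>c \<noteq> 0\<close> by (simp add: algebra_simps)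
    qed
    from this[of "nat (- n - 1)"] False show ?thesis by simp
  qed
  have "\<forall>i\<in>IW. \<forall>n. FF.Yf i n (p w) \<in> IW"
  proof (rule md_induct)
    show "\<forall>i\<in>IW. \<forall>n. FF.Yf i n vac \<in> IW" using v by blast
    show "\<forall>i\<in>IW. \<forall>n. FF.Yf i n (md v k x) \<in> IW" if x: "\<forall>i\<in>IW. \<forall>n. FF.Yf i n x \<in> IW" for v k x
    proof (intro ballI allI)
      fix i n assume i: "i \<in> IW"
      have "pscale.borcherds_lhs FF.Yf (md v (-1) vac) i 0 k n x = md v k (FF.Yf i n x) - FF.Yf i n (md v k x)"
        unfolding FF.Yf_jacobi Yf_md by (rule pscale.bor_0[OF md_fld FF.Yf_fld])
      moreover have "pscale.borcherds_lhs FF.Yf (md v (-1) vac) i 0 k n x \<in> IW"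
        unfolding pscale.borcherds_lhs_def Yf_md using x i by (intro IW_Sum_any IW_closed) (auto intro: IW_md)
      moreover have "md v k (FF.Yf i n x) \<in> IW" using x i by (auto intro: IW_md)
      ultimately show "FF.Yf i n (md v k x) \<in> IW"
        using IW_diff[of "md v k (FF.Yf i n x)" "md v k (FF.Yf i n x) - FF.Yf i n (md v k x)"] by simp
    qed
  qed (auto simp: FF.Yf_simps IW_closed)
  then show ?thesis using assms FF.good_p[OF FF.Yf_good] by simp
qed

section \<open>The quotient by I_B and the maps that descend to it\<close>

sublocale VQ: cquot "VL S" "VB_ideal S"
  by (simp add: cquot_def cquot_axioms_def VM.cmodule_axioms VB_ideal_submodule)

definition qq where "qq w = VB_ideal S +>\<^bsub>VL S\<^esub> q w"

lemma VB_ideal_cases: assumes "z \<in> VB_ideal S" obtains w where "w \<in> IW" "z = q w"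
proof -
  have "z \<in> carrier (VL S)" using assms VM.subspaceD(1)[OF VB_ideal_submodule] by blast
  then obtain w where "p w = w" "z = q w" by (rule VL_cases)
  then show ?thesis using assms that[of w] by (simp add: IW_def)
qed

lemma qq_simps:
  "p w = w \<Longrightarrow> qq w \<in> carrier (VB S)"
  "p w = w \<Longrightarrow> p w' = w' \<Longrightarrow> qq w \<oplus>\<^bsub>VB S\<^esub> qq w' = qq (w + w')"
  "p w = w \<Longrightarrow> c \<odot>\<^bsub>VB S\<^esub> qq w = qq (pscale c w)"
  "p w = w \<Longrightarrow> p w' = w' \<Longrightarrow> qq w = qq w' \<longleftrightarrow> w - w' \<in> IW"
  using VQ.coset_in_Q[of "q w"] VQ.add_Q[of "q w" "q w'"] VQ.smult_Q[of "q w" c] VQ.coset_eq_iff[of "q w" "q w'"]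
  by (simp_all add: qq_def VB_def qW qW_minus IW_def)

lemma qq_Y:
  assumes "p w = w" "p w' = w'"
  shows "VB_Y S (qq w) n (qq w') = qq (FF.Yf w n w')"
proof -
  interpret Y: vertex_algebra "VL S" "VL_vac S" "VL_Y S" by (rule VL_Y_props)
  have "VB_Y S (qq w) n (qq w') = VB_ideal S +>\<^bsub>VL S\<^esub> VL_Y S (q w) n (q w')"
    unfolding VB_Y_def qq_def
  proof (rule VQ.union_map2)
    show "VL_Y S x n y \<in> VB_ideal S" "VL_Y S y n x \<in> VB_ideal S"
      if "x \<in> VB_ideal S" "y \<in> carrier (VL S)" for x y
    proof -
      obtain i where "i \<in> IW" "x = q i" using VB_ideal_cases[OF \<open>x \<in> VB_ideal S\<close>] .
      moreover obtain y' where "p y' = y'" "y = q y'" using VL_cases[OF \<open>y \<in> carrier (VL S)\<close>] .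
      ultimately have "i \<in> IW" "x = q i" "p y' = y'" "y = q y'" by auto
      then show "VL_Y S x n y \<in> VB_ideal S" "VL_Y S y n x \<in> VB_ideal S"
        using IW_left[of i n y'] IW_right[of i y' n] by (auto simp: VL_Y_q IW_def)
    qed
  qed (use assms in \<open>auto simp: qW Y.Y_closed Y.Y_add_left Y.Y_add_right\<close>)
  then show ?thesis using assms by (simp add: VL_Y_q qq_def)
qed

lemma VB_cases: assumes "z \<in> carrier (VB S)" obtains w where "p w = w" "z = qq w"
  using assms by (auto elim!: VQ.Q_cases VL_cases simp: VB_def qq_def)

lemma qq_vac: "VB_vac S = qq vac" and qq_emb: "VB_emb S v = qq (md v (-1) vac)"
  by (simp_all add: VB_vac_def VB_emb_def qq_def q_vac' q_emb)

definition lifts :: "('a \<times> 'b \<Rightarrow> 'a \<times> 'b) \<Rightarrow> (('a, 'b) free_loop \<Rightarrow> ('a, 'b) free_loop) \<Rightarrow> bool" where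
  "lifts g \<gamma> \<longleftrightarrow> lin_map pscale pscale \<gamma> \<and> \<gamma> vac = vac \<and> (\<forall>w. \<gamma> (p w) = \<gamma> w) \<and> (\<forall>w. p (\<gamma> w) = \<gamma> w) \<and>
     (\<forall>v n w. \<gamma> (md v n w) = md (g v) n (\<gamma> w)) \<and> (\<forall>w\<in>IW. \<gamma> w \<in> IW)"

text \<open>Compatibility with anchor, bracket and pairing gives \<open>g0\<close> and
  \<open>g1\<close>, hence the commutation relations for the twisted modes, and compatibility with
  \<open>del\<close> gives the remaining relation. The unit, the product and the action of A are
  what send each generator in \<open>RW\<close> to a generator. The map commutes with
  \<open>tr\<close> because both composites obey the same recursion along modes.\<close>

lemma lift_exists:
  assumes "algebroid_endo S g"
  shows "\<exists>\<gamma>. lifts g \<gamma>"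
proof -
  obtain fA fB where g_lin: "Vector_Spaces.linear (smulC S) (smulC S) g"
    and gA: "\<And>a. g (a, 0) = (fA a, 0)" and gB: "\<And>b. g (0, b) = (0, fB b)"
    and f1: "fA (idA S) = idA S" and fm: "\<And>a a'. fA (a * a') = fA a * fA a'"
    and fl: "\<And>u v. fB (lbr S u v) = lbr S (fB u) (fB v)"
    and fact: "\<And>a b. fB (act S a b) = act S (fA a) (fB b)"
    and fp: "\<And>u v. pairing S (fB u) (fB v) = fA (pairing S u v)"
    and fd: "\<And>a. fB (del S a) = del S (fA a)" and fan: "\<And>a b. fA (anchor S b a) = anchor S (fB b) (fA a)"
    using assms unfolding algebroid_endo_def by blast
  interpret g: Vector_Spaces.linear "smulC S" "smulC S" g by (rule g_lin)
  have g: "g (a, b) = (fA a, fB b)" for a b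
    using g.add[of "(a, 0)" "(0, b)"] by (simp add: gA gB)
  have fA_diff: "fA (a - a') = fA a - fA a'" for a a'
    using g.diff[of "(a, 0)" "(a', 0)"] by (simp add: gA minus_prod_def)
  have g0: "g (prod0 S v v') = prod0 S (g v) (g v')" for v v'
  proof -
    obtain a b a' b' where v: "v = (a, b)" "v' = (a', b')" by (metis surj_pair)
    show ?thesis unfolding v prod0.simps g fA_diff fan fl ..
  qed
  have g1: "g (prod1 S v v') = prod1 S (g v) (g v')" for v v'
  proof -
    obtain a b a' b' where v: "v = (a, b)" "v' = (a', b')" by (metis surj_pair)
    have "fB 0 = 0" using g.zero gB[of 0] by (simp add: zero_prod_def)
    then show ?thesis by (simp only: v prod1.simps g fp)
  qed
  show ?thesis
  proof (rule md_universal[of pscale "\<lambda>v. md (g v)" vac])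
    fix \<gamma> assume \<gamma>: "lin_map pscale pscale \<gamma>" "\<gamma> vac = vac" "\<And>w. \<gamma> (p w) = \<gamma> w"
      "\<And>v n w. \<gamma> (md v n w) = md (g v) n (\<gamma> w)"
    have "p (\<gamma> (p w)) = \<gamma> (p w)" for w
      by (rule md_induct[where P = "\<lambda>x. p (\<gamma> x) = \<gamma> x"])
         (auto simp: \<gamma>(2,4) lin_map_simps[OF \<gamma>(1)])
    then have p\<gamma>: "p (\<gamma> w) = \<gamma> w" for w by (simp add: \<gamma>(3))
    have "\<gamma> (tr (p w)) = tr (\<gamma> (p w))" for w
      by (rule md_induct[where P = "\<lambda>x. \<gamma> (tr x) = tr (\<gamma> x)"])
         (auto simp: \<gamma>(2,4) lin_map_simps[OF \<gamma>(1)] tr_vac tr_md lin_map_simps[OF tr_lin])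
    then have \<gamma>tr: "\<gamma> (tr w) = tr (\<gamma> w)" for w by (simp add: \<gamma>(3) tr_p)
    have RW: "\<gamma> r \<in> RW" if "r \<in> RW" for r
    proof -
      consider (1) "r = md (idA S, 0) (-1) vac - vac"
        | (2) a a' where "r = md (a, 0) (-1) (md (a', 0) (-1) vac) - md (a * a', 0) (-1) vac"
        | (3) a b where "r = md (a, 0) (-1) (md (0, b) (-1) vac) - md (0, act S a b) (-1) vac"
        using \<open>r \<in> RW\<close> unfolding RW_def by blast
      then show ?thesis
        by cases (simp_all add: \<gamma>(2,4) lin_map_simps[OF \<gamma>(1)] gA gB f1 fm fact RW_I)
    qed
    have "\<gamma> w \<in> IW" if "w \<in> IW" for w
      using that
      by (rule IW_minimal)
         (use RW EW_RW EW_IW[of _ 0] in \<open>auto simp: lin_map_simps[OF \<gamma>(1)] IW_closed \<gamma>(4) IW_md \<gamma>tr IW_tr\<close>)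
    then show ?thesis
      using \<gamma> p\<gamma> by (intro exI[of _ \<gamma>]) (simp add: lifts_def)
  next
    show "complex_space (pscale :: complex \<Rightarrow> ('a, 'b) free_loop \<Rightarrow> _)" by unfold_locales
    show "md (g (0, del S a)) n w + pscale (of_int n) (md (g (a, 0)) (n - 1) w) = 0" for a n w
      by (simp add: gA gB fd md_del)
  qed (simp_all add: md_lin g.add md_add g.scale md_scale md_comm g0 g1 md_vac)
qed

end

section \<open>Extension of endomorphisms\<close>

context vertex_algebroid
begin

context
  fixes g \<gamma> assumes lift: "lifts g \<gamma>"
begin

lemma lift_lin: "lin_map pscale pscale \<gamma>" and lift_vac: "\<gamma> vac = vac" and lift_p: "\<gamma> (p w) = \<gamma> w"
  and p_lift: "p (\<gamma> w) = \<gamma> w" and lift_md: "\<gamma> (md v n w) = md (g v) n (\<gamma> w)" and lift_IW: "w \<in> IW \<Longrightarrow> \<gamma> w \<in> IW"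
  using lift by (auto simp: lifts_def simp del: split_paired_All)

lemmas lift_simps = lin_map_simps[OF lift_lin]

lemma lift_Yf: "\<gamma> (FF.Yf u n w) = FF.Yf (\<gamma> u) n (\<gamma> w)"
proof -
  have "\<forall>n w. \<gamma> (FF.Yf (p u) n w) = FF.Yf (\<gamma> (p u)) n (\<gamma> w)"
  proof (rule md_induct)
    show "\<forall>n w. \<gamma> (FF.Yf vac n w) = FF.Yf (\<gamma> vac) n (\<gamma> w)"
      by (simp add: lift_vac FF.Yf_vac FF.idf_def lift_p p_lift lift_simps)
    show "\<forall>n w. \<gamma> (FF.Yf (md v k x) n w) = FF.Yf (\<gamma> (md v k x)) n (\<gamma> w)"
      if x: "\<forall>n w. \<gamma> (FF.Yf x n w) = FF.Yf (\<gamma> x) n (\<gamma> w)" for v k x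
    proof (intro allI)
      fix n w
      have t: "\<gamma> (pscale.bor_term (md v) (FF.Yf x) k 0 n w i) = pscale.bor_term (md (g v)) (FF.Yf (\<gamma> x)) k 0 n (\<gamma> w) i" for i
        using x by (simp add: pscale.bor_term_def lift_simps lift_md)
      have "\<forall>\<^sub>F M in sequentially. \<gamma> (pscale.bor (md v) (FF.Yf x) k 0 n w) =
          pscale.bor (md (g v)) (FF.Yf (\<gamma> x)) k 0 n (\<gamma> w)"
        using pscale.bor_sum_ev[OF md_fld[of v] FF.Yf_fld[of x], of k 0 n w]
          pscale.bor_sum_ev[OF md_fld[of "g v"] FF.Yf_fld[of "\<gamma> x"], of k 0 n "\<gamma> w"]
        by eventually_elim (simp add: lift_simps t)
      then show "\<gamma> (FF.Yf (md v k x) n w) = FF.Yf (\<gamma> (md v k x)) n (\<gamma> w)"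
        by (simp add: Yf_md_iterate lift_md)
    qed
  qed (simp_all add: FF.Yf_add FF.Yf_scale lift_simps)
  then show ?thesis by (simp add: FF.Yf_p lift_p)
qed

text \<open>V_B is spanned from the vacuum by modes of states in A and B, on which \<open>G\<close>
  is prescribed, so every extension is the map induced by \<open>\<gamma>\<close>. This yields
  uniqueness, and it describes the arbitrary extension in \<open>aut_extension\<close>.\<close>

lemma endo_qq:
  assumes G: "va_endo (VB S) (VB_vac S) (VB_Y S) G" and ext: "extends_to_VB S g G" and w: "p w = w"
  shows "G (qq w) = qq (\<gamma> w)"
proof -
  note G' = G[unfolded va_endo_def]
  have "G (qq (p (p w))) = qq (\<gamma> (p w))"
  proof (rule md_induct[where P = "\<lambda>x. G (qq (p x)) = qq (\<gamma> x)"])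
    show "G (qq (p vac)) = qq (\<gamma> vac)" using G' by (simp add: lift_vac qq_vac[symmetric])
    show "G (qq (p (x + y))) = qq (\<gamma> (x + y))" if "G (qq (p x)) = qq (\<gamma> x)" "G (qq (p y)) = qq (\<gamma> y)" for x y
    proof -
      have "G (qq (p x) \<oplus>\<^bsub>VB S\<^esub> qq (p y)) = qq (\<gamma> x) \<oplus>\<^bsub>VB S\<^esub> qq (\<gamma> y)"
        using G' that by (simp add: qq_simps(1))
      then show ?thesis by (simp add: qq_simps(2) p_simps lift_simps p_lift)
    qed
    show "G (qq (p (pscale c x))) = qq (\<gamma> (pscale c x))" if "G (qq (p x)) = qq (\<gamma> x)" for c x
    proof -
      have "G (c \<odot>\<^bsub>VB S\<^esub> qq (p x)) = c \<odot>\<^bsub>VB S\<^esub> qq (\<gamma> x)"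
        using G' that by (simp add: qq_simps(1))
      then show ?thesis by (simp add: qq_simps(3) p_simps lift_simps p_lift)
    qed
    show "G (qq (p (md v k x))) = qq (\<gamma> (md v k x))" if "G (qq (p x)) = qq (\<gamma> x)" "p x = x" for v k x
    proof -
      have "G (VB_Y S (VB_emb S v) k (qq x)) = VB_Y S (VB_emb S (g v)) k (qq (\<gamma> x))"
        using G' that ext by (simp add: qq_simps(1) qq_emb extends_to_VB_def del: split_paired_All)
      then show ?thesis using that by (simp add: qq_emb qq_Y Yf_md lift_md p_lift)
    qed
  qed
  then show ?thesis using w by simp
qed

text \<open>The degree of a mode depends on whether its state lies in A or in B, so the block form
  of \<open>g\<close> enters. A representative is carried along because \<open>\<gamma>\<close> acts
  on representatives and not on cosets.\<close>

lemma VL_homogeneous_lift: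
  assumes "(d, v) \<in> VL_homogeneous S" "\<And>a. g (a, 0) = (fA a, 0)" "\<And>b. g (0, b) = (0, fB b)"
  shows "\<exists>w. p w = w \<and> v = q w \<and> (d, q (\<gamma> w)) \<in> VL_homogeneous S"
  using assms(1)
proof (induction rule: VL_homogeneous.induct)
  case vac
  then show ?case
    using VL_homogeneous.vac by (intro exI[of _ vac]) (simp add: q_vac' lift_vac)
next
  case (modeA d v n a)
  then obtain w where w: "p w = w" "v = q w" "(d, q (\<gamma> w)) \<in> VL_homogeneous S" by blast
  then show ?case
    using VL_homogeneous.modeA[OF w(3), of n "fA a"]
    by (intro exI[of _ "md (a, 0) n w"]) (simp add: q_mode[symmetric] lift_md assms p_lift)
next
  case (modeB d v n b)
  then obtain w where w: "p w = w" "v = q w" "(d, q (\<gamma> w)) \<in> VL_homogeneous S" by blast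
  then show ?case
    using VL_homogeneous.modeB[OF w(3), of n "fB b"]
    by (intro exI[of _ "md (0, b) n w"]) (simp add: q_mode[symmetric] lift_md assms p_lift)
qed

lemma VL_grade_lift:
  assumes "v \<in> VL_grade S d" "\<And>a. g (a, 0) = (fA a, 0)" "\<And>b. g (0, b) = (0, fB b)"
  shows "\<exists>w. p w = w \<and> v = q w \<and> q (\<gamma> w) \<in> VL_grade S d"
proof -
  define T where "T = {v. (int d, v) \<in> VL_homogeneous S}"
  have T: "T \<subseteq> carrier (VL S)"
    using VL_homogeneous_lift[OF _ assms(2,3)] by (fastforce simp: T_def qW)
  note sub = VM.subspaceD[OF VM.lin_span_submodule[OF T]]
  have "v \<in> lin_span (VL S) T" using assms(1) by (simp add: VL_grade_def T_def)
  with T have "\<exists>w. p w = w \<and> v = q w \<and> q (\<gamma> w) \<in> lin_span (VL S) T"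
  proof (induction rule: VM.lin_span_induct)
    case (base v)
    then show ?case
      using VL_homogeneous_lift[OF _ assms(2,3), of "int d" v] VM.lin_span_base[of T] by (auto simp: T_def)
  next
    case zero
    then show ?case using sub(2) by (intro exI[of _ 0]) (simp add: qW lift_simps)
  next
    case (add x y)
    then obtain w w' where w: "p w = w" "x = q w" "q (\<gamma> w) \<in> lin_span (VL S) T"
      "p w' = w'" "y = q w'" "q (\<gamma> w') \<in> lin_span (VL S) T" by blast
    then show ?case
      using sub(3)[OF w(3,6)] by (intro exI[of _ "w + w'"]) (simp add: qW lift_simps p_lift)
  next
    case (smult c x)
    then obtain w where w: "p w = w" "x = q w" "q (\<gamma> w) \<in> lin_span (VL S) T" by blast
    then show ?case
      using sub(4)[OF w(3)] by (intro exI[of _ "pscale c w"]) (simp add: qW lift_simps p_lift)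
  qed
  then show ?thesis by (simp add: VL_grade_def T_def)
qed

lemma endo_exists:
  assumes "\<And>a. g (a, 0) = (fA a, 0)" "\<And>b. g (0, b) = (0, fB b)"
  shows "\<exists>G. G \<in> extensional (carrier (VB S)) \<and>
     graded_va_endo (VB S) (VB_vac S) (VB_Y S) (VB_grade S) G \<and> extends_to_VB S g G"
proof -
  \<comment> \<open>The chosen representative is irrelevant because \<open>\<gamma>\<close>
    preserves \<open>IW\<close>. Restricting to the carrier fixes the values outside it, as the
    uniqueness statement for HOL functions demands.\<close>
  define G where "G = restrict (\<lambda>Z. qq (\<gamma> (SOME w. p w = w \<and> Z = qq w))) (carrier (VB S))"
  have G: "G (qq w) = qq (\<gamma> w)" if w: "p w = w" for w
  proof -
    have "p (SOME w'. p w' = w' \<and> qq w = qq w') = (SOME w'. p w' = w' \<and> qq w = qq w') \<and>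
      qq w = qq (SOME w'. p w' = w' \<and> qq w = qq w')"
      by (rule someI[of _ w]) (simp add: w)
    moreover define w' where "w' = (SOME w'. p w' = w' \<and> qq w = qq w')"
    ultimately have w': "p w' = w'" "w - w' \<in> IW" using w by (auto simp: qq_simps(4))
    have "qq (\<gamma> w) = qq (\<gamma> w')"
      using lift_IW[OF w'(2)] by (simp add: qq_simps(4) p_lift lift_simps)
    then show ?thesis using w by (simp add: G_def qq_simps(1) w'_def)
  qed
  have "va_endo (VB S) (VB_vac S) (VB_Y S) G"
    unfolding va_endo_def
  proof (intro conjI ballI allI)
    show "G \<in> carrier (VB S) \<rightarrow> carrier (VB S)"
      by (auto elim!: VB_cases simp: G qq_simps(1) p_lift)
    show "G (VB_vac S) = VB_vac S" by (simp add: qq_vac G lift_vac)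
  next
    fix u v assume "u \<in> carrier (VB S)" "v \<in> carrier (VB S)"
    then show "G (u \<oplus>\<^bsub>VB S\<^esub> v) = G u \<oplus>\<^bsub>VB S\<^esub> G v"
      by (auto elim!: VB_cases simp: G qq_simps(2) p_lift lift_simps)
  next
    fix c v assume "v \<in> carrier (VB S)"
    then show "G (c \<odot>\<^bsub>VB S\<^esub> v) = c \<odot>\<^bsub>VB S\<^esub> G v"
      by (auto elim!: VB_cases simp: G qq_simps(3) p_lift lift_simps)
  next
    fix u v and n :: int assume "u \<in> carrier (VB S)" "v \<in> carrier (VB S)"
    then show "G (VB_Y S u n v) = VB_Y S (G u) n (G v)"
      by (auto elim!: VB_cases simp: G qq_Y p_lift lift_Yf)
  qed
  moreover have "G ` VB_grade S d \<subseteq> VB_grade S d" for d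
  proof
    fix z assume "z \<in> G ` VB_grade S d"
    then obtain v where v: "v \<in> VL_grade S d" "z = G (VB_ideal S +>\<^bsub>VL S\<^esub> v)"
      by (auto simp: VB_grade_def)
    obtain w where "p w = w" "v = q w" "q (\<gamma> w) \<in> VL_grade S d"
      using VL_grade_lift[OF v(1) assms] by blast
    then show "z \<in> VB_grade S d"
      using v(2) G[of w] by (simp add: VB_grade_def qq_def)
  qed
  moreover have "extends_to_VB S g G"
    by (simp add: extends_to_VB_def qq_emb G lift_md lift_vac del: split_paired_All)
  ultimately show ?thesis
    by (intro exI[of _ G]) (simp add: graded_va_endo_def G_def)
qed

end

section \<open>Inverses, uniqueness of the extension, and automorphisms\<close>

lemma lifts_inverse:
  assumes "lifts g \<gamma>" "lifts h \<delta>" "\<And>v. h (g v) = v" "p w = w"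
  shows "\<delta> (\<gamma> w) = w"
proof -
  have "\<delta> (\<gamma> (p w)) = p w"
    by (rule md_induct[where P = "\<lambda>x. \<delta> (\<gamma> x) = x"])
       (simp_all add: lift_vac[OF assms(1)] lift_vac[OF assms(2)] lift_simps[OF assms(1)] lift_simps[OF assms(2)]
         lift_md[OF assms(1)] lift_md[OF assms(2)] assms(3) del: split_paired_All)
  then show ?thesis using assms(4) by simp
qed

text \<open>As \<open>g\<close> is block diagonal, bijectivity passes to \<open>fA\<close> and
  \<open>fB\<close>, and the inverse is block diagonal too. Each structural identity for the inverse
  is checked after applying the injective \<open>fA\<close> or \<open>fB\<close>.\<close>

lemma algebroid_endo_inv:
  assumes "algebroid_aut S g"
  shows "algebroid_endo S (inv_into UNIV g)"
proof -
  have bij: "bij g" using assms by (simp add: algebroid_aut_def)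
  obtain fA fB where g_lin: "Vector_Spaces.linear (smulC S) (smulC S) g"
    and gA: "\<And>a. g (a, 0) = (fA a, 0)" and gB: "\<And>b. g (0, b) = (0, fB b)"
    and f: "fA (idA S) = idA S" "\<And>a a'. fA (a * a') = fA a * fA a'"
    "\<And>u v. fB (lbr S u v) = lbr S (fB u) (fB v)"
    "\<And>a b. fB (act S a b) = act S (fA a) (fB b)"
    "\<And>u v. pairing S (fB u) (fB v) = fA (pairing S u v)"
    "\<And>a. fB (del S a) = del S (fA a)" "\<And>a b. fA (anchor S b a) = anchor S (fB b) (fA a)"
    using assms unfolding algebroid_aut_def algebroid_endo_def by blast
  interpret g: Vector_Spaces.linear "smulC S" "smulC S" g by (rule g_lin)
  have g: "g (a, b) = (fA a, fB b)" for a b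
    using g.add[of "(a, 0)" "(0, b)"] by (simp add: gA gB)
  define hA where "hA a = fst (inv_into UNIV g (a, 0))" for a
  define hB where "hB b = snd (inv_into UNIV g (0, b))" for b
  have gi: "g (inv_into UNIV g x) = x" and ig: "inv_into UNIV g (g x) = x" for x
    using bij by (simp_all add: bij_is_surj surj_f_inv_f bij_is_inj)
  have inj: "fA a = fA a' \<Longrightarrow> a = a'" "fB b = fB b' \<Longrightarrow> b = b'" for a a' b b'
    using ig gA gB by (metis prod.inject)+
  have fhA: "fA (hA a) = a" for a
    using gi[of "(a, 0)"] g[of "hA a" "snd (inv_into UNIV g (a, 0))"] by (simp add: hA_def)
  have fhB: "fB (hB b) = b" for b
    using gi[of "(0, b)"] g[of "fst (inv_into UNIV g (0, b))" "hB b"] by (simp add: hB_def)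
  have hA: "inv_into UNIV g (a, 0) = (hA a, 0)" for a
    using ig[of "(hA a, 0)"] by (simp add: gA fhA)
  have hB: "inv_into UNIV g (0, b) = (0, hB b)" for b
    using ig[of "(0, hB b)"] by (simp add: gB fhB)
  have "inv_into UNIV g (x + y) = inv_into UNIV g x + inv_into UNIV g y" "inv_into UNIV g (smulC S c x) = smulC S c (inv_into UNIV g x)" for x y c
    using ig[of "inv_into UNIV g x + inv_into UNIV g y"] ig[of "smulC S c (inv_into UNIV g x)"] by (simp_all add: g.add g.scale gi)
  then have "Vector_Spaces.linear (smulC S) (smulC S) (inv_into UNIV g)"
    by (intro Vector_Spaces.linear_iff[THEN iffD2]) (simp add: vC.vector_space_axioms)
  moreover have "hA (idA S) = idA S" "\<And>a a'. hA (a * a') = hA a * hA a'"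
    "\<And>u v. hB (lbr S u v) = lbr S (hB u) (hB v)"
    "\<And>a b. hB (act S a b) = act S (hA a) (hB b)"
    "\<And>u v. pairing S (hB u) (hB v) = hA (pairing S u v)"
    "\<And>a. hB (del S a) = del S (hA a)" "\<And>a b. hA (anchor S b a) = anchor S (hB b) (hA a)"
    by (rule inj; simp add: f fhA fhB; fail | (rule inj(1), simp add: f(5)[symmetric] fhA fhB))+
  ultimately show ?thesis
    unfolding algebroid_endo_def using hA hB by blast
qed

lemma endo_extension:
  assumes "algebroid_endo S g"
  shows "\<exists>!G. G \<in> extensional (carrier (VB S)) \<and>
     graded_va_endo (VB S) (VB_vac S) (VB_Y S) (VB_grade S) G \<and> extends_to_VB S g G"
proof -
  obtain \<gamma> where \<gamma>: "lifts g \<gamma>" using lift_exists[OF assms] by blast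
  obtain fA fB where "\<And>a. g (a, 0) = (fA a, 0)" "\<And>b. g (0, b) = (0, fB b)"
    using assms unfolding algebroid_endo_def by blast
  from endo_exists[OF \<gamma> this] obtain G where G: "G \<in> extensional (carrier (VB S))"
    "graded_va_endo (VB S) (VB_vac S) (VB_Y S) (VB_grade S) G" "extends_to_VB S g G" by blast
  show ?thesis
  proof (rule ex1I[of _ G])
    fix G' assume G': "G' \<in> extensional (carrier (VB S)) \<and>
      graded_va_endo (VB S) (VB_vac S) (VB_Y S) (VB_grade S) G' \<and> extends_to_VB S g G'"
    show "G' = G"
    proof (rule extensionalityI)
      fix z assume "z \<in> carrier (VB S)"
      then obtain w where w: "p w = w" "z = qq w" by (rule VB_cases)
      show "G' z = G z"
        using endo_qq[OF \<gamma>, of G w] endo_qq[OF \<gamma>, of G' w] G G' w by (simp add: graded_va_endo_def)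
    qed (use G G' in auto)
  qed (use G in simp)
qed

text \<open>The lifts of \<open>g\<close> and of its inverse are mutually inverse on the model. That
  the lift of the inverse also preserves \<open>IW\<close> gives injectivity on V_B, and its values
  provide preimages.\<close>

lemma aut_extension:
  assumes g: "algebroid_aut S g" and G: "graded_va_endo (VB S) (VB_vac S) (VB_Y S) (VB_grade S) G"
    "extends_to_VB S g G"
  shows "graded_va_aut (VB S) (VB_vac S) (VB_Y S) (VB_grade S) G"
proof -
  have bij: "bij g" and endo: "algebroid_endo S g" using g by (simp_all add: algebroid_aut_def)
  obtain \<gamma> \<delta> where \<gamma>: "lifts g \<gamma>" and \<delta>: "lifts (inv_into UNIV g) \<delta>"
    using lift_exists[OF endo] lift_exists[OF algebroid_endo_inv[OF g]] by blast
  have inv: "\<delta> (\<gamma> w) = w" "\<gamma> (\<delta> w) = w" if "p w = w" for w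
    using lifts_inverse[OF \<gamma> \<delta> _ that] lifts_inverse[OF \<delta> \<gamma> _ that] bij
    by (simp_all add: bij_is_inj bij_is_surj surj_f_inv_f del: split_paired_All)
  have Gq: "G (qq w) = qq (\<gamma> w)" if "p w = w" for w
    using endo_qq[OF \<gamma> _ G(2) that] G(1) by (simp add: graded_va_endo_def)
  have "bij_betw G (carrier (VB S)) (carrier (VB S))"
  proof (rule bij_betw_imageI)
    show "inj_on G (carrier (VB S))"
    proof (rule inj_onI)
      fix x y assume "x \<in> carrier (VB S)" "y \<in> carrier (VB S)" "G x = G y"
      then obtain w w' where w: "p w = w" "x = qq w" "p w' = w'" "y = qq w'" "qq (\<gamma> w) = qq (\<gamma> w')"
        by (auto elim!: VB_cases simp: Gq)
      then have "\<gamma> w - \<gamma> w' \<in> IW" by (simp add: qq_simps(4) p_lift[OF \<gamma>])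
      then have "\<delta> (\<gamma> w - \<gamma> w') \<in> IW" by (rule lift_IW[OF \<delta>])
      then show "x = y" using w by (simp add: lift_simps[OF \<delta>] inv qq_simps(4))
    qed
    show "G ` carrier (VB S) = carrier (VB S)"
    proof
      show "G ` carrier (VB S) \<subseteq> carrier (VB S)"
        by (auto elim!: VB_cases simp: Gq qq_simps(1) p_lift[OF \<gamma>])
      show "carrier (VB S) \<subseteq> G ` carrier (VB S)"
      proof
        fix z assume "z \<in> carrier (VB S)"
        then obtain w where w: "p w = w" "z = qq w" by (rule VB_cases)
        then have "z = G (qq (\<delta> w))" by (simp add: Gq p_lift[OF \<delta>] inv)
        then show "z \<in> G ` carrier (VB S)" by (rule image_eqI) (simp add: qq_simps(1) p_lift[OF \<delta>])
      qed
    qed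
  qed
  then show ?thesis using G by (simp add: graded_va_aut_def)
qed

end

theorem proposition2p16:
  fixes S :: "('a::comm_ring, 'b::ab_group_add) algebroid"
    and g :: "'a \<times> 'b \<Rightarrow> 'a \<times> 'b"
  assumes "vertex_algebroid S"
    and "algebroid_endo S g"
  shows "(\<exists>!G. G \<in> extensional (carrier (VB S)) \<and>
             graded_va_endo (VB S) (VB_vac S) (VB_Y S) (VB_grade S) G \<and>
             extends_to_VB S g G) \<and>
         (algebroid_aut S g \<longrightarrow>
           (\<forall>G. graded_va_endo (VB S) (VB_vac S) (VB_Y S) (VB_grade S) G \<and>
                extends_to_VB S g G \<longrightarrow>
                graded_va_aut (VB S) (VB_vac S) (VB_Y S) (VB_grade S) G))"
proof -
  interpret vertex_algebroid S by fact
  show ?thesis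
    using endo_extension[OF assms(2)] aut_extension by blast
qed

end
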